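(* Let $d=2$ and consider any two-dimensional random walk with internal states satisfying the basic assumptions (i)–(iv) for which fourth moments exist, i.e. $\sum_{y\in\mathbb{Z}^2}\|y\|^4A_y$ converges. Then the strong law of large numbers holds for the number of visited sites: $$P\left(\lim_{n\to\infty}\frac{L_2(n)}{E_2(n)}=1\right)=1.$$
   Context: Random walk with internal states (RWwIS). $E=\{1,\dots,s\}$ is a finite set, $d\ge1$ (here $d=2$), and $p_{y,j,k}\ge 0$ ($y\in\mathbb{Z}^d$, $j,k\in E$) satisfy $\sum_{y,k}p_{y,j,k}=1$ for each $j$. The RWwIS is the Markov chain $\xi_n=(\eta_n,\varepsilon_n)$ on $\mathbb{Z}^d\times E$ with $P(\xi_{n+1}=(x',k)\mid \xi_n=(x,j))=p_{x'-x,j,k}$; we start from $\eta_0=0$, the distribution of $\varepsilon_0$ being arbitrary. Put $A_y=(p_{y,j,k})_{j,k}$, $Q=\sum_y A_y$, $M_l=\sum_y y_lA_y$, $\Sigma_{l,m}=\sum_y y_ly_mA_y$, $\underline{1}=(1,\dots,1)^T\in\mathbb{R}^s$. Basic assumptions: (i) the Markov chain $(\varepsilon_n)$ on $E$, whose transition matrix is $Q$, is irreducible and aperiodic; $\mu$ is its unique stationary distribution. (ii) Trivial arithmetic: for $j\in E$ the subgroup of $\mathbb{Z}^d$ generated by all differences $y-y'$ such that for some $n\geq 1$ both $P(\xi_n=(y,j)\mid\xi_0=(0,j))>0$ and $P(\xi_n=(y',j)\mid\xi_0=(0,j))>0$ is $\mathbb{Z}^d$. (iii) Zero mean: $\langle\mu,M_l\underline{1}\rangle=0$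 for all $l$. (iv) The second moments $\sum_y\|y\|^2A_y$ converge and the covariance matrix $\sigma=(\sigma_{l,m})_{1\le l,m\le d}$, $\sigma_{l,m}=\langle\mu,\Sigma_{l,m}\underline{1}\rangle-\langle\mu,M_l(Q-1)^{-1}M_m\underline{1}\rangle-\langle\mu,M_m(Q-1)^{-1}M_l\underline{1}\rangle$, is nonsingular (positive definite); here $(Q-1)^{-1}M_m\underline{1}$ is the unique vector $v$ with $\langle\mu,v\rangle=0$ and $Qv-v=M_m\underline{1}$. $L_d(n)=\#\{\eta_0,\dots,\eta_n\}$ is the number of distinct sites visited up to $n$ steps, and $E_d(n)$ is its expectation. *)

theory Defs
  imports "HOL-Probability.Probability" "HOL-Computational_Algebra.Group_Closure"
begin

text \<open>
  Random walks with internal states on the lattice \<open>int ^ 'd\<close>. The finite type \<open>'e\<close> is the set of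
  internal states, and \<open>p y j k\<close> is the probability of jumping by \<open>y\<close> while the internal state
  changes from \<open>j\<close> to \<open>k\<close>.
\<close>

definition transition_weights :: "(int ^ 'd \<Rightarrow> 'e::finite \<Rightarrow> 'e \<Rightarrow> real) \<Rightarrow> bool" where
  "transition_weights p \<longleftrightarrow>
     (\<forall>y j k. 0 \<le> p y j k) \<and> (\<forall>j. ((\<lambda>(y, k). p y j k) has_sum 1) UNIV)"

text \<open>
  The process \<open>\<xi> n = (\<eta> n, \<epsilon> n)\<close> is a Markov chain with these transition probabilities, started
  from \<open>\<eta> 0 = 0\<close>; the law of \<open>\<epsilon> 0\<close> is unconstrained. The Markov property conditions on the whole
  past \<open>s 0, \<dots>, s n\<close>, whenever that past has positive probability.
\<close>

definition rw_with_internal_states ::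
  "(int ^ 'd \<Rightarrow> 'e::finite \<Rightarrow> 'e \<Rightarrow> real) \<Rightarrow> 'a measure \<Rightarrow> (nat \<Rightarrow> 'a \<Rightarrow> (int ^ 'd) \<times> 'e) \<Rightarrow> bool"
where
  "rw_with_internal_states p M \<xi> \<longleftrightarrow>
     prob_space M \<and>
     (\<forall>n. \<xi> n \<in> measurable M (count_space UNIV)) \<and>
     (AE \<omega> in M. fst (\<xi> 0 \<omega>) = 0) \<and>
     (\<forall>n s. \<P>(\<omega> in M. \<forall>i\<le>n. \<xi> i \<omega> = s i) > 0 \<longrightarrow>
        \<P>(\<omega> in M. \<xi> (Suc n) \<omega> = s (Suc n) \<bar> \<forall>i\<le>n. \<xi> i \<omega> = s i) =
        p (fst (s (Suc n)) - fst (s n)) (snd (s n)) (snd (s (Suc n))))"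

text \<open>
  \<open>nstep p n (x, j) (x', k)\<close> is \<open>P(\<xi>_n = (x', k) | \<xi>_0 = (x, j))\<close>. It is taken from the kernel,
  so that it makes sense for every initial state, whatever the law of \<open>\<xi> 0\<close>.
\<close>

fun nstep ::
  "(int ^ 'd \<Rightarrow> 'e::finite \<Rightarrow> 'e \<Rightarrow> real) \<Rightarrow> nat \<Rightarrow> (int ^ 'd) \<times> 'e \<Rightarrow> (int ^ 'd) \<times> 'e \<Rightarrow> real"
where
  "nstep p 0 u v = (if u = v then 1 else 0)"
| "nstep p (Suc n) u v =
     (\<Sum>\<^sub>\<infinity>w\<in>UNIV. nstep p n u w * p (fst v - fst w) (snd w) (snd v))"

definition real_vec :: "int ^ 'd \<Rightarrow> real ^ 'd" where
  "real_vec y = (\<chi> l. real_of_int (y $ l))"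

definition A_mat :: "(int ^ 'd \<Rightarrow> 'e::finite \<Rightarrow> 'e \<Rightarrow> real) \<Rightarrow> int ^ 'd \<Rightarrow> real ^ 'e ^ 'e" where
  "A_mat p y = (\<chi> j k. p y j k)"

definition Q_mat :: "(int ^ 'd \<Rightarrow> 'e::finite \<Rightarrow> 'e \<Rightarrow> real) \<Rightarrow> real ^ 'e ^ 'e" where
  "Q_mat p = (\<Sum>\<^sub>\<infinity>y\<in>UNIV. A_mat p y)"

definition M_mat :: "(int ^ 'd \<Rightarrow> 'e::finite \<Rightarrow> 'e \<Rightarrow> real) \<Rightarrow> 'd \<Rightarrow> real ^ 'e ^ 'e" where
  "M_mat p l = (\<Sum>\<^sub>\<infinity>y\<in>UNIV. real_of_int (y $ l) *\<^sub>R A_mat p y)"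

definition Sigma_mat ::
  "(int ^ 'd \<Rightarrow> 'e::finite \<Rightarrow> 'e \<Rightarrow> real) \<Rightarrow> 'd \<Rightarrow> 'd \<Rightarrow> real ^ 'e ^ 'e" where
  "Sigma_mat p l m = (\<Sum>\<^sub>\<infinity>y\<in>UNIV. (real_of_int (y $ l) * real_of_int (y $ m)) *\<^sub>R A_mat p y)"

definition moment_converges :: "(int ^ 'd::finite \<Rightarrow> 'e::finite \<Rightarrow> 'e \<Rightarrow> real) \<Rightarrow> nat \<Rightarrow> bool" where
  "moment_converges p r \<longleftrightarrow> (\<lambda>y. norm (real_vec y) ^ r *\<^sub>R A_mat p y) summable_on UNIV"

primrec mat_power :: "real ^ 'e ^ 'e \<Rightarrow> nat \<Rightarrow> real ^ 'e ^ 'e" where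
  "mat_power T 0 = mat 1"
| "mat_power T (Suc n) = mat_power T n ** T"

definition irreducible_chain :: "real ^ 'e ^ 'e \<Rightarrow> bool" where
  "irreducible_chain T \<longleftrightarrow> (\<forall>j k. \<exists>n\<ge>1. mat_power T n $ j $ k > 0)"

definition aperiodic_chain :: "real ^ 'e ^ 'e \<Rightarrow> bool" where
  "aperiodic_chain T \<longleftrightarrow> (\<forall>j. Gcd {n. n \<ge> 1 \<and> mat_power T n $ j $ j > 0} = 1)"

definition stationary_distribution :: "real ^ 'e ^ 'e \<Rightarrow> real ^ 'e \<Rightarrow> bool" where
  "stationary_distribution T \<mu> \<longleftrightarrow>
     (\<forall>j. 0 \<le> \<mu> $ j) \<and> (\<Sum>j\<in>UNIV. \<mu> $ j) = 1 \<and> \<mu> v* T = \<mu>"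

definition trivial_arithmetic :: "(int ^ 'd \<Rightarrow> 'e::finite \<Rightarrow> 'e \<Rightarrow> real) \<Rightarrow> bool" where
  "trivial_arithmetic p \<longleftrightarrow>
     (\<forall>j. group_closure {y - y' | y y'.
        \<exists>n\<ge>1. nstep p n (0, j) (y, j) > 0 \<and> nstep p n (0, j) (y', j) > 0} = UNIV)"

text \<open>
  The vector \<open>(Q - 1)\<^sup>-\<^sup>1 M_m 1\<close>. Note that \<open>Q - 1\<close> is singular; it is inverted on the
  orthogonal complement of \<open>\<mu>\<close>, where under irreducibility and zero mean the solution is unique.
\<close>

definition resolvent_vec ::
  "(int ^ 'd \<Rightarrow> 'e::finite \<Rightarrow> 'e \<Rightarrow> real) \<Rightarrow> real ^ 'e \<Rightarrow> 'd \<Rightarrow> real ^ 'e" where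
  "resolvent_vec p \<mu> m = (THE v. \<mu> \<bullet> v = 0 \<and> Q_mat p *v v - v = M_mat p m *v 1)"

definition covariance_mat ::
  "(int ^ 'd \<Rightarrow> 'e::finite \<Rightarrow> 'e \<Rightarrow> real) \<Rightarrow> real ^ 'e \<Rightarrow> real ^ 'd ^ 'd" where
  "covariance_mat p \<mu> = (\<chi> l m.
     \<mu> \<bullet> (Sigma_mat p l m *v 1)
     - \<mu> \<bullet> (M_mat p l *v resolvent_vec p \<mu> m)
     - \<mu> \<bullet> (M_mat p m *v resolvent_vec p \<mu> l))"

definition basic_assumptions ::
  "(int ^ 'd::finite \<Rightarrow> 'e::finite \<Rightarrow> 'e \<Rightarrow> real) \<Rightarrow> real ^ 'e \<Rightarrow> bool" where
  "basic_assumptions p \<mu> \<longleftrightarrow>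
     irreducible_chain (Q_mat p) \<and> aperiodic_chain (Q_mat p) \<and>
     stationary_distribution (Q_mat p) \<mu> \<and>
     trivial_arithmetic p \<and>
     (\<forall>l. \<mu> \<bullet> (M_mat p l *v 1) = 0) \<and>
     moment_converges p 2 \<and>
     invertible (covariance_mat p \<mu>)"

definition visited_sites :: "(nat \<Rightarrow> 'a \<Rightarrow> (int ^ 'd) \<times> 'e) \<Rightarrow> nat \<Rightarrow> 'a \<Rightarrow> nat" where
  "visited_sites \<xi> n \<omega> = card ((\<lambda>i. fst (\<xi> i \<omega>)) ` {0..n})"

definition expected_visited_sites ::
  "'a measure \<Rightarrow> (nat \<Rightarrow> 'a \<Rightarrow> (int ^ 'd) \<times> 'e) \<Rightarrow> nat \<Rightarrow> real" where
  "expected_visited_sites M \<xi> n = (LINT \<omega>|M. real (visited_sites \<xi> n \<omega>))"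

end

theory Submission
  imports Defs "HOL-Real_Asymp.Real_Asymp"
begin

text \<open>
  The number of visited sites has mean of order \<open>n / log n\<close>, so the law of large numbers follows by
  Chebyshev's inequality and the Borel--Cantelli lemma as soon as its variance is
  \<open>O(n\<^sup>2 / log\<^sup>4 n)\<close>: the relative variance is then \<open>O(1 / log\<^sup>2 n)\<close>, which is summable along times
  growing like \<open>2 powr (i powr (3/4))\<close>, and such times are dense enough for interpolation
  (\<open>ratio_limit_interpolation\<close>) because consecutive ones have ratio tending to 1 and the stationary
  mean is concave in \<open>n\<close> (\<open>stat_mean_concave\<close>).

  The variance bound (\<open>stat_var_upper\<close>) uses Le Gall's idea for the range of a random walk. Cut the walk
  in the middle. Seen from the cut, the past and the future are independent given the internal
  state there, the past being a walk driven by the time-reversed kernel, and the number of sites is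
  the sum of the two numbers minus the number \<open>I\<close> of common sites. If \<open>H\<close> denotes
  the probability of hitting a site by time \<open>n\<close>, then two sites \<open>x\<close>, \<open>y\<close> are both hit with probability
  at most \<open>H(x) H(y - x) + H(y) H(x - y)\<close>, whence the second moment of \<open>I\<close> is bounded by a multiple of
  the square of the sum of \<open>H\<^sup>2\<close>, taken for the walk and for its reversal
  (\<open>intersection_second_moment\<close>). That sum is
  \<open>O(n / log\<^sup>2 n)\<close> (\<open>hit_sum_square_sum\<close>), and feeding this into the doubling recursion for the
  variance gives the bound. The covariance of past and future is bounded because the mean range
  depends on the initial state only up to a constant (\<open>oscillation_bound\<close>); the same fact allows an
  arbitrary initial distribution in the end.

  Decomposing at the first visit compares \<open>H\<close> with the Green function, the expected number of visits up
  to time \<open>n\<close>. So everything rests on two local estimates: the probability of being at a given site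
  at time \<open>n\<close> is at most \<open>A / n\<close> (\<open>occ_upper\<close>), and the probability of being at the origin is at least
  \<open>c / n\<close> for large \<open>n\<close> (\<open>occ_lower\<close>). Both come from Fourier inversion. The characteristic operator
  raised to the power \<open>n\<close> decays like \<open>exp (- c n |t|\<^sup>2)\<close> on the whole torus (\<open>fourier_decay_exists\<close>);
  this is where trivial arithmetic enters. Under diffusive scaling it converges to a Gaussian
  (\<open>char_op_limit\<close>): zero mean makes the Poisson equation solvable, and its solutions correct the
  constant function 1 to an eigenvector up to third order. Dominated convergence then
  gives the lower estimate.
\<close>

section \<open>Expectations under probability mass functions\<close>

abbreviation \<E> :: "'b pmf \<Rightarrow> ('b \<Rightarrow> 'c::{banach, second_countable_topology}) \<Rightarrow> 'c" where
  "\<E> M f \<equiv> measure_pmf.expectation M f"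

lemma power_le_one_plus_power:
  fixes x :: real
  assumes "m \<le> n"
  shows "\<bar>x\<bar> ^ m \<le> 1 + \<bar>x\<bar> ^ n"
proof (cases "\<bar>x\<bar> \<le> 1")
  case True
  then have "\<bar>x\<bar> ^ m \<le> 1" by (simp add: power_le_one)
  then show ?thesis by (simp add: add_increasing2)
next
  case False
  then have "\<bar>x\<bar> ^ m \<le> \<bar>x\<bar> ^ n" using assms by (intro power_increasing) auto
  then show ?thesis by simp
qed

lemma integrable_pmf_bounded:
  fixes f :: "'b \<Rightarrow> 'c::{banach, second_countable_topology}"
  assumes "\<And>x. norm (f x) \<le> B"
  shows "integrable (measure_pmf M) f"
  by (rule measure_pmf.integrable_const_bound[where B = B]) (use assms in auto)

lemma expectation_bind_bounded_real:
  fixes f :: "'b \<Rightarrow> real"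
  assumes "\<And>x. \<bar>f x\<bar> \<le> B"
  shows "\<E> (bind_pmf M N) f =
         \<E> M (\<lambda>x. \<E> (N x) f)"
  unfolding measure_pmf_bind
  by (rule integral_bind[where K = "count_space UNIV" and B = B and B' = 1])
     (use assms in \<open>auto simp: measure_pmf.emeasure_space_1 measure_pmf.finite_measure_axioms
        space_subprob_algebra measure_pmf.subprob_space_axioms\<close>)

lemma expectation_bind_bounded:
  fixes f :: "'b \<Rightarrow> complex"
  assumes f: "\<And>x. norm (f x) \<le> B"
  shows "\<E> (bind_pmf M N) f =
         \<E> M (\<lambda>x. \<E> (N x) f)"
proof -
  have i: "integrable (measure_pmf P) f" for P
    by (rule integrable_pmf_bounded[OF f])
  have E: "norm (\<E> P f) \<le> B" for P
    by (rule order_trans[OF integral_norm_bound], rule measure_pmf.integral_le_const)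
       (use f i in auto)
  have i2: "integrable (measure_pmf M) (\<lambda>x. \<E> (N x) f)"
    by (rule integrable_pmf_bounded[OF E])
  have re: "\<bar>Re (f x)\<bar> \<le> B" and im: "\<bar>Im (f x)\<bar> \<le> B" for x
    using f[of x] abs_Re_le_cmod[of "f x"] abs_Im_le_cmod[of "f x"] by linarith+
  show ?thesis
    using expectation_bind_bounded_real[of "\<lambda>x. Re (f x)", OF re, of M N]
          expectation_bind_bounded_real[of "\<lambda>x. Im (f x)", OF im, of M N]
    by (simp add: complex_eq_iff i i2 flip: integral_Re integral_Im)
qed

lemma expectation_pair_mono:
  fixes f g :: "'b \<Rightarrow> 'c \<Rightarrow> real"
  assumes "\<And>y k. \<bar>f y k\<bar> \<le> B" "\<And>y k. \<bar>g y k\<bar> \<le> C" "\<And>y k. f y k \<le> g y k"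
  shows "\<E> M (\<lambda>(y, k). f y k) \<le> \<E> M (\<lambda>(y, k). g y k)"
proof (rule integral_mono)
  show "integrable M (\<lambda>(y, k). f y k)"
    by (rule integrable_pmf_bounded[where B = B]) (use assms in auto)
  show "integrable M (\<lambda>(y, k). g y k)"
    by (rule integrable_pmf_bounded[where B = C]) (use assms in auto)
qed (use assms in auto)

lemma prob_bind_pmf:
  "measure_pmf.prob (bind_pmf M N) S = \<E> M (\<lambda>x. measure_pmf.prob (N x) S)"
proof -
  have "\<E> (bind_pmf M N) (indicator S :: _ \<Rightarrow> real) =
        \<E> M (\<lambda>x. \<E> (N x) (indicator S))"
    by (rule expectation_bind_bounded_real[where B = 1]) (auto simp: indicator_def)
  then show ?thesis by simp
qed

lemma prob_map_pmf: "measure_pmf.prob (map_pmf f M) S = measure_pmf.prob M (f -` S)"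
  by simp

lemma finite_bound:
  fixes f :: "'e::finite \<Rightarrow> 'c::real_normed_vector"
  obtains B where "\<And>k. norm (f k) \<le> B"
proof
  show "norm (f k) \<le> (\<Sum>k\<in>UNIV. norm (f k))" for k
    by (rule member_le_sum) auto
qed

lemma norm_expectation_le:
  fixes f :: "'b \<Rightarrow> 'c::{banach, second_countable_topology}"
  assumes "\<And>x. x \<in> set_pmf M \<Longrightarrow> norm (f x) \<le> B"
  shows "norm (\<E> M f) \<le> B"
proof -
  have "integrable (measure_pmf M) (\<lambda>x. norm (f x))"
    by (rule measure_pmf.integrable_const_bound[where B = B])
       (use assms in \<open>auto simp: AE_measure_pmf_iff\<close>)
  then have "\<E> M (\<lambda>x. norm (f x)) \<le> B"
    by (rule measure_pmf.integral_le_const) (use assms in \<open>auto simp: AE_measure_pmf_iff\<close>)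
  with integral_norm_bound order_trans show ?thesis by blast
qed

lemma bind_pmf_cong_support:
  assumes "\<And>x. x \<in> set_pmf M \<Longrightarrow> f x = g x"
  shows "bind_pmf M f = bind_pmf M g"
  by (rule bind_pmf_cong) (use assms in auto)

text \<open>
  Functions such as the cardinality are bounded only on the support of the random sets considered
  below, so boundedness is asked for there alone.
\<close>

lemma expectation_bind_support:
  fixes f :: "'b \<Rightarrow> real"
  assumes B: "\<And>x. x \<in> set_pmf (bind_pmf M N) \<Longrightarrow> \<bar>f x\<bar> \<le> B"
  shows "\<E> (bind_pmf M N) f =
         \<E> M (\<lambda>x. \<E> (N x) f)"
proof -
  let ?S = "set_pmf (bind_pmf M N)"
  define g where "g x = (if x \<in> ?S then f x else 0)" for x
  have g: "\<bar>g x\<bar> \<le> max 0 B" for x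
    using B[of x] by (cases "x \<in> ?S") (auto simp: g_def simp del: set_bind_pmf)
  have "\<E> (bind_pmf M N) f = \<E> (bind_pmf M N) g"
    by (intro integral_cong_AE) (auto simp: AE_measure_pmf_iff g_def)
  also have "\<dots> = \<E> M (\<lambda>x. \<E> (N x) g)"
    by (rule expectation_bind_bounded_real) (rule g)
  also have "\<dots> = \<E> M (\<lambda>x. \<E> (N x) f)"
    by (intro integral_cong_AE) (auto simp: AE_measure_pmf_iff g_def intro!: integral_cong_AE)
  finally show ?thesis .
qed

lemma integrable_pmf_support:
  fixes f :: "'b \<Rightarrow> 'c::{banach, second_countable_topology}"
  assumes "\<And>x. x \<in> set_pmf M \<Longrightarrow> norm (f x) \<le> B"
  shows "integrable (measure_pmf M) f"
  by (rule measure_pmf.integrable_const_bound[where B = B]) (use assms in \<open>auto simp: AE_measure_pmf_iff\<close>)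

lemma expectation_mono_support:
  fixes f g :: "'b \<Rightarrow> real"
  assumes "\<And>x. x \<in> set_pmf M \<Longrightarrow> \<bar>f x\<bar> \<le> B" "\<And>x. x \<in> set_pmf M \<Longrightarrow> \<bar>g x\<bar> \<le> C"
    and "\<And>x. x \<in> set_pmf M \<Longrightarrow> f x \<le> g x"
  shows "\<E> M f \<le> \<E> M g"
proof (rule integral_mono_AE)
  show "integrable M f" by (rule integrable_pmf_support[where B = B]) (use assms in auto)
  show "integrable M g" by (rule integrable_pmf_support[where B = C]) (use assms in auto)
qed (use assms in \<open>auto simp: AE_measure_pmf_iff\<close>)

section \<open>Occupation, hitting and Green functions\<close>

primrec walk_pmf :: "('e \<Rightarrow> ('v::ab_group_add \<times> 'e) pmf) \<Rightarrow> nat \<Rightarrow> 'e \<Rightarrow> ('v \<times> 'e) pmf" where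
  "walk_pmf K 0 j = return_pmf (0, j)"
| "walk_pmf K (Suc n) j =
     bind_pmf (K j) (\<lambda>(y, k). map_pmf (\<lambda>(x, l). (y + x, l)) (walk_pmf K n k))"

text \<open>
  The law of the set of sites visited up to time \<open>n\<close>, seen from the starting site.
  Recording only the set, and adding new steps at the front, turns statements about first visits
  into one-step inductions.
\<close>

primrec range_pmf :: "('e \<Rightarrow> ('v::ab_group_add \<times> 'e) pmf) \<Rightarrow> nat \<Rightarrow> 'e \<Rightarrow> 'v set pmf" where
  "range_pmf K 0 j = return_pmf {0}"
| "range_pmf K (Suc n) j =
     bind_pmf (K j) (\<lambda>(y, k). map_pmf (\<lambda>A. insert 0 ((+) y ` A)) (range_pmf K n k))"

definition occ :: "('e \<Rightarrow> ('v::ab_group_add \<times> 'e) pmf) \<Rightarrow> nat \<Rightarrow> 'e \<Rightarrow> 'v \<Rightarrow> real" where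
  "occ K n j x = measure_pmf.prob (walk_pmf K n j) {u. fst u = x}"

definition green :: "('e \<Rightarrow> ('v::ab_group_add \<times> 'e) pmf) \<Rightarrow> nat \<Rightarrow> 'e \<Rightarrow> 'v \<Rightarrow> real" where
  "green K n j x = (\<Sum>l\<le>n. occ K l j x)"

definition hit :: "('e \<Rightarrow> ('v::ab_group_add \<times> 'e) pmf) \<Rightarrow> nat \<Rightarrow> 'e \<Rightarrow> 'v \<Rightarrow> real" where
  "hit K n j x = measure_pmf.prob (range_pmf K n j) {A. x \<in> A}"

definition hit_both :: "('e \<Rightarrow> ('v::ab_group_add \<times> 'e) pmf) \<Rightarrow> nat \<Rightarrow> 'e \<Rightarrow> 'v \<Rightarrow> 'v \<Rightarrow> real" where
  "hit_both K n j x x' = measure_pmf.prob (range_pmf K n j) {A. x \<in> A \<and> x' \<in> A}"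

lemma mem_insert_0_translate:
  fixes x y :: "'v::ab_group_add"
  shows "x \<in> insert 0 ((+) y ` A) \<longleftrightarrow> x = 0 \<or> x - y \<in> A"
  by (auto simp: image_iff algebra_simps intro!: bexI[of _ "x - y"])

lemma occ_0: "occ K 0 j x = of_bool (x = 0)"
  by (simp add: occ_def indicator_def)

lemma occ_Suc:
  fixes K :: "'e \<Rightarrow> ('v::ab_group_add \<times> 'e) pmf"
  shows "occ K (Suc n) j x = \<E> (K j) (\<lambda>(y, k). occ K n k (x - y))"
proof -
  have "(\<lambda>u :: 'v \<times> 'e. (fst p + fst u, snd u)) -` {u. fst u = x} = {u. fst u = x - fst p}" for p :: "'v \<times> 'e"
    by (auto simp: algebra_simps)
  then show ?thesis
    unfolding occ_def walk_pmf.simps prob_bind_pmf case_prod_unfold prob_map_pmf by (simp only:)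
qed

lemma occ_nonneg: "0 \<le> occ K n j x" and occ_le_1: "occ K n j x \<le> 1"
  by (simp_all add: occ_def)

lemma hit_nonneg: "0 \<le> hit K n j x" and hit_le_1: "hit K n j x \<le> 1"
  by (simp_all add: hit_def)

lemma green_nonneg: "0 \<le> green K n j x"
  by (auto simp: green_def occ_nonneg intro!: sum_nonneg)

lemma green_0: "green K 0 j x = of_bool (x = 0)"
  by (simp add: green_def occ_0)

lemma green_mono: "m \<le> n \<Longrightarrow> green K m j x \<le> green K n j x"
  by (auto simp: green_def occ_nonneg intro!: sum_mono2)

lemma green_le: "green K n j x \<le> n + 1"
  using sum_bounded_above[of "{..n}" "\<lambda>l. occ K l j x" 1] occ_le_1[of K _ j x]
  by (simp add: green_def)

lemma green_Suc:
  "green K (Suc n) j x = of_bool (x = 0) + \<E> (K j) (\<lambda>(y, k). green K n k (x - y))"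
proof -
  have "green K (Suc n) j x = occ K 0 j x + (\<Sum>l\<le>n. occ K (Suc l) j x)"
    unfolding green_def by (subst sum.atMost_Suc_shift) simp
  also have "(\<Sum>l\<le>n. occ K (Suc l) j x) =
      (\<Sum>l\<le>n. \<E> (K j) (\<lambda>u. occ K l (snd u) (x - fst u)))"
    by (simp add: occ_Suc case_prod_unfold)
  also have "\<dots> = \<E> (K j) (\<lambda>u. \<Sum>l\<le>n. occ K l (snd u) (x - fst u))"
    by (subst Bochner_Integration.integral_sum)
       (auto intro!: integrable_pmf_bounded[where B = 1] simp: occ_nonneg occ_le_1)
  finally show ?thesis by (simp add: occ_0 green_def case_prod_unfold)
qed

lemma hit_0: "hit K 0 j x = of_bool (x = 0)"
  by (simp add: hit_def indicator_def)

lemma hit_zero: "hit K n j 0 = 1"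
  by (cases n) (auto simp: hit_def prob_bind_pmf case_prod_unfold vimage_def measure_pmf.prob_space)

lemma hit_Suc:
  assumes "x \<noteq> 0"
  shows "hit K (Suc n) j x = \<E> (K j) (\<lambda>(y, k). hit K n k (x - y))"
proof -
  have "(\<lambda>A. insert 0 ((+) y ` A)) -` {A. x \<in> A} = {A. x - y \<in> A}" for y
    using assms by (auto simp only: vimage_def mem_Collect_eq mem_insert_0_translate)
  then show ?thesis
    by (simp add: hit_def prob_bind_pmf case_prod_unfold)
qed

lemma hit_both_Suc:
  assumes "x \<noteq> 0" "x' \<noteq> 0"
  shows "hit_both K (Suc n) j x x' =
         \<E> (K j) (\<lambda>(y, k). hit_both K n k (x - y) (x' - y))"
proof -
  have "(\<lambda>A. insert 0 ((+) y ` A)) -` {A. x \<in> A \<and> x' \<in> A} = {A. x - y \<in> A \<and> x' - y \<in> A}" for y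
    using assms by (auto simp only: vimage_def mem_Collect_eq mem_insert_0_translate)
  then show ?thesis
    by (simp add: hit_both_def prob_bind_pmf case_prod_unfold)
qed

lemma hit_both_le: "hit_both K n j x x' \<le> hit K n j x" "hit_both K n j x x' \<le> hit K n j x'"
  unfolding hit_both_def hit_def by (auto intro!: measure_pmf.finite_measure_mono)

lemma hit_both_nonneg: "0 \<le> hit_both K n j x x'"
  by (simp add: hit_both_def)

lemma hit_mono: "m \<le> n \<Longrightarrow> hit K m j x \<le> hit K n j x"
proof (induction m arbitrary: n j x)
  case 0
  then show ?case by (cases "x = 0") (auto simp: hit_0 hit_zero hit_nonneg)
next
  case (Suc m)
  then obtain n' where n: "n = Suc n'" "m \<le> n'" by (cases n) auto
  show ?case
  proof (cases "x = 0")
    case False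
    show ?thesis unfolding n(1) hit_Suc[OF False]
      by (rule expectation_pair_mono[where B = 1 and C = 1])
         (use Suc.IH n in \<open>auto simp: hit_nonneg hit_le_1\<close>)
  qed (simp add: hit_zero)
qed

text \<open>
  A visit to \<open>x\<close> starts at the first hitting time; from there on, the expected number
  of further visits is at most the Green function at 0. The first step analysis below proves this
  without mentioning hitting times.
\<close>

lemma green_le_hit:
  assumes B: "\<And>i. green K N i 0 \<le> B" and "n \<le> N"
  shows "green K n j x \<le> B * hit K n j x"
  using \<open>n \<le> N\<close>
proof (induction n arbitrary: j x)
  case 0
  have "1 \<le> B" using B[of j] green_mono[of 0 N K j 0] by (simp add: green_0)
  then show ?case by (simp add: green_0 hit_0)
next
  case (Suc n)
  show ?case
  proof (cases "x = 0")
    case True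
    then show ?thesis using order_trans[OF green_mono[OF Suc.prems] B] by (simp add: hit_zero)
  next
    case False
    have "green K (Suc n) j x = \<E> (K j) (\<lambda>(y, k). green K n k (x - y))"
      using False by (simp add: green_Suc)
    also have "\<dots> \<le> \<E> (K j) (\<lambda>(y, k). B * hit K n k (x - y))"
      by (rule expectation_pair_mono[where B = "real n + 1" and C = "\<bar>B\<bar>"])
         (use Suc green_le[of K n] in \<open>auto simp: green_nonneg hit_nonneg hit_le_1 abs_mult mult_left_le add.commute\<close>)
    also have "\<dots> = B * hit K (Suc n) j x"
      using False by (simp add: hit_Suc case_prod_unfold)
    finally show ?thesis .
  qed
qed

text \<open>
  After hitting \<open>x\<close> by time \<open>n\<close> the walk still has \<open>N\<close>
  steps, in which it visits \<open>x\<close> at least \<open>b\<close> times on average.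
\<close>

lemma hit_le_green:
  assumes b: "\<And>i. b \<le> green K N i 0" and b0: "0 \<le> b"
  shows "b * hit K n j x \<le> green K (n + N) j x"
proof (induction n arbitrary: j x)
  case 0
  then show ?case using b by (auto simp: hit_0 green_nonneg)
next
  case (Suc n)
  show ?case
  proof (cases "x = 0")
    case True
    then show ?thesis using b[of j] green_mono[of N "Suc n + N" K j 0] by (simp add: hit_zero)
  next
    case False
    have "b * hit K (Suc n) j x = \<E> (K j) (\<lambda>(y, k). b * hit K n k (x - y))"
      using False by (simp add: hit_Suc case_prod_unfold)
    also have "\<dots> \<le> \<E> (K j) (\<lambda>(y, k). green K (n + N) k (x - y))"
      by (rule expectation_pair_mono[where B = "\<bar>b\<bar>" and C = "real (n + N) + 1"])
         (use Suc green_le[of K "n + N"] b0 in \<open>auto simp: green_nonneg hit_nonneg hit_le_1 abs_mult mult_left_le add.commute\<close>)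
    also have "\<dots> = green K (Suc n + N) j x"
      using False green_Suc[of K "n + N" j x] by simp
    finally show ?thesis .
  qed
qed

text \<open>
  One of the two sites is visited first, and the other one has to be hit from there.
\<close>

lemma hit_both_le_product:
  assumes H: "\<And>n i z. n \<le> N \<Longrightarrow> hit K n i z \<le> H z" and "n \<le> N"
  shows "hit_both K n j x x' \<le> hit K n j x * H (x' - x) + hit K n j x' * H (x - x')"
  using \<open>n \<le> N\<close>
proof (induction n arbitrary: j x x')
  case 0
  have H0: "0 \<le> H z" for z using H[of 0 j z] hit_nonneg[of K 0 j z] by simp
  have "1 \<le> H 0" using H[of 0 j 0] by (simp add: hit_zero)
  moreover have "hit_both K 0 j x x' \<le> of_bool (x = 0 \<and> x' = 0)"
    by (simp add: hit_both_def indicator_def)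
  moreover have "hit_both K 0 j x x' \<le> H z" if "\<not> (x = 0 \<and> x' = 0)" for z
    using calculation(2) H0[of z] that by simp
  ultimately show ?case using H0 by (auto simp: hit_0)
next
  case (Suc n)
  have H0: "0 \<le> H z" for z using H[of 0 j z] hit_nonneg[of K 0 j z] by simp
  consider "x = 0" | "x' = 0" | "x \<noteq> 0" "x' \<noteq> 0" by blast
  then show ?case
  proof cases
    case 1
    have "hit_both K (Suc n) j x x' \<le> H x'"
      by (rule order_trans[OF hit_both_le(2) H[OF Suc.prems]])
    then show ?thesis using 1 H0 by (simp add: hit_zero hit_nonneg add_increasing2)
  next
    case 2
    have "hit_both K (Suc n) j x x' \<le> H x"
      by (rule order_trans[OF hit_both_le(1) H[OF Suc.prems]])
    then show ?thesis using 2 H0 by (simp add: hit_zero hit_nonneg add_increasing)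
  next
    case 3
    have Hb: "\<bar>hit K n k z * H w\<bar> \<le> H w" for k z w
      using H0 by (simp add: abs_mult hit_nonneg hit_le_1 mult_left_le_one_le)
    have i: "integrable (K j) (\<lambda>(y, k). hit K n k (z - y) * H w)" for z w
      by (rule integrable_pmf_bounded[where B = "H w"]) (use Hb in auto)
    have "hit_both K (Suc n) j x x' =
          \<E> (K j) (\<lambda>(y, k). hit_both K n k (x - y) (x' - y))"
      by (rule hit_both_Suc[OF 3])
    also have "\<dots> \<le> \<E> (K j)
          (\<lambda>(y, k). hit K n k (x - y) * H (x' - x) + hit K n k (x' - y) * H (x - x'))"
    proof (rule expectation_pair_mono[where B = 1 and C = "H (x' - x) + H (x - x')"])
      fix y k
      show "\<bar>hit_both K n k (x - y) (x' - y)\<bar> \<le> 1"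
        by (simp add: hit_both_def)
      show "\<bar>hit K n k (x - y) * H (x' - x) + hit K n k (x' - y) * H (x - x')\<bar> \<le> H (x' - x) + H (x - x')"
        by (rule order_trans[OF abs_triangle_ineq add_mono[OF Hb Hb]])
      show "hit_both K n k (x - y) (x' - y) \<le>
            hit K n k (x - y) * H (x' - x) + hit K n k (x' - y) * H (x - x')"
        using Suc.IH[of k "x - y" "x' - y"] Suc.prems by simp
    qed
    also have "\<dots> = hit K (Suc n) j x * H (x' - x) + hit K (Suc n) j x' * H (x - x')"
      using Bochner_Integration.integral_add[OF i i, of x "x' - x" x' "x - x'"]
      by (simp add: hit_Suc[OF 3(1)] hit_Suc[OF 3(2)] case_prod_unfold)
    finally show ?thesis .
  qed
qed

section \<open>Gaussian decay of the characteristic operator\<close>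

definition dot :: "real \<times> real \<Rightarrow> int ^ 2 \<Rightarrow> real" where
  "dot t y = fst t * real_of_int (y $ 1) + snd t * real_of_int (y $ 2)"

lemma dot_add: "dot t (y + z) = dot t y + dot t z"
  and dot_diff: "dot t (y - z) = dot t y - dot t z"
  and dot_minus: "dot (- t) y = - dot t y" "dot t (- y) = - dot t y"
  and dot_0: "dot t 0 = 0"
  and dot_scaleR: "dot (c *\<^sub>R t) y = c * dot t y"
  by (simp_all add: dot_def algebra_simps)

text \<open>
  The Fourier transform of the kernel, acting on functions of the internal state. Its
  \<open>n\<close>-th power is the Fourier transform of the \<open>n\<close>-step kernel
  (\<open>char_op_pow_walk\<close>).
\<close>

definition char_op ::
  "('e \<Rightarrow> ((int ^ 2) \<times> 'e) pmf) \<Rightarrow> real \<times> real \<Rightarrow> ('e \<Rightarrow> complex) \<Rightarrow> 'e \<Rightarrow> complex" where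
  "char_op K t f j = \<E> (K j) (\<lambda>(y, k). cis (dot t y) * f k)"

lemma char_op_bound:
  assumes "\<And>k. cmod (f k) \<le> B"
  shows "cmod (char_op K t f j) \<le> B"
  unfolding char_op_def by (rule norm_expectation_le) (use assms in \<open>auto simp: norm_mult\<close>)

lemma char_op_pow_bound:
  assumes "\<And>k. cmod (f k) \<le> B"
  shows "cmod ((char_op K t ^^ n) f j) \<le> B"
  using assms by (induction n arbitrary: j) (auto intro!: char_op_bound)

lemma char_op_pow_walk:
  fixes f :: "'e::finite \<Rightarrow> complex"
  shows "(char_op K t ^^ n) f j = \<E> (walk_pmf K n j) (\<lambda>(y, k). cis (dot t y) * f k)"
proof (induction n arbitrary: j)
  case 0
  show ?case by (simp add: dot_0)
next
  case (Suc n)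
  obtain B where B: "\<And>k. cmod (f k) \<le> B" using finite_bound[of f] by blast
  have "\<E> (walk_pmf K (Suc n) j) (\<lambda>(y, k). cis (dot t y) * f k) =
     \<E> (K j) (\<lambda>u. \<E> (walk_pmf K n (snd u))
        (\<lambda>v. cis (dot t (fst u)) * (cis (dot t (fst v)) * f (snd v))))"
    unfolding walk_pmf.simps
    by (subst expectation_bind_bounded[where B = B])
       (use B in \<open>auto simp: norm_mult case_prod_unfold dot_add mult.assoc simp flip: cis_mult\<close>)
  also have "\<dots> = \<E> (K j) (\<lambda>u. cis (dot t (fst u)) * (char_op K t ^^ n) f (snd u))"
    by (simp add: Suc.IH case_prod_unfold)
  finally show ?case by (simp add: char_op_def[of K t "(char_op K t ^^ n) f"] case_prod_unfold)
qed

lemma norm_one_plus_cis_le: "cmod (1 + cis a) \<le> 2 - (1 - cos a) / 2"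
proof (rule power2_le_imp_le)
  have "(cmod (1 + cis a))\<^sup>2 = (1 + cos a)\<^sup>2 + (sin a)\<^sup>2"
    by (simp add: cmod_power2)
  also have "\<dots> = 2 + 2 * cos a"
    using sin_cos_squared_add[of a] by (simp add: power2_eq_square algebra_simps)
  also have "\<dots> \<le> (2 - (1 - cos a) / 2)\<^sup>2"
    using zero_le_power2[of "cos a - 1"] by (simp add: power2_eq_square algebra_simps)
  finally show "(cmod (1 + cis a))\<^sup>2 \<le> (2 - (1 - cos a) / 2)\<^sup>2" .
next
  have aux: "0 \<le> 2 - (1 - x) / 2" if "- 1 \<le> x" for x :: real
    using that by (simp add: field_simps)
  show "0 \<le> 2 - (1 - cos a) / 2" by (rule aux[OF cos_ge_minus_one])
qed

text \<open>
  Two atoms of a distribution with the same internal state interfere: their contribution to the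
  Fourier transform is smaller than their mass unless their phases agree. Keeping only one pair of
  atoms is enough, since finitely many pairs will be combined later.
\<close>

lemma two_atoms:
  fixes q :: "((int ^ 2) \<times> 'e) pmf"
  assumes "(y, k) \<in> set_pmf q" "(y', k) \<in> set_pmf q"
  obtains w where "w > 0"
    "\<And>t (f :: 'e \<Rightarrow> complex) B. (\<And>k. cmod (f k) \<le> B) \<Longrightarrow>
       cmod (\<E> q (\<lambda>(y, k). cis (dot t y) * f k)) \<le>
       B * (1 - w * (1 - cos (dot t (y - y'))))"
proof (cases "y = y'")
  case True
  show ?thesis
  proof (rule that[of 1])
    fix t and f :: "'e \<Rightarrow> complex" and B :: real assume "\<And>k. cmod (f k) \<le> B"
    then have "cmod (\<E> q (\<lambda>(y, k). cis (dot t y) * f k)) \<le> B"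
      by (intro norm_expectation_le) (auto simp: norm_mult)
    then show "cmod (\<E> q (\<lambda>(y, k). cis (dot t y) * f k)) \<le>
        B * (1 - 1 * (1 - cos (dot t (y - y'))))"
      using True by (simp add: dot_0)
  qed simp
next
  case False
  define a a' where "a = pmf q (y, k)" and "a' = pmf q (y', k)"
  \<comment> \<open>the two atoms are compared on their common mass \<open>w\<close>\<close>
  define w where "w = min a a'"
  have a: "0 < a" "0 < a'" using assms by (auto simp: a_def a'_def pmf_positive_iff)
  then have w: "0 < w" "w \<le> a" "w \<le> a'" by (auto simp: w_def)
  show ?thesis
  proof (rule that[of "w / 2"])
    fix t and f :: "'e \<Rightarrow> complex" and B :: real assume f: "\<And>k. cmod (f k) \<le> B"
    define g where "g = (\<lambda>(y, k). cis (dot t y) * f k)"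
    have g: "cmod (g u) \<le> B" for u using f by (auto simp: g_def norm_mult split: prod.split)
    have B: "0 \<le> B" using f[of k] norm_ge_zero order_trans by blast
    define S where "S = {(y, k), (y', k)}"
    have ig: "integrable q (\<lambda>u. indicator X u *\<^sub>R g u)" for X
      by (rule integrable_pmf_bounded[where B = B]) (use g B in \<open>auto simp: indicator_def\<close>)
    have "\<E> q g = \<E> q
            (\<lambda>u. indicator S u *\<^sub>R g u + indicator (- S) u *\<^sub>R g u)"
      by (intro Bochner_Integration.integral_cong) (auto simp: indicator_def)
    also have "\<dots> = \<E> q (\<lambda>u. indicator S u *\<^sub>R g u)
        + \<E> q (\<lambda>u. indicator (- S) u *\<^sub>R g u)"
      by (rule Bochner_Integration.integral_add[OF ig ig])
    also have "\<E> q (\<lambda>u. indicator S u *\<^sub>R g u) = a * g (y, k) + a' * g (y', k)"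
      by (subst integral_measure_pmf[of S])
         (use False in \<open>auto simp: S_def a_def a'_def indicator_def scaleR_conv_of_real split: if_splits\<close>)
    finally have E: "\<E> q g = a * g (y, k) + a' * g (y', k)
        + \<E> q (\<lambda>u. indicator (- S) u *\<^sub>R g u)" .
    have "cmod (\<E> q (\<lambda>u. indicator (- S) u *\<^sub>R g u)) \<le>
        \<E> q (\<lambda>u. cmod (indicator (- S) u *\<^sub>R g u))"
      by (rule integral_norm_bound)
    also have "\<dots> \<le> \<E> q (\<lambda>u. B * indicator (- S) u)"
      by (rule integral_mono, rule integrable_norm[OF ig], rule integrable_pmf_bounded[where B = B])
         (use g B in \<open>auto simp: indicator_def\<close>)
    also have "\<dots> = B * (1 - measure_pmf.prob q S)"
      using measure_pmf.prob_compl[of S q] by (simp add: Compl_eq_Diff_UNIV)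
    also have "measure_pmf.prob q S = a + a'"
      using False by (simp add: S_def a_def a'_def measure_measure_pmf_finite)
    finally have rest: "cmod (\<E> q (\<lambda>u. indicator (- S) u *\<^sub>R g u)) \<le> B * (1 - (a + a'))" .
    have "g (y, k) + g (y', k) = cis (dot t y') * f k * (1 + cis (dot t (y - y')))"
      by (simp add: g_def dot_diff algebra_simps cis_mult)
    then have "cmod (g (y, k) + g (y', k)) = cmod (f k) * cmod (1 + cis (dot t (y - y')))"
      by (simp add: norm_mult)
    also have "\<dots> \<le> B * (2 - (1 - cos (dot t (y - y'))) / 2)"
      by (intro mult_mono f norm_one_plus_cis_le B) auto
    finally have pair: "cmod (g (y, k) + g (y', k)) \<le> B * (2 - (1 - cos (dot t (y - y'))) / 2)" .
    have "a * g (y, k) + a' * g (y', k) =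
       of_real (a - w) * g (y, k) + of_real (a' - w) * g (y', k) + of_real w * (g (y, k) + g (y', k))"
      by (simp add: algebra_simps)
    also have "cmod \<dots> \<le> (a - w) * B + (a' - w) * B + w * (B * (2 - (1 - cos (dot t (y - y'))) / 2))"
      by (intro order_trans[OF norm_triangle_ineq] add_mono)
         (use w g pair in \<open>auto simp: norm_mult simp del: of_real_diff intro!: mult_left_mono\<close>)
    finally have "cmod (\<E> q g) \<le> B * (1 - w / 2 * (1 - cos (dot t (y - y'))))"
      using rest norm_triangle_ineq[of "a * g (y, k) + a' * g (y', k)"
              "\<E> q (\<lambda>u. indicator (- S) u *\<^sub>R g u)"]
      unfolding E by (simp add: field_simps)
    then show "cmod (\<E> q (\<lambda>(y, k). cis (dot t y) * f k)) \<le>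
        B * (1 - w / 2 * (1 - cos (dot t (y - y'))))"
      by (simp only: g_def)
  qed (use w in simp)
qed

text \<open>
  The loss is required at all late times, so that losses in finitely many directions can be
  combined at a common time.
\<close>

definition contracts :: "('e \<Rightarrow> ((int ^ 2) \<times> 'e) pmf) \<Rightarrow> 'e \<Rightarrow> int ^ 2 \<Rightarrow> bool" where
  "contracts K j d \<longleftrightarrow> (\<exists>N w. w > 0 \<and> (\<forall>n\<ge>N. \<forall>t f B. (\<forall>k. cmod (f k) \<le> B) \<longrightarrow>
     cmod ((char_op K t ^^ n) f j) \<le> B * (1 - w * (1 - cos (dot t d)))))"

lemma contracts_base:
  fixes K :: "'e::finite \<Rightarrow> ((int ^ 2) \<times> 'e) pmf"
  assumes "(y, k) \<in> set_pmf (walk_pmf K N j)" "(y', k) \<in> set_pmf (walk_pmf K N j)"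
  shows "contracts K j (y - y')"
proof -
  obtain w where w: "w > 0"
    "\<And>t f B. (\<And>k. cmod (f k) \<le> B) \<Longrightarrow>
       cmod (\<E> (walk_pmf K N j) (\<lambda>(y, k). cis (dot t y) * f k)) \<le>
       B * (1 - w * (1 - cos (dot t (y - y'))))"
    using two_atoms[OF assms] by metis
  have "cmod ((char_op K t ^^ n) f j) \<le> B * (1 - w * (1 - cos (dot t (y - y'))))"
    if "n \<ge> N" "\<forall>k. cmod (f k) \<le> B" for n t f B
  proof -
    have "(char_op K t ^^ n) f j = (char_op K t ^^ N) ((char_op K t ^^ (n - N)) f) j"
      using that(1) by (metis comp_apply funpow_add le_add_diff_inverse)
    then show ?thesis
      using w(2)[of "(char_op K t ^^ (n - N)) f" B t] char_op_pow_bound that(2)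
      by (metis char_op_pow_walk)
  qed
  with w(1) show ?thesis unfolding contracts_def by blast
qed

text \<open>
  The quantity \<open>1 - cos a\<close> is half the squared distance of \<open>cis a\<close> from
  1, so this is the triangle inequality on the unit circle.
\<close>

lemma one_minus_cos_diff: "1 - cos (a - b) \<le> 2 * (1 - cos a) + 2 * (1 - cos b)" for a b :: real
proof -
  have "1 - cos x = 2 * (sin (x / 2))\<^sup>2" for x :: real
    using cos_double_sin[of "x / 2"] by simp
  moreover have "\<bar>sin (a / 2 - b / 2)\<bar> \<le> \<bar>sin (a / 2)\<bar> + \<bar>sin (b / 2)\<bar>"
  proof -
    have "\<bar>sin (a / 2 - b / 2)\<bar> \<le> \<bar>sin (a / 2) * cos (b / 2)\<bar> + \<bar>cos (a / 2) * sin (b / 2)\<bar>"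
      by (simp add: sin_diff)
    also have "\<dots> \<le> \<bar>sin (a / 2)\<bar> + \<bar>sin (b / 2)\<bar>"
      by (intro add_mono) (auto simp: abs_mult mult_left_le mult_left_le_one_le)
    finally show ?thesis .
  qed
  then have "(sin (a / 2 - b / 2))\<^sup>2 \<le> (\<bar>sin (a / 2)\<bar> + \<bar>sin (b / 2)\<bar>)\<^sup>2"
    by (metis abs_ge_zero power2_abs power_mono)
  moreover have "(\<bar>sin (a / 2)\<bar> + \<bar>sin (b / 2)\<bar>)\<^sup>2 \<le> 2 * (sin (a / 2))\<^sup>2 + 2 * (sin (b / 2))\<^sup>2"
    using sum_squares_bound[of "\<bar>sin (a / 2)\<bar>" "\<bar>sin (b / 2)\<bar>"] by (simp add: power2_sum)
  ultimately show ?thesis by (simp add: diff_divide_distrib)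
qed

lemma contracts_combine:
  fixes K :: "'e \<Rightarrow> ((int ^ 2) \<times> 'e) pmf"
  assumes "contracts K j d" "contracts K j d'"
  obtains N w where "w > 0"
    "\<And>n t f B. n \<ge> N \<Longrightarrow> \<forall>k. cmod (f k) \<le> B \<Longrightarrow>
       cmod ((char_op K t ^^ n) f j) \<le> B * (1 - w * ((1 - cos (dot t d)) + (1 - cos (dot t d'))))"
proof -
  obtain N1 w1 where 1: "w1 > 0" "\<And>n t f B. n \<ge> N1 \<Longrightarrow> \<forall>k. cmod (f k) \<le> B \<Longrightarrow>
     cmod ((char_op K t ^^ n) f j) \<le> B * (1 - w1 * (1 - cos (dot t d)))"
    using assms(1) unfolding contracts_def by blast
  obtain N2 w2 where 2: "w2 > 0" "\<And>n t f B. n \<ge> N2 \<Longrightarrow> \<forall>k. cmod (f k) \<le> B \<Longrightarrow>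
     cmod ((char_op K t ^^ n) f j) \<le> B * (1 - w2 * (1 - cos (dot t d')))"
    using assms(2) unfolding contracts_def by blast
  show ?thesis
  proof (rule that[of "min w1 w2 / 2" "max N1 N2"])
    fix n t and f :: "'e \<Rightarrow> complex" and B :: real assume n: "n \<ge> max N1 N2" and f: "\<forall>k. cmod (f k) \<le> B"
    let ?c = "1 - cos (dot t d)" and ?c' = "1 - cos (dot t d')"
    have B: "0 \<le> B" using f norm_ge_zero order_trans by blast
    have c: "0 \<le> ?c" "0 \<le> ?c'" by auto
    have "cmod ((char_op K t ^^ n) f j) \<le> (B * (1 - w1 * ?c) + B * (1 - w2 * ?c')) / 2"
      using 1(2)[of n f B t] 2(2)[of n f B t] n f by auto
    also have "\<dots> = B * (1 - (w1 * ?c + w2 * ?c') / 2)"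
      by (simp add: field_simps)
    also have "\<dots> \<le> B * (1 - min w1 w2 / 2 * (?c + ?c'))"
    proof (intro mult_left_mono B)
      have "min w1 w2 * ?c \<le> w1 * ?c" "min w1 w2 * ?c' \<le> w2 * ?c'"
        using c by (auto intro!: mult_right_mono)
      then show "1 - (w1 * ?c + w2 * ?c') / 2 \<le> 1 - min w1 w2 / 2 * (?c + ?c')"
        unfolding times_divide_eq_left distrib_left[of "min w1 w2"]
        by (intro diff_left_mono divide_right_mono add_mono) auto
    qed
    finally show "cmod ((char_op K t ^^ n) f j) \<le> B * (1 - min w1 w2 / 2 * (?c + ?c'))" .
  qed (use 1 2 in auto)
qed

lemma contracts_diff:
  fixes K :: "'e \<Rightarrow> ((int ^ 2) \<times> 'e) pmf"
  assumes "contracts K j d" "contracts K j d'"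
  shows "contracts K j (d - d')"
proof -
  obtain N w where w: "w > 0" "\<And>n t f B. n \<ge> N \<Longrightarrow> \<forall>k. cmod (f k) \<le> B \<Longrightarrow>
     cmod ((char_op K t ^^ n) f j) \<le> B * (1 - w * ((1 - cos (dot t d)) + (1 - cos (dot t d'))))"
    using contracts_combine[OF assms] by metis
  show ?thesis
    unfolding contracts_def
  proof (intro exI[of _ N] exI[of _ "w / 2"] conjI allI impI)
    fix n t and f :: "'e \<Rightarrow> complex" and B :: real assume n: "n \<ge> N" and f: "\<forall>k. cmod (f k) \<le> B"
    have B: "0 \<le> B" using f norm_ge_zero order_trans by blast
    have "w * (1 - cos (dot t (d - d'))) \<le> w * (2 * (1 - cos (dot t d)) + 2 * (1 - cos (dot t d')))"
      unfolding dot_diff using w(1) by (intro mult_left_mono one_minus_cos_diff) simp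
    then have "1 - w * ((1 - cos (dot t d)) + (1 - cos (dot t d'))) \<le> 1 - w / 2 * (1 - cos (dot t (d - d')))"
      by (simp add: algebra_simps)
    from mult_left_mono[OF this B] w(2)[OF n f, of t]
    show "cmod ((char_op K t ^^ n) f j) \<le> B * (1 - w / 2 * (1 - cos (dot t (d - d'))))"
      by linarith
  qed (use w in simp)
qed

text \<open>
  The directions of contraction form a group: this is how an assumption on the generated subgroup
  turns into an analytic estimate.
\<close>

lemma contracts_group_closure:
  fixes K :: "'e::finite \<Rightarrow> ((int ^ 2) \<times> 'e) pmf"
  assumes D: "\<And>d. d \<in> D \<Longrightarrow> contracts K j d" and "d \<in> group_closure D"
  shows "contracts K j d"
  using assms(2)
proof induction
  case (base s)
  have "contracts K j 0"
    unfolding contracts_def dot_0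
    by (intro exI[of _ 0] exI[of _ 1]) (auto intro: char_op_pow_bound)
  with base D show ?case by auto
qed (rule contracts_diff)

text \<open>
  Jordan's inequality for the sine, applied to half the angle.
\<close>

lemma one_minus_cos_ge:
  assumes "\<bar>x\<bar> \<le> pi"
  shows "2 * x\<^sup>2 / pi\<^sup>2 \<le> 1 - cos x"
proof -
  have jordan: "y / pi \<le> sin (y / 2)" if "0 \<le> y" "y \<le> pi" for y
  proof -
    have "concave_on {0..pi / 2} sin"
    proof (rule f''_le0_imp_concave)
      show "(sin has_real_derivative cos x) (at x)" for x :: real by (rule DERIV_sin)
      show "(cos has_real_derivative - sin x) (at x)" for x :: real by (rule DERIV_cos)
    qed (auto intro: sin_ge_zero)
    then have "(1 - y / pi) * sin 0 + (y / pi) * sin (pi / 2) \<le> sin ((1 - y / pi) *\<^sub>R 0 + (y / pi) *\<^sub>R (pi / 2))"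
      using that by (intro concave_onD) auto
    then show ?thesis by simp
  qed
  have "\<bar>x\<bar> / pi \<le> \<bar>sin (x / 2)\<bar>"
    using jordan[of "\<bar>x\<bar>"] assms by (cases "x \<ge> 0") auto
  then have "(\<bar>x\<bar> / pi)\<^sup>2 \<le> (sin (x / 2))\<^sup>2"
    using power_mono[of "\<bar>x\<bar> / pi" "\<bar>sin (x / 2)\<bar>" 2] by simp
  then show ?thesis
    using cos_double_sin[of "x / 2"] by (simp add: power_divide)
qed

definition fourier_decay :: "('e \<Rightarrow> ((int ^ 2) \<times> 'e) pmf) \<Rightarrow> real \<Rightarrow> real \<Rightarrow> bool" where
  "fourier_decay K C c \<longleftrightarrow> 0 < c \<and> (\<forall>n t f j. \<bar>fst t\<bar> \<le> pi \<longrightarrow> \<bar>snd t\<bar> \<le> pi \<longrightarrow> (\<forall>k. cmod (f k) \<le> 1) \<longrightarrow>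
     cmod ((char_op K t ^^ n) f j) \<le> C * exp (- c * real n * ((fst t)\<^sup>2 + (snd t)\<^sup>2)))"

text \<open>
  When the differences generate the whole lattice, the two unit vectors are directions of
  contraction, so some power of the operator contracts by \<open>exp (- v |t|\<^sup>2)\<close>
  uniformly on the torus. Iterating gives the decay.
\<close>

lemma fourier_decay_exists:
  fixes K :: "'e::finite \<Rightarrow> ((int ^ 2) \<times> 'e) pmf"
  assumes "\<And>j. group_closure {y - y' | y y'. \<exists>n k. (y, k) \<in> set_pmf (walk_pmf K n j) \<and>
                 (y', k) \<in> set_pmf (walk_pmf K n j)} = UNIV"
  obtains C c where "fourier_decay K C c"
proof -
  have con: "contracts K j d" for j d
    by (rule contracts_group_closure[of "{y - y' | y y'. \<exists>n k. (y, k) \<in> set_pmf (walk_pmf K n j) \<and>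
                 (y', k) \<in> set_pmf (walk_pmf K n j)}"])
       (use assms[of j] in \<open>auto intro: contracts_base\<close>)
  have "\<exists>N w. w > 0 \<and> (\<forall>n\<ge>N. \<forall>t f B. \<bar>fst t\<bar> \<le> pi \<longrightarrow> \<bar>snd t\<bar> \<le> pi \<longrightarrow> (\<forall>k. cmod (f k) \<le> B) \<longrightarrow>
     cmod ((char_op K t ^^ n) f j) \<le> B * exp (- w * ((fst t)\<^sup>2 + (snd t)\<^sup>2)))" for j
  proof -
    obtain N w where w: "w > 0" "\<And>n t f B. n \<ge> N \<Longrightarrow> \<forall>k. cmod (f k) \<le> B \<Longrightarrow>
     cmod ((char_op K t ^^ n) f j) \<le> B * (1 - w * ((1 - cos (dot t (axis 1 1))) + (1 - cos (dot t (axis 2 1)))))"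
      using contracts_combine[OF con[of j "axis 1 1"] con[of j "axis 2 1"]] by metis
    have "cmod ((char_op K t ^^ n) f j) \<le> B * exp (- (2 * w / pi\<^sup>2) * ((fst t)\<^sup>2 + (snd t)\<^sup>2))"
      if n: "n \<ge> N" and t: "\<bar>fst t\<bar> \<le> pi" "\<bar>snd t\<bar> \<le> pi" and f: "\<forall>k. cmod (f k) \<le> B" for n t f B
    proof -
      have B: "0 \<le> B" using f norm_ge_zero order_trans by blast
      have d: "dot t (axis 1 1) = fst t" "dot t (axis 2 1) = snd t"
        by (auto simp: dot_def axis_def)
      have "w * (2 * (fst t)\<^sup>2 / pi\<^sup>2 + 2 * (snd t)\<^sup>2 / pi\<^sup>2) \<le> w * ((1 - cos (fst t)) + (1 - cos (snd t)))"
        using w(1) by (intro mult_left_mono add_mono one_minus_cos_ge t) simp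
      then have "1 - w * ((1 - cos (fst t)) + (1 - cos (snd t))) \<le> 1 + (- (2 * w / pi\<^sup>2) * ((fst t)\<^sup>2 + (snd t)\<^sup>2))"
        by (simp add: field_simps)
      also have "\<dots> \<le> exp (- (2 * w / pi\<^sup>2) * ((fst t)\<^sup>2 + (snd t)\<^sup>2))"
        by (rule exp_ge_add_one_self)
      finally have "B * (1 - w * ((1 - cos (fst t)) + (1 - cos (snd t)))) \<le> B * exp (- (2 * w / pi\<^sup>2) * ((fst t)\<^sup>2 + (snd t)\<^sup>2))"
        by (rule mult_left_mono[OF _ B])
      with w(2)[OF n f, of t] show ?thesis by (simp only: d)
    qed
    with w(1) show ?thesis
      by (intro exI[of _ N] exI[of _ "2 * w / pi\<^sup>2"]) auto
  qed
  then obtain N w where w: "\<And>j. w j > 0" and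
    Nw: "\<And>j n t f B. n \<ge> N j \<Longrightarrow> \<bar>fst t\<bar> \<le> pi \<Longrightarrow> \<bar>snd t\<bar> \<le> pi \<Longrightarrow> \<forall>k. cmod (f k) \<le> B \<Longrightarrow>
     cmod ((char_op K t ^^ n) f j) \<le> B * exp (- w j * ((fst t)\<^sup>2 + (snd t)\<^sup>2))"
    by metis
  define m where "m = Suc (Max (range N))"
  define v where "v = Min (range w)"
  have v: "v > 0" "\<And>j. v \<le> w j" using w by (auto simp: v_def)
  have m: "m \<ge> N j" for j by (auto simp: m_def le_Suc_eq)
  have step: "cmod ((char_op K t ^^ m) f j) \<le> B * exp (- v * ((fst t)\<^sup>2 + (snd t)\<^sup>2))"
    if "\<bar>fst t\<bar> \<le> pi" "\<bar>snd t\<bar> \<le> pi" "\<forall>k. cmod (f k) \<le> B" for t f j B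
  proof -
    have B: "0 \<le> B" using that(3) norm_ge_zero order_trans by blast
    have "B * exp (- w j * ((fst t)\<^sup>2 + (snd t)\<^sup>2)) \<le> B * exp (- v * ((fst t)\<^sup>2 + (snd t)\<^sup>2))"
      using v(2)[of j] B by (auto intro!: mult_left_mono mult_right_mono)
    with Nw[OF m that, of j] show ?thesis by linarith
  qed
  have steps: "cmod ((char_op K t ^^ (m * q)) f j) \<le> exp (- v * real q * ((fst t)\<^sup>2 + (snd t)\<^sup>2))"
    if t: "\<bar>fst t\<bar> \<le> pi" "\<bar>snd t\<bar> \<le> pi" "\<forall>k. cmod (f k) \<le> 1" for t f j q
  proof (induction q arbitrary: j)
    case 0
    then show ?case using t by simp
  next
    case (Suc q)
    have "(char_op K t ^^ (m * Suc q)) f j = (char_op K t ^^ m) ((char_op K t ^^ (m * q)) f) j"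
      by (simp add: funpow_add)
    also have "cmod \<dots> \<le> exp (- v * real q * ((fst t)\<^sup>2 + (snd t)\<^sup>2)) * exp (- v * ((fst t)\<^sup>2 + (snd t)\<^sup>2))"
      by (rule step) (use t Suc in auto)
    also have "\<dots> = exp (- v * real (Suc q) * ((fst t)\<^sup>2 + (snd t)\<^sup>2))"
      by (simp add: algebra_simps flip: exp_add)
    finally show ?case .
  qed
  have m0: "m > 0" by (simp add: m_def)
  \<comment> \<open>the constant makes up for the last \<open>n mod m\<close> steps, since
    \<open>|t|\<^sup>2 \<le> 2 pi\<^sup>2\<close> on the torus\<close>
  have "fourier_decay K (exp (v * (2 * pi\<^sup>2))) (v / m)"
    unfolding fourier_decay_def
  proof (intro conjI allI impI)
    fix n t j and f :: "'e \<Rightarrow> complex" assume t: "\<bar>fst t\<bar> \<le> pi" "\<bar>snd t\<bar> \<le> pi" and f: "\<forall>k. cmod (f k) \<le> 1"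
    let ?r = "(fst t)\<^sup>2 + (snd t)\<^sup>2"
    have r: "0 \<le> ?r" "?r \<le> 2 * pi\<^sup>2"
      using power_mono[OF t(1), of 2] power_mono[OF t(2), of 2] by auto
    have "(char_op K t ^^ n) f j = (char_op K t ^^ (m * (n div m))) ((char_op K t ^^ (n mod m)) f) j"
      by (metis comp_apply funpow_add mult_div_mod_eq)
    also have "cmod \<dots> \<le> exp (- v * real (n div m) * ?r)"
      by (rule steps) (use t f char_op_pow_bound[where f = f and B = 1] in auto)
    also have "\<dots> \<le> exp (v * (2 * pi\<^sup>2) + - (v / m) * n * ?r)"
    proof -
      have "real n / m \<le> real (n div m) + 1"
        using m0 by (simp add: field_simps)
          (metis add.commute mod_less_divisor mult_div_mod_eq nat_less_le of_nat_add of_nat_le_iff of_nat_mult add_left_mono)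
      then have "v * (real n / m * ?r) \<le> v * ((real (n div m) + 1) * ?r)"
        using v(1) r by (intro mult_left_mono mult_right_mono) auto
      moreover have "v * ?r \<le> v * (2 * pi\<^sup>2)" using v(1) r by (intro mult_left_mono) auto
      ultimately show ?thesis by (simp add: algebra_simps)
    qed
    finally show "cmod ((char_op K t ^^ n) f j) \<le> exp (v * (2 * pi\<^sup>2)) * exp (- (v / m) * real n * ?r)"
      by (simp only: exp_add)
  qed (use v m0 in simp)
  then show ?thesis by (rule that)
qed

section \<open>Fourier inversion and the local upper bound\<close>

lemma integral_cis_int:
  "integral\<^sup>L lborel (\<lambda>x. indicator {-pi..pi} x *\<^sub>R cis (x * of_int m)) = (if m = 0 then of_real (2 * pi) else 0)"
proof (cases "m = 0")
  case True
  then show ?thesis by (simp add: scaleR_conv_of_real)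
next
  case False
  define F where "F x = cis (x * of_int m) / (\<i> * of_int m)" for x :: real
  have "integral\<^sup>L lborel (\<lambda>x. indicator {-pi..pi} x *\<^sub>R cis (x * of_int m)) = F pi - F (-pi)"
  proof (rule integral_FTC_atLeastAtMost)
    show "(F has_vector_derivative cis (x * of_int m)) (at x within {-pi..pi})" for x
    proof -
      have "((\<lambda>x. exp (x *\<^sub>R (\<i> * of_int m)) * (1 / (\<i> * of_int m))) has_vector_derivative
          exp (x *\<^sub>R (\<i> * of_int m)) * (\<i> * of_int m) * (1 / (\<i> * of_int m))) (at x within {-pi..pi})"
        by (intro has_vector_derivative_mult_left exp_scaleR_has_vector_derivative_right)
      moreover have "exp (x *\<^sub>R (\<i> * of_int m)) = cis (x * of_int m)" for x
        by (simp add: cis_conv_exp scaleR_conv_of_real mult_ac)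
      ultimately show ?thesis using False by (simp add: F_def[abs_def])
    qed
    show "continuous_on {- pi..pi} (\<lambda>x. cis (x * of_int m))"
      by (intro continuous_intros)
  qed simp
  also have "\<dots> = 0"
  proof -
    have "sin (pi * real_of_int m) = 0" by (rule sin_zero_iff_int2[THEN iffD2]) auto
    then show ?thesis by (simp add: F_def complex_eq_iff diff_divide_distrib[symmetric] complex_is_Real_iff cis.code)
  qed
  finally show ?thesis using False by simp
qed

definition torus :: "(real \<times> real) set" where
  "torus = {-pi..pi} \<times> {-pi..pi}"

lemma torus_sets [measurable]: "torus \<in> sets borel"
  unfolding torus_def by (intro borel_closed closed_Times) auto

lemma emeasure_torus: "emeasure lborel torus < \<infinity>"
proof -
  have "torus = cbox (-pi, -pi) (pi, pi)"
    by (auto simp: torus_def cbox_Pair_eq)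
  then show ?thesis using emeasure_lborel_cbox_finite by metis
qed

lemma dot_measurable [measurable (raw)]:
  assumes f: "f \<in> borel_measurable M"
    and "(\<lambda>x. real_of_int (g x $ 1)) \<in> borel_measurable M" "(\<lambda>x. real_of_int (g x $ 2)) \<in> borel_measurable M"
  shows "(\<lambda>x. dot (f x) (g x)) \<in> borel_measurable M"
proof -
  have "(\<lambda>x. fst (f x)) \<in> borel_measurable M" "(\<lambda>x. snd (f x)) \<in> borel_measurable M"
    by (rule measurable_compose[OF f], rule borel_measurable_continuous_onI, intro continuous_intros)+
  with assms(2,3) show ?thesis
    unfolding dot_def by (intro borel_measurable_add borel_measurable_times)
qed

lemma integral_cis_dot:
  "integral\<^sup>L lborel (\<lambda>t. indicator torus t *\<^sub>R cis (dot t y)) = (if y = 0 then of_real (4 * pi\<^sup>2) else 0)"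
proof -
  let ?f = "\<lambda>t. indicator torus t *\<^sub>R cis (dot t y)"
  have int: "integrable lborel ?f"
  proof (rule Bochner_Integration.integrable_bound)
    show "integrable lborel (indicator torus :: _ \<Rightarrow> real)"
      using emeasure_torus by (simp add: integrable_indicator_iff)
    show "?f \<in> borel_measurable lborel" unfolding cis_conv_exp by measurable
  qed (auto simp: indicator_def)
  have "integral\<^sup>L lborel ?f = (\<integral>a. (\<integral>b. ?f (a, b) \<partial>lborel) \<partial>lborel)"
    using lborel_pair.integral_fst'[of ?f] int by (simp add: lborel_prod)
  also have "\<dots> = (\<integral>a. (indicator {-pi..pi} a *\<^sub>R cis (a * of_int (y $ 1))) *
       (\<integral>b. indicator {-pi..pi} b *\<^sub>R cis (b * of_int (y $ 2)) \<partial>lborel) \<partial>lborel)"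
  proof (rule Bochner_Integration.integral_cong)
    fix a
    have "?f (a, b) = (indicator {-pi..pi} a *\<^sub>R cis (a * of_int (y $ 1))) *
       (indicator {-pi..pi} b *\<^sub>R cis (b * of_int (y $ 2)))" for b
      by (auto simp: torus_def indicator_def dot_def cis_mult)
    then show "(\<integral>b. ?f (a, b) \<partial>lborel) = (indicator {-pi..pi} a *\<^sub>R cis (a * of_int (y $ 1))) *
       (\<integral>b. indicator {-pi..pi} b *\<^sub>R cis (b * of_int (y $ 2)) \<partial>lborel)"
      by (simp only: integral_mult_right_zero)
  qed simp
  also have "\<dots> = (if y $ 1 = 0 then of_real (2 * pi) else 0) * (if y $ 2 = 0 then of_real (2 * pi) else 0)"
    by (simp only: integral_mult_left_zero integral_cis_int)
  also have "\<dots> = (if y = 0 then of_real (4 * pi\<^sup>2) else 0)"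
    by (auto simp: vec_eq_iff forall_2 power2_eq_square)
  finally show ?thesis .
qed

lemma char_op_pow_measurable [measurable]:
  fixes K :: "'e::finite \<Rightarrow> ((int ^ 2) \<times> 'e) pmf"
  shows "(\<lambda>t. (char_op K t ^^ n) f j) \<in> borel_measurable borel"
proof -
  have s: "(\<lambda>p. g (snd p)) \<in> borel_measurable (borel \<Otimes>\<^sub>M measure_pmf (walk_pmf K n j))"
    for g :: "(int ^ 2) \<times> 'e \<Rightarrow> 'd::topological_space"
    by (rule measurable_compose[OF measurable_snd]) auto
  have [measurable]: "(\<lambda>p. real_of_int (fst (snd p) $ 1)) \<in> borel_measurable (borel \<Otimes>\<^sub>M measure_pmf (walk_pmf K n j))"
    "(\<lambda>p. real_of_int (fst (snd p) $ 2)) \<in> borel_measurable (borel \<Otimes>\<^sub>M measure_pmf (walk_pmf K n j))"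
    "(\<lambda>p. f (snd (snd p))) \<in> borel_measurable (borel \<Otimes>\<^sub>M measure_pmf (walk_pmf K n j))"
    using s[of "\<lambda>u. real_of_int (fst u $ 1)"] s[of "\<lambda>u. real_of_int (fst u $ 2)"] s[of "\<lambda>u. f (snd u)"] by auto
  show ?thesis
    unfolding char_op_pow_walk
  proof (rule measure_pmf.borel_measurable_lebesgue_integral)
    show "(\<lambda>(t, y, k). cis (dot t y) * f k) \<in> borel_measurable (borel \<Otimes>\<^sub>M measure_pmf (walk_pmf K n j))"
      unfolding case_prod_unfold cis_conv_exp by measurable
  qed
qed

lemma fourier_inversion:
  fixes K :: "'e::finite \<Rightarrow> ((int ^ 2) \<times> 'e) pmf"
  shows "integral\<^sup>L lborel (\<lambda>t. indicator torus t *\<^sub>R ((char_op K t ^^ n) (\<lambda>_. 1) j * cis (- dot t x)))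
         = of_real (4 * pi\<^sup>2 * occ K n j x)"
proof -
  let ?W = "measure_pmf (walk_pmf K n j)"
  let ?f = "\<lambda>u t. indicator torus t *\<^sub>R cis (dot t (fst u - x))"
  interpret pair_sigma_finite ?W lborel
    by (intro pair_sigma_finite.intro measure_pmf.sigma_finite_measure_axioms lborel.sigma_finite_measure_axioms)
  have s: "(\<lambda>p. g (fst p)) \<in> borel_measurable (?W \<Otimes>\<^sub>M lborel)"
    for g :: "(int ^ 2) \<times> 'e \<Rightarrow> real"
    by (rule measurable_compose[OF measurable_fst]) auto
  have [measurable]: "(\<lambda>p. real_of_int ((fst (fst p) - x) $ 1)) \<in> borel_measurable (?W \<Otimes>\<^sub>M lborel)"
    "(\<lambda>p. real_of_int ((fst (fst p) - x) $ 2)) \<in> borel_measurable (?W \<Otimes>\<^sub>M lborel)"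
    using s[of "\<lambda>u. real_of_int ((fst u - x) $ 1)"] s[of "\<lambda>u. real_of_int ((fst u - x) $ 2)"] by auto
  have int: "integrable (?W \<Otimes>\<^sub>M lborel) (case_prod ?f)"
  proof (rule Fubini_integrable)
    show "case_prod ?f \<in> borel_measurable (?W \<Otimes>\<^sub>M lborel)"
      unfolding case_prod_unfold cis_conv_exp by measurable
    have "integrable lborel (?f u)" for u :: "(int ^ 2) \<times> 'e"
    proof (rule Bochner_Integration.integrable_bound)
      show "integrable lborel (indicator torus :: _ \<Rightarrow> real)"
        using emeasure_torus by (simp add: integrable_indicator_iff)
      show "?f u \<in> borel_measurable lborel" unfolding cis_conv_exp by measurable
    qed (auto simp: indicator_def)
    then show "AE u in ?W. integrable lborel (\<lambda>t. case_prod ?f (u, t))" by simp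
    show "integrable ?W (\<lambda>u. \<integral>t. norm (case_prod ?f (u, t)) \<partial>lborel)"
      by simp
  qed
  have "indicator torus t *\<^sub>R ((char_op K t ^^ n) (\<lambda>_. 1) j * cis (- dot t x)) = (\<integral>u. ?f u t \<partial>?W)" for t
  proof -
    have "(\<integral>u. ?f u t \<partial>?W) = indicator torus t *\<^sub>R (\<integral>u. cis (dot t (fst u)) * cis (- dot t x) \<partial>?W)"
      by (simp add: dot_diff cis_mult)
    then show ?thesis
      by (simp only: integral_mult_left_zero char_op_pow_walk case_prod_unfold mult_1_right)
  qed
  then have "integral\<^sup>L lborel (\<lambda>t. indicator torus t *\<^sub>R ((char_op K t ^^ n) (\<lambda>_. 1) j * cis (- dot t x)))
     = (\<integral>t. (\<integral>u. ?f u t \<partial>?W) \<partial>lborel)" by (simp only:)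
  also have "\<dots> = (\<integral>u. (\<integral>t. ?f u t \<partial>lborel) \<partial>?W)"
    by (rule Fubini_integral[OF int])
  also have "\<dots> = (\<integral>u. of_real (4 * pi\<^sup>2 * indicator {u. fst u = x} u) \<partial>?W)"
    by (intro Bochner_Integration.integral_cong refl, simp only: integral_cis_dot) (simp add: indicator_def)
  also have "\<dots> = of_real (4 * pi\<^sup>2 * occ K n j x)"
    by (simp only: integral_complex_of_real) (simp add: occ_def)
  finally show ?thesis .
qed

lemma integral_lborel_scaleR:
  fixes g :: "real \<times> real \<Rightarrow> complex"
  assumes [measurable]: "g \<in> borel_measurable borel" and c: "c > 0"
  shows "integral\<^sup>L lborel (\<lambda>x. g (c *\<^sub>R x)) = integral\<^sup>L lborel g /\<^sub>R c\<^sup>2"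
proof -
  have "integral\<^sup>L lborel g = c\<^sup>2 *\<^sub>R integral\<^sup>L lborel (\<lambda>x. g (c *\<^sub>R x))"
    using c by (subst lborel_affine[of c 0])
      (auto simp: integral_density integral_distr power2_eq_square)
  then show ?thesis using c by simp
qed

text \<open>
  The integrand of the inversion formula after the substitution \<open>t = \<tau> / sqrt n\<close>,
  so that the factor \<open>n\<close> of the local estimates appears
  (\<open>occ_eq_integral_scaled_char\<close>).
\<close>

definition scaled_char ::
  "('e \<Rightarrow> ((int ^ 2) \<times> 'e) pmf) \<Rightarrow> nat \<Rightarrow> 'e \<Rightarrow> int ^ 2 \<Rightarrow> real \<times> real \<Rightarrow> complex" where
  "scaled_char K n j x \<tau> = (let t = (1 / sqrt n) *\<^sub>R \<tau> in
     indicator torus t *\<^sub>R ((char_op K t ^^ n) (\<lambda>_. 1) j * cis (- dot t x)))"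

lemma scaled_char_measurable [measurable]:
  fixes K :: "'e::finite \<Rightarrow> ((int ^ 2) \<times> 'e) pmf"
  shows "scaled_char K n j x \<in> borel_measurable borel"
proof -
  have m: "(\<lambda>t. indicator torus t *\<^sub>R ((char_op K t ^^ n) (\<lambda>_. 1) j * cis (- dot t x))) \<in> borel_measurable borel"
    unfolding cis_conv_exp by measurable
  have "(\<lambda>\<tau> :: real \<times> real. (1 / sqrt n) *\<^sub>R \<tau>) \<in> borel_measurable borel" by measurable
  then show ?thesis
    unfolding scaled_char_def[abs_def] Let_def by (rule measurable_compose[OF _ m])
qed

lemma occ_eq_integral_scaled_char:
  fixes K :: "'e::finite \<Rightarrow> ((int ^ 2) \<times> 'e) pmf"
  assumes "n > 0"
  shows "integral\<^sup>L lborel (scaled_char K n j x) = of_real (4 * pi\<^sup>2 * n * occ K n j x)"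
proof -
  let ?g = "\<lambda>t. indicator torus t *\<^sub>R ((char_op K t ^^ n) (\<lambda>_. 1) j * cis (- dot t x))"
  have "?g \<in> borel_measurable borel"
    unfolding cis_conv_exp by measurable
  from integral_lborel_scaleR[OF this, of "1 / sqrt n"]
  have "integral\<^sup>L lborel (scaled_char K n j x) = of_real (4 * pi\<^sup>2 * occ K n j x) /\<^sub>R (1 / sqrt n)\<^sup>2"
    unfolding scaled_char_def Let_def fourier_inversion using assms by simp
  also have "\<dots> = real n *\<^sub>R of_real (4 * pi\<^sup>2 * occ K n j x)"
    using assms by (simp add: power_divide)
  finally show ?thesis by (simp add: scaleR_conv_of_real)
qed

lemma fourier_decayD:
  assumes "fourier_decay K C c" "\<bar>fst t\<bar> \<le> pi" "\<bar>snd t\<bar> \<le> pi" "\<And>k. cmod (f k) \<le> 1"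
  shows "cmod ((char_op K t ^^ n) f j) \<le> C * exp (- c * real n * ((fst t)\<^sup>2 + (snd t)\<^sup>2))"
  using assms unfolding fourier_decay_def by blast

lemma scaled_char_bound:
  assumes "fourier_decay K C c" "n > 0"
  shows "norm (scaled_char K n j x \<tau>) \<le> C * exp (- c * ((fst \<tau>)\<^sup>2 + (snd \<tau>)\<^sup>2))"
proof (cases "(1 / sqrt n) *\<^sub>R \<tau> \<in> torus")
  case True
  define t where "t = (1 / sqrt n) *\<^sub>R \<tau>"
  have "\<bar>fst t\<bar> \<le> pi" "\<bar>snd t\<bar> \<le> pi" using True by (auto simp: torus_def mem_Times_iff t_def)
  then have "cmod ((char_op K t ^^ n) (\<lambda>_. 1) j) \<le> C * exp (- c * real n * ((fst t)\<^sup>2 + (snd t)\<^sup>2))"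
    by (intro fourier_decayD[OF assms(1)]) auto
  also have "- c * real n * ((fst t)\<^sup>2 + (snd t)\<^sup>2) = - c * ((fst \<tau>)\<^sup>2 + (snd \<tau>)\<^sup>2)"
  proof -
    have "real n * (x / sqrt n)\<^sup>2 = x\<^sup>2" for x using assms(2) by (simp add: power_divide)
    then have "real n * ((fst t)\<^sup>2 + (snd t)\<^sup>2) = (fst \<tau>)\<^sup>2 + (snd \<tau>)\<^sup>2"
      by (simp add: t_def distrib_left)
    then show ?thesis by (simp only: mult.assoc)
  qed
  finally show ?thesis
    using True by (simp add: scaled_char_def Let_def norm_mult flip: t_def)
next
  case False
  have "cmod ((char_op K 0 ^^ 0) (\<lambda>_. 1) j) \<le> C * exp (- c * real 0 * ((fst (0 :: real \<times> real))\<^sup>2 + (snd (0 :: real \<times> real))\<^sup>2))"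
    by (intro fourier_decayD[OF assms(1)]) auto
  then have "C \<ge> 0" by simp
  with False show ?thesis by (simp add: scaled_char_def Let_def)
qed

text \<open>
  The dominating function for the rescaled Fourier integrals.
\<close>

lemma integrable_gaussian:
  assumes "c > 0"
  shows "integrable lborel (\<lambda>\<tau> :: real \<times> real. exp (- c * ((fst \<tau>)\<^sup>2 + (snd \<tau>)\<^sup>2)))"
proof -
  have 1: "integrable lborel (\<lambda>x :: real. exp (- c * x\<^sup>2))"
  proof -
    have "integrable lborel (\<lambda>x. sqrt (pi / c) * normal_density 0 (1 / sqrt (2 * c)) x)"
      by (intro integrable_mult_right integrable_normal_density) (use assms in auto)
    also have "(\<lambda>x. sqrt (pi / c) * normal_density 0 (1 / sqrt (2 * c)) x) = (\<lambda>x. exp (- c * x\<^sup>2))"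
    proof
      fix x :: real
      have s: "(1 / sqrt (2 * c))\<^sup>2 = 1 / (2 * c)" using assms by (simp add: power_divide)
      have e: "- (x - 0)\<^sup>2 / (2 * (1 / (2 * c))) = - c * x\<^sup>2" "2 * pi * (1 / (2 * c)) = pi / c"
        using assms by simp_all
      show "sqrt (pi / c) * normal_density 0 (1 / sqrt (2 * c)) x = exp (- c * x\<^sup>2)"
        unfolding normal_density_def s e using assms by simp
    qed
    finally show ?thesis .
  qed
  have "integrable (lborel \<Otimes>\<^sub>M lborel) (\<lambda>\<tau> :: real \<times> real. exp (- c * (fst \<tau>)\<^sup>2) * exp (- c * (snd \<tau>)\<^sup>2))"
  proof (rule lborel_pair.Fubini_integrable)
    show "integrable lborel (\<lambda>x. \<integral>y. norm (exp (- c * (fst (x, y))\<^sup>2) * exp (- c * (snd (x, y :: real))\<^sup>2)) \<partial>lborel)"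
      using 1 by simp
  qed (use 1 in auto)
  then show ?thesis
    unfolding lborel_prod by (simp only: distrib_left exp_add)
qed

lemma occ_upper:
  fixes K :: "'e::finite \<Rightarrow> ((int ^ 2) \<times> 'e) pmf"
  assumes "fourier_decay K C c"
  obtains A where "A > 0" "\<And>n j x. occ K n j x \<le> A / (real n + 1)"
proof -
  have c: "c > 0" using assms by (simp add: fourier_decay_def)
  define G where "G = integral\<^sup>L lborel (\<lambda>\<tau> :: real \<times> real. C * exp (- c * ((fst \<tau>)\<^sup>2 + (snd \<tau>)\<^sup>2)))"
  have bnd: "4 * pi\<^sup>2 * n * occ K n j x \<le> G" if "n > 0" for n j x
  proof -
    have "norm (integral\<^sup>L lborel (scaled_char K n j x)) \<le> integral\<^sup>L lborel (\<lambda>\<tau>. norm (scaled_char K n j x \<tau>))"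
      by (rule integral_norm_bound)
    also have "\<dots> \<le> G"
      unfolding G_def
    proof (rule integral_mono)
      have i: "integrable lborel (\<lambda>\<tau> :: real \<times> real. C * exp (- c * ((fst \<tau>)\<^sup>2 + (snd \<tau>)\<^sup>2)))"
        by (intro integrable_mult_right integrable_gaussian c)
      then show "integrable lborel (\<lambda>\<tau> :: real \<times> real. C * exp (- c * ((fst \<tau>)\<^sup>2 + (snd \<tau>)\<^sup>2)))" .
      show "integrable lborel (\<lambda>\<tau>. norm (scaled_char K n j x \<tau>))"
      proof (rule Bochner_Integration.integrable_bound[OF i])
        show "AE \<tau> in lborel. norm (norm (scaled_char K n j x \<tau>)) \<le>
            norm (C * exp (- c * ((fst \<tau>)\<^sup>2 + (snd \<tau>)\<^sup>2)))"
          unfolding real_norm_def abs_norm_cancel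
          by (intro AE_I2 order_trans[OF scaled_char_bound[OF assms that] abs_ge_self])
      qed measurable
    qed (rule scaled_char_bound[OF assms that])
    finally show ?thesis
      unfolding occ_eq_integral_scaled_char[OF that] norm_of_real by linarith
  qed
  \<comment> \<open>the maximum with 1 covers \<open>n = 0\<close>\<close>
  have "occ K n j x \<le> max 1 G / (real n + 1)" for n j x
  proof (cases "n = 0")
    case True
    then show ?thesis using occ_le_1[of K 0 j x] by simp
  next
    case False
    have "(real n + 1) * occ K n j x \<le> 4 * pi\<^sup>2 * n * occ K n j x"
    proof (rule mult_right_mono)
      have "real n + 1 \<le> 4 * 1 * real n" using False by simp
      also have "\<dots> \<le> 4 * pi\<^sup>2 * n"
        using pi_ge_two by (intro mult_right_mono mult_left_mono one_le_power) auto
      finally show "real n + 1 \<le> 4 * pi\<^sup>2 * n" .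
    qed (rule occ_nonneg)
    also have "\<dots> \<le> max 1 G" using bnd[of n j x] False by simp
    finally show ?thesis by (simp add: field_simps)
  qed
  then show ?thesis by (intro that[of "max 1 G"]) auto
qed

section \<open>Gaussian limit of the characteristic operator\<close>

lemma cis_taylor: "cmod (cis x - (1 + \<i> * x - x\<^sup>2 / 2)) \<le> \<bar>x\<bar> ^ 3 / 6"
proof -
  have "(\<Sum>k\<le>2. (\<i> * complex_of_real x) ^ k / fact k) = 1 + \<i> * x - x\<^sup>2 / 2"
    by (simp add: numeral_2_eq_2 power_mult_distrib)
  then show ?thesis
    using iexp_approx1[of x 2] by (simp add: cis_conv_exp numeral_3_eq_3)
qed

lemma char_op_diff:
  fixes K :: "'e::finite \<Rightarrow> ((int ^ 2) \<times> 'e) pmf"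
  shows "char_op K t (\<lambda>k. f k - g k) j = char_op K t f j - char_op K t g j"
proof -
  have i: "integrable (K j) (\<lambda>(y, k). cis (dot t y) * h k)" for h :: "'e \<Rightarrow> complex"
  proof -
    obtain B where "\<And>k. cmod (h k) \<le> B" using finite_bound[of h] by blast
    then show ?thesis by (intro integrable_pmf_bounded[where B = B]) (auto simp: norm_mult)
  qed
  show ?thesis
    using Bochner_Integration.integral_diff[OF i[of f] i[of g]]
    by (simp add: char_op_def case_prod_unfold right_diff_distrib)
qed

lemma char_op_pow_diff:
  fixes K :: "'e::finite \<Rightarrow> ((int ^ 2) \<times> 'e) pmf"
  shows "(char_op K t ^^ n) (\<lambda>k. f k - g k) j = (char_op K t ^^ n) f j - (char_op K t ^^ n) g j"
proof (induction n arbitrary: j)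
  case (Suc n)
  then have "(char_op K t ^^ n) (\<lambda>k. f k - g k) = (\<lambda>j. (char_op K t ^^ n) f j - (char_op K t ^^ n) g j)"
    by (intro ext)
  then show ?case by (simp only: funpow.simps comp_apply char_op_diff)
qed simp

lemma char_op_scale: "char_op K t (\<lambda>k. c * f k) j = c * char_op K t f j"
proof -
  have "(\<lambda>(y, k). cis (dot t y) * (c * f k)) = (\<lambda>u. c * (case u of (y, k) \<Rightarrow> cis (dot t y) * f k))"
    by (auto simp: fun_eq_iff mult_ac)
  then show ?thesis by (simp add: char_op_def)
qed

text \<open>
  Errors of an approximate eigenvector accumulate only linearly, because the operator does not
  increase the supremum norm.
\<close>

lemma approx_eigenvector:
  fixes K :: "'e::finite \<Rightarrow> ((int ^ 2) \<times> 'e) pmf"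
  assumes step: "\<And>j. cmod (char_op K t h j - l * h j) \<le> d" and L: "cmod l \<le> L" "1 \<le> L"
  shows "cmod ((char_op K t ^^ n) h j - l ^ n * h j) \<le> real n * L ^ n * d"
proof (induction n arbitrary: j)
  case (Suc n)
  have d: "0 \<le> d" using step[of j] norm_ge_zero order_trans by blast
  let ?g = "\<lambda>k. (char_op K t ^^ n) h k - l ^ n * h k"
  have "(char_op K t ^^ Suc n) h j - l ^ Suc n * h j =
        char_op K t ?g j + l ^ n * (char_op K t h j - l * h j)"
    by (simp only: char_op_diff char_op_scale funpow.simps comp_apply power_Suc) (simp add: algebra_simps)
  also have "cmod \<dots> \<le> real n * L ^ n * d + L ^ n * d"
  proof (intro order_trans[OF norm_triangle_ineq] add_mono)
    show "cmod (char_op K t ?g j) \<le> real n * L ^ n * d"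
      by (rule char_op_bound) (rule Suc.IH)
    show "cmod (l ^ n * (char_op K t h j - l * h j)) \<le> L ^ n * d"
      unfolding norm_mult norm_power using L d step[of j] by (intro mult_mono power_mono) auto
  qed
  also have "\<dots> = real (Suc n) * L ^ n * d"
    by (simp add: algebra_simps)
  also have "\<dots> \<le> real (Suc n) * L ^ Suc n * d"
    using L d by (intro mult_right_mono mult_left_mono power_increasing) auto
  finally show ?case .
qed simp

text \<open>
  Expansion to third order of the integrand of the operator applied to the corrected constant
  \<open>1 + i \<epsilon> u + \<epsilon>\<^sup>2 q\<close>.
\<close>

lemma taylor_remainder_bound:
  fixes x \<epsilon> u q B :: real
  assumes \<epsilon>: "0 < \<epsilon>" "\<epsilon> \<le> 1" and B: "\<bar>u\<bar> \<le> B" "\<bar>q\<bar> \<le> B"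
  shows "cmod (cis (\<epsilon> * x) * (1 + \<i> * complex_of_real \<epsilon> * of_real u + (of_real \<epsilon>)\<^sup>2 * of_real q)
           - (1 + \<i> * complex_of_real \<epsilon> * of_real (x + u) + (of_real \<epsilon>)\<^sup>2 * of_real (q - x * u - x\<^sup>2 / 2)))
         \<le> \<epsilon> ^ 3 * ((1 + 5 * B) * (1 + \<bar>x\<bar> ^ 3))"
proof -
  define h where "h = 1 + \<i> * complex_of_real \<epsilon> * of_real u + (of_real \<epsilon>)\<^sup>2 * of_real q"
  define R where "R = cis (\<epsilon> * x) - (1 + \<i> * (\<epsilon> * x) - (\<epsilon> * x)\<^sup>2 / 2)"
  have B0: "0 \<le> B" using B(1) by linarith
  have e: "\<epsilon>\<^sup>2 \<le> 1" "\<epsilon> ^ 4 \<le> \<epsilon> ^ 3"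
    using \<epsilon> by (auto simp: power_le_one intro: power_decreasing)
  have h: "cmod h \<le> 1 + 2 * B"
  proof -
    have "cmod h \<le> 1 + \<epsilon> * \<bar>u\<bar> + \<epsilon>\<^sup>2 * \<bar>q\<bar>"
      unfolding h_def using \<epsilon>
      by (intro order_trans[OF norm_triangle_ineq] add_mono) (auto simp: norm_mult norm_power)
    also have "\<dots> \<le> 1 + 1 * B + 1 * B"
      using \<epsilon> e B by (intro add_mono mult_mono) auto
    finally show ?thesis by simp
  qed
  have R: "cmod R \<le> \<epsilon> ^ 3 * \<bar>x\<bar> ^ 3"
  proof -
    have "cmod R \<le> \<bar>\<epsilon> * x\<bar> ^ 3 / 6" using cis_taylor[of "\<epsilon> * x"] by (simp add: R_def)
    also have "\<dots> \<le> \<bar>\<epsilon> * x\<bar> ^ 3" by simp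
    finally show ?thesis using \<epsilon> by (simp add: abs_mult power_mult_distrib)
  qed
  have "cis (\<epsilon> * x) * h - (1 + \<i> * complex_of_real \<epsilon> * of_real (x + u) + (of_real \<epsilon>)\<^sup>2 * of_real (q - x * u - x\<^sup>2 / 2))
      = of_real (\<epsilon> ^ 3) * (\<i> * of_real (x * q - x\<^sup>2 * u / 2)) + of_real (\<epsilon> ^ 4) * of_real (- x\<^sup>2 * q / 2) + R * h"
  proof -
    have c: "cis (\<epsilon> * x) = R + (1 + \<i> * (\<epsilon> * x) - (\<epsilon> * x)\<^sup>2 / 2)" by (simp add: R_def)
    show ?thesis unfolding c h_def
      by (simp add: field_simps power2_eq_square power3_eq_cube power4_eq_xxxx)
  qed
  also have "cmod \<dots> \<le> \<epsilon> ^ 3 * (\<bar>x * q\<bar> + \<bar>x\<^sup>2 * u\<bar>) + \<epsilon> ^ 3 * \<bar>x\<^sup>2 * q\<bar> + \<epsilon> ^ 3 * \<bar>x\<bar> ^ 3 * (1 + 2 * B)"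
  proof (intro order_trans[OF norm_triangle_ineq] add_mono)
    have "\<bar>a - b / 2\<bar> \<le> \<bar>a\<bar> + \<bar>b\<bar>" for a b :: real by (auto simp: abs_if field_simps)
    from this[of "x * q" "x\<^sup>2 * u"] have "\<bar>x * q - x\<^sup>2 * u / 2\<bar> \<le> \<bar>x * q\<bar> + \<bar>x\<^sup>2 * u\<bar>" .
    then show "cmod (of_real (\<epsilon> ^ 3) * (\<i> * of_real (x * q - x\<^sup>2 * u / 2))) \<le> \<epsilon> ^ 3 * (\<bar>x * q\<bar> + \<bar>x\<^sup>2 * u\<bar>)"
      using \<epsilon> by (simp add: norm_mult norm_power del: of_real_diff of_real_divide of_real_mult)
    have "\<epsilon> ^ 4 * \<bar>- x\<^sup>2 * q / 2\<bar> \<le> \<epsilon> ^ 3 * \<bar>x\<^sup>2 * q\<bar>"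
      using e \<epsilon> by (intro mult_mono) (auto simp: abs_mult)
    then show "cmod (of_real (\<epsilon> ^ 4) * of_real (- x\<^sup>2 * q / 2)) \<le> \<epsilon> ^ 3 * \<bar>x\<^sup>2 * q\<bar>"
      using \<epsilon> by (simp only: norm_mult norm_of_real) simp
    show "cmod (R * h) \<le> \<epsilon> ^ 3 * \<bar>x\<bar> ^ 3 * (1 + 2 * B)"
      unfolding norm_mult using R h \<epsilon> by (intro mult_mono) auto
  qed
  also have "\<dots> = \<epsilon> ^ 3 * (\<bar>x * q\<bar> + \<bar>x\<^sup>2 * u\<bar> + \<bar>x\<^sup>2 * q\<bar> + \<bar>x\<bar> ^ 3 * (1 + 2 * B))"
    by (simp add: algebra_simps)
  also have "\<dots> \<le> \<epsilon> ^ 3 * ((1 + 5 * B) * (1 + \<bar>x\<bar> ^ 3))"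
  proof (rule mult_left_mono)
    have x1: "\<bar>x\<bar> \<le> 1 + \<bar>x\<bar> ^ 3" and x2: "x\<^sup>2 \<le> 1 + \<bar>x\<bar> ^ 3"
      using power_le_one_plus_power[of 1 3 x] power_le_one_plus_power[of 2 3 x] by simp_all
    have "\<bar>x * q\<bar> \<le> (1 + \<bar>x\<bar> ^ 3) * B" "\<bar>x\<^sup>2 * u\<bar> \<le> (1 + \<bar>x\<bar> ^ 3) * B" "\<bar>x\<^sup>2 * q\<bar> \<le> (1 + \<bar>x\<bar> ^ 3) * B"
      unfolding abs_mult using x1 x2 B by (auto intro!: mult_mono)
    moreover have "\<bar>x\<bar> ^ 3 * (1 + 2 * B) \<le> (1 + \<bar>x\<bar> ^ 3) * (1 + 2 * B)"
      using B0 by (intro mult_right_mono) auto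
    ultimately show "\<bar>x * q\<bar> + \<bar>x\<^sup>2 * u\<bar> + \<bar>x\<^sup>2 * q\<bar> + \<bar>x\<bar> ^ 3 * (1 + 2 * B) \<le> (1 + 5 * B) * (1 + \<bar>x\<bar> ^ 3)"
      by (simp add: algebra_simps)
  qed (use \<epsilon> in simp)
  finally show ?thesis by (simp only: h_def)
qed

text \<open>
  The assumptions on \<open>u\<close> and \<open>q\<close> say that the terms of first and second
  order cancel, so that \<open>1 + i \<epsilon> u + \<epsilon>\<^sup>2 q\<close> is an eigenvector
  for the eigenvalue \<open>1 - \<epsilon>\<^sup>2 s / 2\<close> up to an error of order
  \<open>\<epsilon>\<^sup>3\<close>. With \<open>\<epsilon> = 1 / sqrt n\<close> the
  \<open>n\<close>-th power of the eigenvalue tends to \<open>exp (- s / 2)\<close>, while the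
  accumulated error is of order \<open>n \<epsilon>\<^sup>3 = \<epsilon>\<close>.
\<close>

lemma char_op_limit:
  fixes K :: "'e::finite \<Rightarrow> ((int ^ 2) \<times> 'e) pmf" and u q :: "'e \<Rightarrow> real"
  assumes int3: "\<And>j. integrable (K j) (\<lambda>v. \<bar>dot \<tau> (fst v)\<bar> ^ 3)"
    and u: "\<And>j. u j = \<E> (K j) (\<lambda>v. dot \<tau> (fst v) + u (snd v))"
    and q: "\<And>j. q j - s / 2 = \<E> (K j)
              (\<lambda>v. q (snd v) - dot \<tau> (fst v) * u (snd v) - (dot \<tau> (fst v))\<^sup>2 / 2)"
  shows "(\<lambda>n. (char_op K ((1 / sqrt (real n)) *\<^sub>R \<tau>) ^^ n) (\<lambda>_. 1) j) \<longlonglongrightarrow> of_real (exp (- s / 2))"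
proof -
  let ?X = "\<lambda>v :: (int ^ 2) \<times> 'e. dot \<tau> (fst v)"
  obtain Bu where Bu: "\<And>k. \<bar>u k\<bar> \<le> Bu" using finite_bound[of u] by auto
  obtain Bq where Bq: "\<And>k. \<bar>q k\<bar> \<le> Bq" using finite_bound[of q] by auto
  define B where "B = max Bu Bq"
  have B: "\<bar>u k\<bar> \<le> B" "\<bar>q k\<bar> \<le> B" for k using Bu[of k] Bq[of k] by (auto simp: B_def)
  have B0: "0 \<le> B" using B(1)[of j] by linarith
  define D where "D = (\<Sum>j\<in>UNIV. (1 + 5 * B) * \<E> (K j) (\<lambda>v. 1 + \<bar>?X v\<bar> ^ 3)) + \<bar>s\<bar> * B"
  define h where "h \<epsilon> k = 1 + \<i> * complex_of_real \<epsilon> * of_real (u k) + (of_real \<epsilon>)\<^sup>2 * of_real (q k)" for \<epsilon> k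
  define l where "l \<epsilon> = 1 - \<epsilon>\<^sup>2 * (s / 2)" for \<epsilon> :: real
  have i3: "integrable (K j) (\<lambda>v. 1 + \<bar>?X v\<bar> ^ 3)" for j using int3 by simp
  have dom: "integrable (K j) f" if "\<And>v. norm (f v) \<le> c * (1 + \<bar>?X v\<bar> ^ 3)" for f :: "_ \<Rightarrow> real" and c j
  proof (rule Bochner_Integration.integrable_bound)
    show "integrable (K j) (\<lambda>v. c * (1 + \<bar>?X v\<bar> ^ 3))" by (intro integrable_mult_right i3)
    show "AE v in K j. norm (f v) \<le> norm (c * (1 + \<bar>?X v\<bar> ^ 3))"
      unfolding real_norm_def by (intro AE_I2 order_trans[OF that[unfolded real_norm_def] abs_ge_self])
  qed simp
  have x1: "\<bar>x\<bar> \<le> 1 + \<bar>x\<bar> ^ 3" and x2: "x\<^sup>2 \<le> 1 + \<bar>x\<bar> ^ 3" for x :: real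
    using power_le_one_plus_power[of 1 3 x] power_le_one_plus_power[of 2 3 x] by simp_all
  have ia: "integrable (K j) (\<lambda>v. ?X v + u (snd v))" for j
  proof (rule dom[where c = "1 + B"])
    fix v
    show "norm (?X v + u (snd v)) \<le> (1 + B) * (1 + \<bar>?X v\<bar> ^ 3)"
    proof -
      have "norm (?X v + u (snd v)) \<le> 1 * (1 + \<bar>?X v\<bar> ^ 3) + B * 1"
        using x1[of "?X v"] B(1)[of "snd v"] by simp
      also have "\<dots> \<le> 1 * (1 + \<bar>?X v\<bar> ^ 3) + B * (1 + \<bar>?X v\<bar> ^ 3)"
        using B0 by (intro add_mono mult_left_mono) auto
      finally show ?thesis by (simp add: algebra_simps)
    qed
  qed
  have ib: "integrable (K j) (\<lambda>v. q (snd v) - ?X v * u (snd v) - (?X v)\<^sup>2 / 2)" for j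
  proof (rule dom[where c = "1 + 2 * B"])
    fix v
    have "\<bar>a - b - c / 2\<bar> \<le> \<bar>a\<bar> + \<bar>b\<bar> + c" if "0 \<le> c" for a b c :: real
      using that by (auto simp: abs_if field_simps)
    from this[of "(?X v)\<^sup>2" "q (snd v)" "?X v * u (snd v)"]
    have "norm (q (snd v) - ?X v * u (snd v) - (?X v)\<^sup>2 / 2) \<le> \<bar>q (snd v)\<bar> + \<bar>?X v\<bar> * \<bar>u (snd v)\<bar> + (?X v)\<^sup>2"
      by (simp add: abs_mult)
    also have "\<dots> \<le> B * (1 + \<bar>?X v\<bar> ^ 3) + (1 + \<bar>?X v\<bar> ^ 3) * B + (1 + \<bar>?X v\<bar> ^ 3)"
    proof (intro add_mono mult_mono x1 x2 B)
      have "B * 1 \<le> B * (1 + \<bar>?X v\<bar> ^ 3)" using B0 by (intro mult_left_mono) auto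
      then show "\<bar>q (snd v)\<bar> \<le> B * (1 + \<bar>?X v\<bar> ^ 3)" using B(2)[of "snd v"] by linarith
    qed auto
    finally show "norm (q (snd v) - ?X v * u (snd v) - (?X v)\<^sup>2 / 2) \<le> (1 + 2 * B) * (1 + \<bar>?X v\<bar> ^ 3)"
      by (simp add: algebra_simps)
  qed
  have step: "cmod (char_op K (\<epsilon> *\<^sub>R \<tau>) (h \<epsilon>) j - of_real (l \<epsilon>) * h \<epsilon> j) \<le> \<epsilon> ^ 3 * D"
    if \<epsilon>: "0 < \<epsilon>" "\<epsilon> \<le> 1" for \<epsilon> j
  proof -
    let ?m = "\<lambda>v. 1 + \<i> * complex_of_real \<epsilon> * of_real (?X v + u (snd v))
        + (of_real \<epsilon>)\<^sup>2 * of_real (q (snd v) - ?X v * u (snd v) - (?X v)\<^sup>2 / 2)"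
    let ?f = "\<lambda>v. cis (\<epsilon> * ?X v) * h \<epsilon> (snd v)"
    have im: "integrable (K j) ?m"
      by (intro Bochner_Integration.integrable_add integrable_mult_right integrable_of_real ia ib) simp
    have hb: "cmod (h \<epsilon> k) \<le> 1 + 2 * B" for k
    proof -
      have "cmod (h \<epsilon> k) \<le> 1 + \<epsilon> * \<bar>u k\<bar> + \<epsilon>\<^sup>2 * \<bar>q k\<bar>"
        unfolding h_def using \<epsilon>
        by (intro order_trans[OF norm_triangle_ineq] add_mono) (auto simp: norm_mult norm_power)
      also have "\<dots> \<le> 1 + 1 * B + 1 * B"
        using \<epsilon> B by (intro add_mono mult_mono) (auto simp: power_le_one)
      finally show ?thesis by simp
    qed
    have if_: "integrable (K j) ?f"
      by (rule integrable_pmf_bounded[where B = "1 + 2 * B"]) (use hb in \<open>auto simp: norm_mult\<close>)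
    have em: "\<E> (K j) ?m
        = 1 + \<i> * complex_of_real \<epsilon> * of_real (u j) + (of_real \<epsilon>)\<^sup>2 * of_real (q j - s / 2)"
    proof -
      have "\<E> (K j) (\<lambda>v. 1 + c * complex_of_real (a v) + d * of_real (b v))
          = 1 + c * of_real (\<E> (K j) a) + d * of_real (\<E> (K j) b)"
        if "integrable (K j) a" "integrable (K j) b" for a b :: "_ \<Rightarrow> real" and c d
        using that by simp
      from this[OF ia ib] show ?thesis by (simp only: u[symmetric] q[symmetric])
    qed
    have "cmod (\<E> (K j) ?f - \<E> (K j) ?m) \<le>
        \<E> (K j) (\<lambda>v. \<epsilon> ^ 3 * ((1 + 5 * B) * (1 + \<bar>?X v\<bar> ^ 3)))"
    proof -
      have "cmod (\<E> (K j) ?f - \<E> (K j) ?m)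
          = cmod (\<E> (K j) (\<lambda>v. ?f v - ?m v))"
        by (simp only: Bochner_Integration.integral_diff[OF if_ im])
      also have "\<dots> \<le> \<E> (K j) (\<lambda>v. cmod (?f v - ?m v))"
        by (rule integral_norm_bound)
      also have "\<dots> \<le> \<E> (K j) (\<lambda>v. \<epsilon> ^ 3 * ((1 + 5 * B) * (1 + \<bar>?X v\<bar> ^ 3)))"
      proof (rule integral_mono)
        show "integrable (K j) (\<lambda>v. cmod (?f v - ?m v))"
          by (intro integrable_norm Bochner_Integration.integrable_diff if_ im)
        show "integrable (K j) (\<lambda>v. \<epsilon> ^ 3 * ((1 + 5 * B) * (1 + \<bar>?X v\<bar> ^ 3)))"
          by (intro integrable_mult_right i3)
        show "cmod (?f v - ?m v) \<le> \<epsilon> ^ 3 * ((1 + 5 * B) * (1 + \<bar>?X v\<bar> ^ 3))" for v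
          unfolding h_def by (rule taylor_remainder_bound[OF \<epsilon> B])
      qed
      finally show ?thesis .
    qed
    also have "\<dots> = \<epsilon> ^ 3 * ((1 + 5 * B) * \<E> (K j) (\<lambda>v. 1 + \<bar>?X v\<bar> ^ 3))"
      by simp
    also have "\<dots> \<le> \<epsilon> ^ 3 * (\<Sum>j\<in>UNIV. (1 + 5 * B) * \<E> (K j) (\<lambda>v. 1 + \<bar>?X v\<bar> ^ 3))"
      by (intro mult_left_mono member_le_sum[of j UNIV "\<lambda>j. (1 + 5 * B) * \<E> (K j) (\<lambda>v. 1 + \<bar>?X v\<bar> ^ 3)"])
         (use \<epsilon> B0 in \<open>auto intro!: mult_nonneg_nonneg Bochner_Integration.integral_nonneg\<close>)
    finally have 1: "cmod (\<E> (K j) ?f - \<E> (K j) ?m)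
      \<le> \<epsilon> ^ 3 * (\<Sum>j\<in>UNIV. (1 + 5 * B) * \<E> (K j) (\<lambda>v. 1 + \<bar>?X v\<bar> ^ 3))" .
    have "\<E> (K j) ?m - of_real (l \<epsilon>) * h \<epsilon> j
        = of_real (\<epsilon> ^ 3) * (\<i> * of_real (s * u j / 2) + of_real (\<epsilon> * s * q j / 2))"
      unfolding em h_def l_def by (simp add: field_simps power2_eq_square power3_eq_cube)
    also have "cmod \<dots> \<le> \<epsilon> ^ 3 * (\<bar>s\<bar> * B / 2 + \<bar>s\<bar> * B / 2)"
      unfolding norm_mult
    proof (intro mult_mono order_trans[OF norm_triangle_ineq] add_mono)
      show "cmod (\<i> * of_real (s * u j / 2)) \<le> \<bar>s\<bar> * B / 2"
        using B(1)[of j] by (auto simp: norm_mult abs_mult intro!: mult_left_mono)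
      have "\<epsilon> * (\<bar>s\<bar> * \<bar>q j\<bar>) \<le> 1 * (\<bar>s\<bar> * B)"
        using \<epsilon> B0 B(2)[of j] by (intro mult_mono) auto
      then show "cmod (of_real (\<epsilon> * s * q j / 2)) \<le> \<bar>s\<bar> * B / 2"
        using \<epsilon> by (simp add: norm_mult abs_mult)
    qed (use \<epsilon> in \<open>auto simp: norm_power\<close>)
    finally have 2: "cmod (\<E> (K j) ?m - of_real (l \<epsilon>) * h \<epsilon> j) \<le> \<epsilon> ^ 3 * (\<bar>s\<bar> * B)"
      by (simp only: field_sum_of_halves)
    have c: "char_op K (\<epsilon> *\<^sub>R \<tau>) (h \<epsilon>) j = \<E> (K j) ?f"
      by (simp add: char_op_def dot_scaleR case_prod_unfold)
    have "cmod (char_op K (\<epsilon> *\<^sub>R \<tau>) (h \<epsilon>) j - of_real (l \<epsilon>) * h \<epsilon> j) \<le>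
       cmod (\<E> (K j) ?f - \<E> (K j) ?m)
       + cmod (\<E> (K j) ?m - of_real (l \<epsilon>) * h \<epsilon> j)"
      unfolding c by (rule order_trans[OF _ norm_triangle_ineq]) simp
    then show ?thesis using 1 2 unfolding D_def distrib_left by linarith
  qed
  \<comment> \<open>a bound for the powers of the eigenvalue, valid for either sign of \<open>s\<close>\<close>
  define L where "L = exp (\<bar>s\<bar> / 2)"
  have bound: "cmod ((char_op K ((1 / sqrt (real n)) *\<^sub>R \<tau>) ^^ n) (\<lambda>_. 1) j - of_real (l (1 / sqrt (real n)) ^ n))
      \<le> (1 / sqrt n) * (L * D + 2 * B + L * (2 * B))" if n: "n > 0" for n :: nat
  proof -
    let ?e = "1 / sqrt (real n)"
    have e: "0 < ?e" "?e \<le> 1" using n by auto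
    have e2: "?e\<^sup>2 = 1 / n" by (simp add: power_divide)
    let ?T = "char_op K (?e *\<^sub>R \<tau>) ^^ n"
    define L1 where "L1 = 1 + \<bar>s\<bar> / 2 / n"
    have L1: "\<bar>l ?e\<bar> \<le> L1" "1 \<le> L1"
      unfolding L1_def l_def e2 using n by (auto simp: abs_if field_simps)
    have L1n: "L1 ^ n \<le> L"
    proof -
      have "L1 ^ n \<le> exp (\<bar>s\<bar> / 2 / n) ^ n"
        unfolding L1_def by (intro power_mono exp_ge_add_one_self) simp
      also have "\<dots> = L" using n by (simp add: L_def flip: exp_of_nat_mult)
      finally show ?thesis .
    qed
    have 1: "cmod (?T (h ?e) j - of_real (l ?e) ^ n * h ?e j) \<le> real n * L1 ^ n * (?e ^ 3 * D)"
      by (rule approx_eigenvector) (use L1 step[OF e] in auto)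
    have D0: "0 \<le> D"
      unfolding D_def using B0
      by (auto intro!: add_nonneg_nonneg sum_nonneg mult_nonneg_nonneg Bochner_Integration.integral_nonneg)
    have "real n * ?e ^ 3 = ?e" using n by (simp add: power3_eq_cube field_simps)
    then have "real n * L1 ^ n * (?e ^ 3 * D) = ?e * (L1 ^ n * D)" by (metis mult.assoc mult.commute)
    also have "\<dots> \<le> ?e * (L * D)" using L1n D0 e by (intro mult_left_mono mult_right_mono) auto
    finally have 1: "cmod (?T (h ?e) j - of_real (l ?e) ^ n * h ?e j) \<le> ?e * (L * D)" using 1 by linarith
    have h1: "cmod (h ?e k - 1) \<le> ?e * (2 * B)" for k
    proof -
      have "cmod (h ?e k - 1) \<le> ?e * \<bar>u k\<bar> + ?e\<^sup>2 * \<bar>q k\<bar>"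
        unfolding h_def by (rule order_trans[OF _ order_trans[OF norm_triangle_ineq]], rule order_refl[THEN order_trans])
           (auto simp: norm_mult norm_power norm_divide)
      also have "\<dots> \<le> ?e * B + ?e * B"
      proof -
        have "?e\<^sup>2 \<le> ?e" unfolding power2_eq_square by (rule mult_left_le) (use e in auto)
        then show ?thesis using e B by (intro add_mono mult_mono) auto
      qed
      finally show ?thesis by simp
    qed
    have 2: "cmod (?T (h ?e) j - ?T (\<lambda>_. 1) j) \<le> ?e * (2 * B)"
      unfolding char_op_pow_diff[symmetric] by (rule char_op_pow_bound) (rule h1)
    have "cmod (of_real (l ?e) ^ n * h ?e j - of_real (l ?e) ^ n) = \<bar>l ?e\<bar> ^ n * cmod (h ?e j - 1)"
    proof -
      have "of_real (l ?e) ^ n * h ?e j - of_real (l ?e) ^ n = of_real (l ?e) ^ n * (h ?e j - 1)"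
        by (simp only: right_diff_distrib mult_1_right)
      then show ?thesis by (simp only: norm_mult norm_power norm_of_real)
    qed
    also have "\<dots> \<le> L * (?e * (2 * B))"
      by (intro mult_mono h1 order_trans[OF power_mono[OF L1(1)] L1n]) (auto simp: L_def)
    finally have 3: "cmod (of_real (l ?e) ^ n * h ?e j - of_real (l ?e) ^ n) \<le> L * (?e * (2 * B))" .
    have "cmod (a - d) \<le> cmod (b - c) + cmod (b - a) + cmod (c - d)" for a b c d :: complex
    proof -
      have "a - d = (b - c) - (b - a) + (c - d)" by simp
      also have "cmod \<dots> \<le> cmod ((b - c) - (b - a)) + cmod (c - d)" by (rule norm_triangle_ineq)
      finally show ?thesis using norm_triangle_ineq4[of "b - c" "b - a"] by linarith
    qed
    from this[of "?T (\<lambda>_. 1) j" "of_real (l ?e) ^ n" "?T (h ?e) j" "of_real (l ?e) ^ n * h ?e j"] 1 2 3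
    show ?thesis by (simp add: distrib_left mult_ac)
  qed
  have lim0: "(\<lambda>n. (1 / sqrt (real n)) * (L * D + 2 * B + L * (2 * B))) \<longlonglongrightarrow> 0"
    by (intro tendsto_mult_left_zero) real_asymp
  have diff: "(\<lambda>n. (char_op K ((1 / sqrt (real n)) *\<^sub>R \<tau>) ^^ n) (\<lambda>_. 1) j - of_real (l (1 / sqrt (real n)) ^ n)) \<longlonglongrightarrow> 0"
    by (rule Lim_null_comparison[OF _ lim0])
       (use bound in \<open>auto intro!: eventually_sequentiallyI[of 1]\<close>)
  have main: "(\<lambda>n. complex_of_real (l (1 / sqrt (real n)) ^ n)) \<longlonglongrightarrow> of_real (exp (- s / 2))"
  proof (intro tendsto_of_real)
    have "(\<lambda>n. (1 + (- s / 2) / real n) ^ n) \<longlonglongrightarrow> exp (- s / 2)"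
      by (rule tendsto_exp_limit_sequentially)
    then show "(\<lambda>n. l (1 / sqrt (real n)) ^ n) \<longlonglongrightarrow> exp (- s / 2)"
      by (simp add: l_def power_divide mult.commute)
  qed
  show ?thesis by (rule Lim_transform[OF main diff])
qed

section \<open>Finite chains: oscillation and the Poisson equation\<close>

definition edges :: "('e \<Rightarrow> ('v \<times> 'e) pmf) \<Rightarrow> ('e \<times> 'e) set" where
  "edges K = {(j, k). \<exists>y. (y, k) \<in> set_pmf (K j)}"

lemma integrable_state_fun:
  fixes f :: "'e::finite \<Rightarrow> real"
  shows "integrable (measure_pmf N) (\<lambda>u. f (snd u))"
proof -
  obtain B where "\<And>k. norm (f k) \<le> B" using finite_bound[of f] by blast
  then show ?thesis by (intro integrable_pmf_bounded)
qed

text \<open>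
  The mean number of visited sites, as a function of the initial state, has this property: the
  first step adds at most one site.
\<close>

definition almost_subharmonic :: "('e \<Rightarrow> ('v \<times> 'e) pmf) \<Rightarrow> ('e \<Rightarrow> real) \<Rightarrow> bool" where
  "almost_subharmonic K g \<longleftrightarrow> (\<forall>i. g i \<le> 1 + \<E> (K i) (\<lambda>u. g (snd u)))"

text \<open>
  If \<open>g\<close> is close to its upper bound \<open>M\<close> at some state, then it is close
  to \<open>M\<close> at every state that can be reached in one step, with a loss governed by the
  transition probability. The claim is propagated along a path.
\<close>

lemma chain_oscillation:
  fixes K :: "'e::finite \<Rightarrow> ('v \<times> 'e) pmf"
  assumes "(j, k) \<in> (edges K)\<^sup>*"
  shows "\<exists>C\<ge>0. \<forall>g M. (\<forall>i. g i \<le> M) \<longrightarrow> almost_subharmonic K g \<longrightarrow> M - g k \<le> C * (1 + (M - g j))"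
  using assms
proof induction
  case base
  show ?case by (rule exI[of _ "1 :: real"]) simp
next
  case (step k l)
  from step.IH obtain C where C0: "C \<ge> 0" and
    C: "\<forall>g M. (\<forall>i. g i \<le> M) \<longrightarrow> almost_subharmonic K g \<longrightarrow> M - g k \<le> C * (1 + (M - g j))"
    by (elim exE conjE)
  define p where "p = measure_pmf.prob (K k) {u. snd u = l}"
  have p: "p > 0"
  proof -
    obtain y where y: "(y, l) \<in> set_pmf (K k)" using step.hyps(2) by (auto simp: edges_def)
    have "0 < pmf (K k) (y, l)" using y by (simp add: pmf_positive_iff)
    also have "\<dots> \<le> p"
      unfolding p_def pmf.rep_eq by (rule measure_pmf.finite_measure_mono) auto
    finally show ?thesis .
  qed
  have "M - g l \<le> (1 + C) / p * (1 + (M - g j))"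
    if M: "\<forall>i. g i \<le> M" and g: "almost_subharmonic K g" for g M
  proof -
    have "\<E> (K k) (\<lambda>u. g (snd u)) \<le>
          \<E> (K k) (\<lambda>u. M - (M - g l) * indicator {u. snd u = l} u)"
    proof (rule integral_mono)
      show "integrable (K k) (\<lambda>u. g (snd u))" by (rule integrable_state_fun)
      show "integrable (K k) (\<lambda>u. M - (M - g l) * indicator {u. snd u = l} u)"
        by (rule integrable_pmf_bounded[where B = "\<bar>M\<bar> + \<bar>g l\<bar>"]) (auto simp: indicator_def)
    qed (use M in \<open>auto simp: indicator_def\<close>)
    also have "\<dots> = M - (M - g l) * p"
    proof -
      have "integrable (K k) (indicator {u. snd u = l} :: _ \<Rightarrow> real)"
        by (rule integrable_pmf_bounded[where B = 1]) (auto simp: indicator_def)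
      then show ?thesis by (simp add: p_def)
    qed
    finally have "g k \<le> 1 + (M - (M - g l) * p)"
      using g[unfolded almost_subharmonic_def, rule_format, of k] by linarith
    moreover have "M - g k \<le> C * (1 + (M - g j))" using C M g by blast
    ultimately have "(M - g l) * p \<le> 1 + C * (1 + (M - g j))" by linarith
    also have "\<dots> \<le> 1 * (1 + (M - g j)) + C * (1 + (M - g j))" using M by simp
    also have "\<dots> = (1 + C) * (1 + (M - g j))" by (simp add: algebra_simps)
    finally show ?thesis using p by (simp add: pos_le_divide_eq)
  qed
  then show ?case using p C0 by (intro exI[of _ "(1 + C) / p"]) simp
qed

lemma oscillation_bound:
  fixes K :: "'e::finite \<Rightarrow> ('v \<times> 'e) pmf"
  assumes irr: "\<And>j k. (j, k) \<in> (edges K)\<^sup>*"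
  shows "\<exists>C\<ge>0. \<forall>g j k. almost_subharmonic K g \<longrightarrow> \<bar>g j - g k\<bar> \<le> C"
proof -
  have "\<forall>j k. \<exists>C\<ge>0. \<forall>g M. (\<forall>i. g i \<le> M) \<longrightarrow> almost_subharmonic K g \<longrightarrow> M - g k \<le> C * (1 + (M - g j))"
    by (intro allI chain_oscillation irr)
  then obtain C where C: "\<forall>j k. C j k \<ge> 0 \<and> (\<forall>g M. (\<forall>i. g i \<le> M) \<longrightarrow> almost_subharmonic K g
      \<longrightarrow> M - g k \<le> C j k * (1 + (M - g j)))"
    unfolding choice_iff by (elim exE)
  define D where "D = (\<Sum>u\<in>UNIV. C (fst u) (snd u))"
  have D: "C j k \<le> D" for j k
    unfolding D_def using member_le_sum[of "(j, k)" UNIV "\<lambda>u. C (fst u) (snd u)"] C by simp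
  have one: "g j - g k \<le> D" if g: "almost_subharmonic K g" for g j k
  proof -
    define M where "M = Max (range g)"
    have M: "\<forall>i. g i \<le> M" by (simp add: M_def)
    have "M \<in> range g" unfolding M_def by (rule Max_in) auto
    then obtain i where i: "g i = M" by auto
    have "M - g k \<le> C i k * (1 + (M - g i))"
      using C M g by blast
    then show ?thesis using M[rule_format, of j] D[of i k] i by simp
  qed
  have "0 \<le> D" unfolding D_def by (rule sum_nonneg) (use C in auto)
  moreover have "\<bar>g j - g k\<bar> \<le> D" if "almost_subharmonic K g" for g j k
    using one[OF that, of j k] one[OF that, of k j] by linarith
  ultimately show ?thesis by blast
qed

text \<open>
  All positive multiples of a harmonic function are almost subharmonic, so they have bounded
  oscillation by the same constant.
\<close>

lemma harmonic_constant:
  fixes K :: "'e::finite \<Rightarrow> ('v \<times> 'e) pmf"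
  assumes irr: "\<And>j k. (j, k) \<in> (edges K)\<^sup>*"
    and g: "\<And>i. g i = \<E> (K i) (\<lambda>u. g (snd u))"
  shows "g j = (g k :: real)"
proof (rule ccontr)
  assume ne: "g j \<noteq> g k"
  obtain C where C: "0 \<le> C" "\<forall>g j k. almost_subharmonic K g \<longrightarrow> \<bar>g j - g k\<bar> \<le> C"
    using oscillation_bound[OF irr] by (elim exE conjE)
  \<comment> \<open>scaled such that the oscillation would be \<open>C + 1\<close>\<close>
  define c where "c = (C + 1) / \<bar>g j - g k\<bar>"
  have "c * g i = \<E> (K i) (\<lambda>u. c * g (snd u))" for i
    unfolding integral_mult_right_zero g[symmetric] ..
  then have "almost_subharmonic K (\<lambda>i. c * g i)"
    unfolding almost_subharmonic_def by (metis add.commute le_add_same_cancel1 zero_le_one)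
  from C(2)[rule_format, OF this, of j k] have "\<bar>c * g j - c * g k\<bar> \<le> C" .
  moreover have "\<bar>c * g j - c * g k\<bar> = C + 1"
  proof -
    have "\<bar>c * g j - c * g k\<bar> = \<bar>c\<bar> * \<bar>g j - g k\<bar>" by (simp only: right_diff_distrib[symmetric] abs_mult)
    then show ?thesis using ne C(1) by (simp add: c_def)
  qed
  ultimately show False by simp
qed

text \<open>
  The operator \<open>v - K v\<close> has the constants as its kernel and is therefore singular.
  Adding the mean of \<open>v\<close> makes it injective, hence surjective in finite dimension, and
  for right-hand sides of mean zero the added term vanishes.
\<close>

lemma poisson_equation:
  fixes K :: "'e::finite \<Rightarrow> ('v \<times> 'e) pmf" and m :: "'e \<Rightarrow> real"
  assumes irr: "\<And>j k. (j, k) \<in> (edges K)\<^sup>*"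
    and m: "(\<Sum>j\<in>UNIV. m j) = 1"
    and stat: "\<And>g :: 'e \<Rightarrow> real. (\<Sum>j\<in>UNIV. m j * \<E> (K j) (\<lambda>u. g (snd u))) = (\<Sum>j\<in>UNIV. m j * g j)"
    and f: "(\<Sum>j\<in>UNIV. m j * f j) = 0"
  obtains v where "\<And>j. v j - \<E> (K j) (\<lambda>u. v (snd u)) = f j"
proof -
  define A where "A j v = \<E> (K j) (\<lambda>u. v $ snd u)" for j and v :: "real ^ 'e"
  define c where "c v = (\<Sum>j\<in>UNIV. m j * v $ j)" for v :: "real ^ 'e"
  \<comment> \<open>\<open>c v\<close> is the mean of \<open>v\<close> under \<open>m\<close>\<close>
  define L where "L v = (\<chi> j. v $ j - A j v + c v)" for v :: "real ^ 'e"
  have Aadd: "A j (v + w) = A j v + A j w" for j v w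
    unfolding A_def using integrable_state_fun[of "K j" "\<lambda>k. v $ k"] integrable_state_fun[of "K j" "\<lambda>k. w $ k"] by simp
  have Asc: "A j (r *\<^sub>R v) = r * A j v" for j r v
    unfolding A_def by simp
  have c: "c (v + w) = c v + c w" "c (r *\<^sub>R v) = r * c v" for v w r
    by (simp_all add: c_def algebra_simps sum.distrib sum_distrib_left)
  have lin: "linear L"
    by (rule linearI) (auto simp: L_def vec_eq_iff Aadd Asc c algebra_simps)
  have cL: "(\<Sum>j\<in>UNIV. m j * L v $ j) = c v" for v
  proof -
    have "(\<Sum>j\<in>UNIV. m j * L v $ j) = (\<Sum>j\<in>UNIV. m j * v $ j) - (\<Sum>j\<in>UNIV. m j * A j v) + (\<Sum>j\<in>UNIV. m j) * c v"
      by (simp add: L_def algebra_simps sum.distrib sum_subtractf sum_distrib_left)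
    then show ?thesis using stat[of "\<lambda>k. v $ k"] m by (simp add: A_def)
  qed
  have "inj L"
    unfolding linear_injective_0[OF lin]
  proof (intro allI impI)
    fix v assume Lv: "L v = 0"
    have cv: "c v = 0" using cL[of v] Lv by simp
    have h: "v $ i = \<E> (K i) (\<lambda>u. v $ snd u)" for i
    proof -
      have "L v $ i = 0" using Lv by simp
      then show ?thesis using cv by (simp add: L_def A_def)
    qed
    have const: "v $ i = v $ j" for i j by (rule harmonic_constant[OF irr h])
    have "c v = (\<Sum>j\<in>UNIV. m j * v $ i)" for i
      unfolding c_def by (intro sum.cong refl) (metis const)
    then have "v $ i = 0" for i using cv m by (simp flip: sum_distrib_right)
    then show "v = 0" by (simp add: vec_eq_iff)
  qed
  then have "surj L" by (rule linear_injective_imp_surjective[OF lin]) (rule refl)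
  then obtain v where v: "L v = (\<chi> j. f j)" by (metis surjD)
  have "c v = 0" using cL[of v] f by (simp add: v)
  have "v $ j - \<E> (K j) (\<lambda>u. v $ snd u) = f j" for j
  proof -
    have "L v $ j = f j" using v by simp
    then show ?thesis using \<open>c v = 0\<close> by (simp add: L_def A_def)
  qed
  then show ?thesis by (rule that)
qed

text \<open>
  The law of one step of the chain with initial law \<open>\<mu>\<close>: state before,
  displacement, state after.
\<close>

definition joint :: "('e \<Rightarrow> ('v \<times> 'e) pmf) \<Rightarrow> 'e pmf \<Rightarrow> ('e \<times> 'v \<times> 'e) pmf" where
  "joint K \<mu> = bind_pmf \<mu> (\<lambda>j. map_pmf (\<lambda>(y, k). (j, y, k)) (K j))"

lemma nn_integral_joint:
  "(\<integral>\<^sup>+ v. F v \<partial>joint K \<mu>) = (\<Sum>j\<in>UNIV. ennreal (pmf \<mu> j) * (\<integral>\<^sup>+ u. F (j, u) \<partial>K j))"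
  for \<mu> :: "'e::finite pmf"
  by (simp add: joint_def case_prod_unfold nn_integral_measure_pmf[of \<mu>] nn_integral_count_space_finite)

lemma integrable_joint_iff:
  fixes F :: "'e::finite \<times> 'v \<times> 'e \<Rightarrow> real"
  assumes "\<And>j. pmf \<mu> j > 0"
  shows "integrable (joint K \<mu>) F \<longleftrightarrow> (\<forall>j. integrable (K j) (\<lambda>u. F (j, u)))"
proof -
  have "ennreal (pmf \<mu> j) * x < \<top> \<longleftrightarrow> x < \<top>" for j x
    using assms[of j] by (auto simp: ennreal_mult_less_top)
  then have "(\<integral>\<^sup>+ v. norm (F v) \<partial>joint K \<mu>) < \<top> \<longleftrightarrow> (\<forall>j. (\<integral>\<^sup>+ u. norm (F (j, u)) \<partial>K j) < \<top>)"
    unfolding nn_integral_joint by (simp add: ennreal_sum_less_top)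
  then show ?thesis
    by (simp add: integrable_iff_bounded)
qed

lemma expectation_joint:
  fixes F :: "'e::finite \<times> 'v \<times> 'e \<Rightarrow> real"
  assumes pos: "\<And>j. pmf \<mu> j > 0" and int: "integrable (joint K \<mu>) F"
  shows "\<E> (joint K \<mu>) F =
     (\<Sum>j\<in>UNIV. pmf \<mu> j * \<E> (K j) (\<lambda>u. F (j, u)))"
proof -
  have nonneg: "\<E> (joint K \<mu>) G =
     (\<Sum>j\<in>UNIV. pmf \<mu> j * \<E> (K j) (\<lambda>u. G (j, u)))"
    if G: "integrable (joint K \<mu>) G" "\<And>v. 0 \<le> G v" for G
  proof -
    have i: "integrable (K j) (\<lambda>u. G (j, u))" for j
      using G(1) unfolding integrable_joint_iff[OF pos] by simp
    have "ennreal (\<E> (joint K \<mu>) G) = (\<integral>\<^sup>+ v. G v \<partial>joint K \<mu>)"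
      using G by (intro nn_integral_eq_integral[symmetric]) auto
    also have "\<dots> = (\<Sum>j\<in>UNIV. ennreal (pmf \<mu> j) * (\<integral>\<^sup>+ u. G (j, u) \<partial>K j))"
      by (rule nn_integral_joint)
    also have "\<dots> = (\<Sum>j\<in>UNIV. ennreal (pmf \<mu> j * \<E> (K j) (\<lambda>u. G (j, u))))"
      by (intro sum.cong refl, subst nn_integral_eq_integral[OF i])
         (use G(2) in \<open>auto simp: ennreal_mult'\<close>)
    also have "\<dots> = ennreal (\<Sum>j\<in>UNIV. pmf \<mu> j * \<E> (K j) (\<lambda>u. G (j, u)))"
      using G(2) by (intro sum_ennreal mult_nonneg_nonneg Bochner_Integration.integral_nonneg) auto
    finally show ?thesis
      using G(2) by (subst (asm) ennreal_inj)
        (auto intro!: sum_nonneg mult_nonneg_nonneg Bochner_Integration.integral_nonneg)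
  qed
  let ?p = "\<lambda>v. max 0 (F v)" and ?n = "\<lambda>v. max 0 (- F v)"
  have ip: "integrable (joint K \<mu>) ?p" "integrable (joint K \<mu>) ?n"
    using int by auto
  have ipj: "integrable (K j) (\<lambda>u. ?p (j, u))" "integrable (K j) (\<lambda>u. ?n (j, u))" for j
    using ip unfolding integrable_joint_iff[OF pos] by simp_all
  have F: "F v = ?p v - ?n v" for v by (auto simp: max_def)
  have "\<E> (joint K \<mu>) F = \<E> (joint K \<mu>) ?p - \<E> (joint K \<mu>) ?n"
    by (subst Bochner_Integration.integral_diff[OF ip, symmetric]) (simp only: F[symmetric])
  also have "\<dots> = (\<Sum>j\<in>UNIV. pmf \<mu> j * (\<E> (K j) (\<lambda>u. ?p (j, u)) - \<E> (K j) (\<lambda>u. ?n (j, u))))"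
    by (subst nonneg[OF ip(1)], simp, subst nonneg[OF ip(2)], simp) (simp add: right_diff_distrib sum_subtractf)
  also have "\<dots> = (\<Sum>j\<in>UNIV. pmf \<mu> j * \<E> (K j) (\<lambda>u. F (j, u)))"
    by (subst Bochner_Integration.integral_diff[OF ipj, symmetric]) (simp only: F[symmetric])
  finally show ?thesis .
qed

section \<open>A walk and its time reversal\<close>

text \<open>
  A kernel together with its time reversal with respect to a stationary law \<open>\<mu>\<close>.
  Duality says that a step read backwards in time is a step of the other kernel; it implies that
  \<open>\<mu>\<close> is stationary for both. The assumptions are symmetric in the two kernels, so
  each result holds for the reversed walk as well.
\<close>

locale dual_walks =
  fixes K K' :: "'e::finite \<Rightarrow> ((int ^ 2) \<times> 'e) pmf" and \<mu> :: "'e pmf"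
  assumes pos: "0 < pmf \<mu> j"
    and dual: "joint K' \<mu> = map_pmf (\<lambda>(j, y, k). (k, - y, j)) (joint K \<mu>)"
    and irreducible: "(j, k) \<in> (edges K)\<^sup>*"
    and fourth_moment: "integrable (joint K \<mu>) (\<lambda>(j, y, k). real_of_int (y $ l) ^ 4)"
    and zero_mean: "\<E> (joint K \<mu>) (\<lambda>(j, y, k). real_of_int (y $ l)) = 0"
    and decay: "\<exists>C c. fourier_decay K C c"

lemma complex_expectation_joint:
  fixes F :: "'e::finite \<times> 'v \<times> 'e \<Rightarrow> complex"
  assumes "\<And>v. cmod (F v) \<le> B"
  shows "\<E> (joint K \<mu>) F =
     (\<Sum>j\<in>UNIV. of_real (pmf \<mu> j) * \<E> (K j) (\<lambda>u. F (j, u)))"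
  unfolding joint_def
  by (subst expectation_bind_bounded[where B = B, OF assms], subst integral_measure_pmf[of UNIV])
     (auto simp: scaleR_conv_of_real case_prod_unfold)

context dual_walks
begin

lemma dual': "joint K \<mu> = map_pmf (\<lambda>(j, y, k). (k, - y, j)) (joint K' \<mu>)"
  unfolding dual by (simp add: map_pmf_comp case_prod_unfold)

text \<open>
  With respect to \<open>\<mu>\<close>, the reversed kernel gives the transposed operator at the
  opposite frequency.
\<close>

lemma char_op_dual:
  fixes f g :: "'e \<Rightarrow> complex"
  shows "(\<Sum>j\<in>UNIV. pmf \<mu> j * (g j * char_op K t f j)) = (\<Sum>j\<in>UNIV. pmf \<mu> j * (f j * char_op K' (- t) g j))"
proof -
  obtain Bf where Bf: "\<And>k. cmod (f k) \<le> Bf" using finite_bound[of f] by blast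
  obtain Bg where Bg: "\<And>k. cmod (g k) \<le> Bg" using finite_bound[of g] by blast
  let ?F = "\<lambda>v. g (fst v) * (cis (dot t (fst (snd v))) * f (snd (snd v)))"
  let ?G = "\<lambda>v. f (fst v) * (cis (dot (- t) (fst (snd v))) * g (snd (snd v)))"
  have prod: "cmod (a * (cis r * b)) \<le> A * B" if "cmod a \<le> A" "cmod b \<le> B" for a b r A B
    unfolding norm_mult norm_cis mult_1 using that by (intro mult_mono) (auto intro: order_trans[OF norm_ge_zero])
  have "(\<Sum>j\<in>UNIV. pmf \<mu> j * (g j * char_op K t f j)) = \<E> (joint K \<mu>) ?F"
    by (subst complex_expectation_joint[where B = "Bg * Bf"])
       (use prod Bf Bg in \<open>auto simp: char_op_def case_prod_unfold\<close>)
  also have "\<dots> = \<E> (joint K' \<mu>) ?G"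
    unfolding dual by (simp add: case_prod_unfold dot_minus mult_ac)
  also have "\<dots> = (\<Sum>j\<in>UNIV. pmf \<mu> j * (f j * char_op K' (- t) g j))"
    by (subst complex_expectation_joint[where B = "Bf * Bg"])
       (use prod Bf Bg in \<open>auto simp: char_op_def case_prod_unfold\<close>)
  finally show ?thesis .
qed

lemma char_op_pow_dual:
  fixes f g :: "'e \<Rightarrow> complex"
  shows "(\<Sum>j\<in>UNIV. pmf \<mu> j * (g j * (char_op K t ^^ n) f j)) =
         (\<Sum>j\<in>UNIV. pmf \<mu> j * (f j * (char_op K' (- t) ^^ n) g j))"
proof (induction n arbitrary: g)
  case 0
  show ?case by (simp add: mult.commute)
next
  case (Suc n)
  have "(\<Sum>j\<in>UNIV. pmf \<mu> j * (g j * (char_op K t ^^ Suc n) f j))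
      = (\<Sum>j\<in>UNIV. pmf \<mu> j * (char_op K' (- t) g j * (char_op K t ^^ n) f j))"
    unfolding funpow.simps comp_apply char_op_dual by (simp add: mult.commute)
  also have "\<dots> = (\<Sum>j\<in>UNIV. pmf \<mu> j * (f j * (char_op K' (- t) ^^ n) (char_op K' (- t) g) j))"
    by (rule Suc.IH)
  finally show ?case by (simp add: funpow_swap1)
qed

text \<open>
  The values of the powers for \<open>K'\<close> are matrix entries of the powers for
  \<open>K\<close>, obtained by testing against point masses.
\<close>

lemma dual_decay: "\<exists>C c. fourier_decay K' C c"
proof -
  obtain C c where Cc: "fourier_decay K C c" using decay by blast
  define D where "D = (\<Sum>j\<in>UNIV. \<bar>C\<bar> / pmf \<mu> j)"
  have D: "\<bar>C\<bar> / pmf \<mu> j \<le> D" for j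
    unfolding D_def by (rule member_le_sum) (use pos in auto)
  have "fourier_decay K' D c"
    unfolding fourier_decay_def
  proof (intro conjI allI impI)
    show "0 < c" using Cc by (simp add: fourier_decay_def)
    fix n t j and f :: "'e \<Rightarrow> complex"
    assume t: "\<bar>fst t\<bar> \<le> pi" "\<bar>snd t\<bar> \<le> pi" and f: "\<forall>k. cmod (f k) \<le> 1"
    let ?d = "\<lambda>k :: 'e. if k = j then 1 else 0 :: complex"
    let ?E = "exp (- c * real n * ((fst t)\<^sup>2 + (snd t)\<^sup>2))"
    have "cmod ((char_op K (- t) ^^ n) ?d k) \<le> C * ?E" for k
      using fourier_decayD[OF Cc, of "- t" ?d n k] t by simp
    then have b: "cmod ((char_op K (- t) ^^ n) ?d k) \<le> \<bar>C\<bar> * ?E" for k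
      by (rule order_trans) (intro mult_right_mono; simp)
    have "of_real (pmf \<mu> j) * (char_op K' t ^^ n) f j
        = (\<Sum>k\<in>UNIV. of_real (pmf \<mu> k) * (?d k * (char_op K' t ^^ n) f k))"
      by (subst sum.remove[of _ j]) auto
    also have "\<dots> = (\<Sum>k\<in>UNIV. pmf \<mu> k * (f k * (char_op K (- t) ^^ n) ?d k))"
      using char_op_pow_dual[where f = ?d and g = f and t = "- t" and n = n] by simp
    also have "cmod \<dots> \<le> (\<Sum>k\<in>UNIV. pmf \<mu> k * (1 * (\<bar>C\<bar> * ?E)))"
    proof (rule sum_norm_le)
      fix k
      have "cmod (f k * (char_op K (- t) ^^ n) ?d k) \<le> 1 * (\<bar>C\<bar> * ?E)"
        unfolding norm_mult by (rule mult_mono) (use f b in auto)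
      then show "cmod (of_real (pmf \<mu> k) * (f k * (char_op K (- t) ^^ n) ?d k)) \<le> pmf \<mu> k * (1 * (\<bar>C\<bar> * ?E))"
        unfolding norm_mult[of "of_real (pmf \<mu> k)"] norm_of_real abs_of_nonneg[OF pmf_nonneg]
        by (rule mult_left_mono) simp
    qed
    also have "\<dots> = \<bar>C\<bar> * ?E"
      by (simp add: sum_pmf_eq_1 flip: sum_distrib_right)
    finally have "pmf \<mu> j * cmod ((char_op K' t ^^ n) f j) \<le> \<bar>C\<bar> * ?E"
      by (simp add: norm_mult)
    then have "cmod ((char_op K' t ^^ n) f j) \<le> \<bar>C\<bar> / pmf \<mu> j * ?E"
      using pos[of j] by (simp add: pos_le_divide_eq mult.commute)
    also have "\<dots> \<le> D * ?E" using D by (intro mult_right_mono) auto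
    finally show "cmod ((char_op K' t ^^ n) f j) \<le> D * ?E" .
  qed
  then show ?thesis by blast
qed

lemma edges_joint: "(j, k) \<in> edges K \<longleftrightarrow> (\<exists>y. (j, y, k) \<in> set_pmf (joint K \<mu>))"
proof -
  have "j \<in> set_pmf \<mu>" for j using pos[of j] by (simp add: pmf_positive_iff)
  then show ?thesis by (force simp: edges_def joint_def)
qed

lemma edges_dual: "edges K' = (edges K)\<inverse>"
proof -
  have "j \<in> set_pmf \<mu>" for j using pos[of j] by (simp add: pmf_positive_iff)
  then have "(j, k) \<in> edges K' \<longleftrightarrow> (\<exists>y. (j, y, k) \<in> set_pmf (joint K' \<mu>))" for j k
    by (force simp: edges_def joint_def)
  moreover have "(\<exists>y. (j, y, k) \<in> set_pmf (joint K' \<mu>)) \<longleftrightarrow> (\<exists>y. (k, y, j) \<in> set_pmf (joint K \<mu>))" for j k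
  proof -
    have "(j, y, k) \<in> set_pmf (joint K' \<mu>) \<longleftrightarrow> (k, - y, j) \<in> set_pmf (joint K \<mu>)" for y
      unfolding dual by (force simp: image_iff)
    then show ?thesis by (metis minus_minus)
  qed
  ultimately show ?thesis by (auto simp: edges_joint)
qed

end

sublocale dual_walks \<subseteq> rev: dual_walks K' K \<mu>
proof
  show "0 < pmf \<mu> j" for j by (rule pos)
  show "joint K \<mu> = map_pmf (\<lambda>(j, y, k). (k, - y, j)) (joint K' \<mu>)" by (rule dual')
  show "(j, k) \<in> (edges K')\<^sup>*" for j k
    using irreducible[of k j] by (simp add: edges_dual rtrancl_converse)
  show "integrable (joint K' \<mu>) (\<lambda>(j, y, k). real_of_int (y $ l) ^ 4)" for l
    using fourth_moment[of l] by (simp add: dual case_prod_unfold)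
  show "\<E> (joint K' \<mu>) (\<lambda>(j, y, k). real_of_int (y $ l)) = 0" for l
    using zero_mean[of l] by (simp add: dual case_prod_unfold)
  show "\<exists>C c. fourier_decay K' C c" by (rule dual_decay)
qed

section \<open>The local lower bound at the origin\<close>

context dual_walks
begin

text \<open>
  The state after a step of \<open>K\<close> is the state before a step of \<open>K'\<close>.
\<close>

lemma stationary:
  fixes g :: "'e \<Rightarrow> real"
  shows "(\<Sum>j\<in>UNIV. pmf \<mu> j * \<E> (K j) (\<lambda>u. g (snd u))) = (\<Sum>j\<in>UNIV. pmf \<mu> j * g j)"
proof -
  obtain B where B: "\<And>k. norm (g k) \<le> B" using finite_bound[of g] by blast
  have i: "integrable (joint L \<mu>) (\<lambda>v. g (snd (snd v)))" "integrable (joint L \<mu>) (\<lambda>v. g (fst v))"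
    for L :: "'e \<Rightarrow> ((int ^ 2) \<times> 'e) pmf"
    by (rule integrable_pmf_bounded, rule B)+
  have "(\<Sum>j\<in>UNIV. pmf \<mu> j * \<E> (K j) (\<lambda>u. g (snd u)))
      = \<E> (joint K \<mu>) (\<lambda>v. g (snd (snd v)))"
    by (subst expectation_joint[OF pos i(1)]) simp
  also have "\<dots> = \<E> (joint K' \<mu>) (\<lambda>v. g (fst v))"
    by (simp add: dual case_prod_unfold)
  also have "\<dots> = (\<Sum>j\<in>UNIV. pmf \<mu> j * g j)"
    by (subst expectation_joint[OF pos i(2)]) simp
  finally show ?thesis .
qed

lemma integrable_dot_cubed: "integrable (K j) (\<lambda>v. \<bar>dot \<tau> (fst v)\<bar> ^ 3)"
proof -
  have m: "integrable (K j) (\<lambda>v. real_of_int (fst v $ l) ^ 4)" for l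
    using fourth_moment[of l] unfolding integrable_joint_iff[OF pos] by (simp add: case_prod_unfold)
  have i: "integrable (K j) (\<lambda>v. 1 + 8 * ((fst \<tau>) ^ 4 * real_of_int (fst v $ 1) ^ 4 + (snd \<tau>) ^ 4 * real_of_int (fst v $ 2) ^ 4))"
    by (intro Bochner_Integration.integrable_add integrable_mult_right m) simp
  have b: "\<bar>a + b\<bar> ^ 3 \<le> 1 + 8 * (a ^ 4 + b ^ 4)" for a b :: real
  proof -
    have "\<bar>a + b\<bar> ^ 3 \<le> 1 + (a + b) ^ 4"
      using power_le_one_plus_power[of 3 4 "a + b"] by simp
    also have "(a + b) ^ 4 \<le> 8 * (a ^ 4 + b ^ 4)"
    proof -
      have sq: "(x + y)\<^sup>2 \<le> 2 * (x\<^sup>2 + y\<^sup>2)" for x y :: real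
        using sum_squares_bound[of x y] by (simp add: power2_sum)
      have "(a + b) ^ 4 = ((a + b)\<^sup>2)\<^sup>2" by simp
      also have "\<dots> \<le> (2 * (a\<^sup>2 + b\<^sup>2))\<^sup>2" by (intro power_mono sq) simp
      also have "\<dots> = 4 * (a\<^sup>2 + b\<^sup>2)\<^sup>2"
        unfolding power_mult_distrib[of 2] by simp
      also have "\<dots> \<le> 4 * (2 * ((a\<^sup>2)\<^sup>2 + (b\<^sup>2)\<^sup>2))" by (intro mult_left_mono sq) simp
      finally show ?thesis by simp
    qed
    finally show ?thesis by simp
  qed
  show ?thesis
  proof (rule Bochner_Integration.integrable_bound[OF i])
    show "AE v in K j. norm (\<bar>dot \<tau> (fst v)\<bar> ^ 3) \<le>
        norm (1 + 8 * ((fst \<tau>) ^ 4 * real_of_int (fst v $ 1) ^ 4 + (snd \<tau>) ^ 4 * real_of_int (fst v $ 2) ^ 4))"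
    proof (rule AE_I2)
      fix v
      have "norm (\<bar>dot \<tau> (fst v)\<bar> ^ 3) \<le> 1 + 8 * ((fst \<tau>) ^ 4 * real_of_int (fst v $ 1) ^ 4 + (snd \<tau>) ^ 4 * real_of_int (fst v $ 2) ^ 4)"
        using b[of "fst \<tau> * real_of_int (fst v $ 1)" "snd \<tau> * real_of_int (fst v $ 2)"]
        by (simp add: dot_def power_mult_distrib)
      then show "norm (\<bar>dot \<tau> (fst v)\<bar> ^ 3) \<le>
        norm (1 + 8 * ((fst \<tau>) ^ 4 * real_of_int (fst v $ 1) ^ 4 + (snd \<tau>) ^ 4 * real_of_int (fst v $ 2) ^ 4))"
        unfolding real_norm_def by (rule order_trans[OF _ abs_ge_self])
    qed
  qed simp
qed

lemma integrable_dot: "integrable (K j) (\<lambda>v. dot \<tau> (fst v))"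
  and integrable_dot_sq: "integrable (K j) (\<lambda>v. (dot \<tau> (fst v))\<^sup>2)"
proof -
  have i: "integrable (K j) (\<lambda>v. 1 + \<bar>dot \<tau> (fst v)\<bar> ^ 3)"
    by (intro Bochner_Integration.integrable_add integrable_dot_cubed) simp
  have x: "\<bar>x\<bar> \<le> \<bar>1 + \<bar>x\<bar> ^ 3\<bar> \<and> x\<^sup>2 \<le> \<bar>1 + \<bar>x\<bar> ^ 3\<bar>" for x :: real
    using power_le_one_plus_power[of 1 3 x] power_le_one_plus_power[of 2 3 x] by simp
  show "integrable (K j) (\<lambda>v. dot \<tau> (fst v))"
    by (rule Bochner_Integration.integrable_bound[OF i]) (use x in auto)
  show "integrable (K j) (\<lambda>v. (dot \<tau> (fst v))\<^sup>2)"
    by (rule Bochner_Integration.integrable_bound[OF i]) (use x in auto)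
qed

lemma mean_dot: "(\<Sum>j\<in>UNIV. pmf \<mu> j * \<E> (K j) (\<lambda>v. dot \<tau> (fst v))) = 0"
proof -
  have i: "integrable (joint K \<mu>) (\<lambda>(j, y, k). real_of_int (y $ l))" for l
    using integrable_dot[of _ "(of_bool (l = 1), of_bool (l = 2))"] exhaust_2[of l]
    unfolding integrable_joint_iff[OF pos] by (auto simp: dot_def case_prod_unfold)
  have "(\<Sum>j\<in>UNIV. pmf \<mu> j * \<E> (K j) (\<lambda>v. dot \<tau> (fst v)))
     = \<E> (joint K \<mu>) (\<lambda>v. dot \<tau> (fst (snd v)))"
    by (subst expectation_joint[OF pos]) (use integrable_dot in \<open>auto simp: integrable_joint_iff[OF pos]\<close>)
  also have "\<dots> = fst \<tau> * \<E> (joint K \<mu>) (\<lambda>(j, y, k). real_of_int (y $ 1))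
     + snd \<tau> * \<E> (joint K \<mu>) (\<lambda>(j, y, k). real_of_int (y $ 2))"
    using i[of 1] i[of 2] by (simp add: dot_def case_prod_unfold)
  also have "\<dots> = 0" by (simp add: zero_mean)
  finally show ?thesis .
qed

text \<open>
  The Poisson equation is solved twice: for \<open>u\<close> its right-hand side has mean zero
  because the walk has zero mean, and for \<open>q\<close> the number \<open>s\<close> is chosen to
  achieve this.
\<close>

lemma gaussian_limit:
  "\<exists>s. \<forall>j. (\<lambda>n. (char_op K ((1 / sqrt (real n)) *\<^sub>R \<tau>) ^^ n) (\<lambda>_. 1) j) \<longlonglongrightarrow> of_real (exp (- s / 2))"
proof -
  let ?X = "\<lambda>v :: (int ^ 2) \<times> 'e. dot \<tau> (fst v)"
  have m1: "(\<Sum>j\<in>UNIV. pmf \<mu> j) = 1" by (simp add: sum_pmf_eq_1)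
  obtain u where u: "\<And>j. u j - \<E> (K j) (\<lambda>v. u (snd v)) = \<E> (K j) ?X"
    using poisson_equation[OF irreducible m1 stationary mean_dot[of \<tau>]] by blast
  obtain B where B: "\<And>k. norm (u k) \<le> B" using finite_bound[of u] by blast
  have ixu: "integrable (K j) (\<lambda>v. ?X v * u (snd v))" for j
  proof (rule Bochner_Integration.integrable_bound[OF integrable_mult_right[OF integrable_dot]])
    show "AE v in K j. norm (?X v * u (snd v)) \<le> norm (B * ?X v)"
      unfolding norm_mult using B by (intro AE_I2) (simp add: mult.commute mult_right_mono order_trans[OF _ abs_ge_self])
  qed simp
  define r where "r j = \<E> (K j) (\<lambda>v. ?X v * u (snd v) + (?X v)\<^sup>2 / 2)" for j
  define s where "s = 2 * (\<Sum>j\<in>UNIV. pmf \<mu> j * r j)"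
  have z: "(\<Sum>j\<in>UNIV. pmf \<mu> j * (s / 2 - r j)) = 0"
    using m1 by (simp add: right_diff_distrib sum_subtractf s_def flip: sum_distrib_right)
  obtain q where q: "\<And>j. q j - \<E> (K j) (\<lambda>v. q (snd v)) = s / 2 - r j"
    using poisson_equation[OF irreducible m1 stationary z] by blast
  have "(\<lambda>n. (char_op K ((1 / sqrt (real n)) *\<^sub>R \<tau>) ^^ n) (\<lambda>_. 1) j) \<longlonglongrightarrow> of_real (exp (- s / 2))" for j
  proof (rule char_op_limit)
    show "integrable (K j) (\<lambda>v. \<bar>?X v\<bar> ^ 3)" for j by (rule integrable_dot_cubed)
    show "u j = \<E> (K j) (\<lambda>v. ?X v + u (snd v))" for j
      using u[of j] integrable_dot[of j \<tau>] integrable_state_fun[of "K j" u] by simp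
    show "q j - s / 2 = \<E> (K j) (\<lambda>v. q (snd v) - ?X v * u (snd v) - (?X v)\<^sup>2 / 2)" for j
      using q[of j] integrable_dot_sq[of j \<tau>] integrable_state_fun[of "K j" q] ixu[of j] by (simp add: r_def)
  qed
  then show ?thesis by blast
qed

text \<open>
  By dominated convergence, \<open>4 pi\<^sup>2 n\<close> times the probability of return tends to
  the integral of a positive function. The limiting variance \<open>s\<close> may depend on
  \<open>\<tau>\<close> in any way, as only positivity of \<open>exp (- s / 2)\<close> matters.
\<close>

lemma occ_lower: "\<exists>c>0. \<exists>N. \<forall>n\<ge>N. \<forall>j. c / real (Suc n) \<le> occ K (Suc n) j 0"
proof -
  obtain C c where Cc: "fourier_decay K C c" using decay by blast
  have c: "c > 0" using Cc by (simp add: fourier_decay_def)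
  obtain S where S: "\<forall>\<tau> j. (\<lambda>n. (char_op K ((1 / sqrt (real n)) *\<^sub>R \<tau>) ^^ n) (\<lambda>_. 1) j) \<longlonglongrightarrow> of_real (exp (- S \<tau> / 2))"
  proof -
    have "\<forall>\<tau>. \<exists>s. \<forall>j. (\<lambda>n. (char_op K ((1 / sqrt (real n)) *\<^sub>R \<tau>) ^^ n) (\<lambda>_. 1) j) \<longlonglongrightarrow> of_real (exp (- s / 2))"
      by (rule allI, rule gaussian_limit)
    from choice[OF this] that show ?thesis by blast
  qed
  let ?g = "\<lambda>\<tau>. exp (- S \<tau> / 2)"
  let ?w = "\<lambda>\<tau> :: real \<times> real. C * exp (- c * ((fst \<tau>)\<^sup>2 + (snd \<tau>)\<^sup>2))"
  have iw: "integrable lborel ?w" by (intro integrable_mult_right integrable_gaussian c)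
  \<comment> \<open>the index is shifted because the bound fails for \<open>n = 0\<close>, where the
    scaling factor \<open>1 / sqrt n\<close> is 0\<close>
  have lim: "(\<lambda>n. scaled_char K (Suc n) j 0 \<tau>) \<longlonglongrightarrow> of_real (?g \<tau>)" for \<tau> j
  proof (rule LIMSEQ_Suc, rule Lim_transform_eventually[OF S[rule_format]])
    have "(\<lambda>n. a / sqrt (real n)) \<longlonglongrightarrow> 0" for a :: real by real_asymp
    from order_tendstoD[OF this] have "\<forall>\<^sub>F n in sequentially. - pi < a / sqrt (real n) \<and> a / sqrt (real n) < pi" for a
      by (intro eventually_conj) (use pi_gt_zero in auto)
    from this[of "fst \<tau>"] this[of "snd \<tau>"]
    have "\<forall>\<^sub>F n in sequentially. (1 / sqrt (real n)) *\<^sub>R \<tau> \<in> torus"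
      by eventually_elim (auto simp: torus_def mem_Times_iff)
    then show "\<forall>\<^sub>F n in sequentially. (char_op K ((1 / sqrt (real n)) *\<^sub>R \<tau>) ^^ n) (\<lambda>_. 1) j = scaled_char K n j 0 \<tau>"
      by eventually_elim (simp add: scaled_char_def Let_def dot_0)
  qed
  have gm: "(\<lambda>\<tau>. complex_of_real (?g \<tau>)) \<in> borel_measurable lborel"
  proof (rule borel_measurable_LIMSEQ_metric)
    fix j :: 'e
    show "(\<lambda>n. scaled_char K (Suc n) j 0 \<tau>) \<longlonglongrightarrow> of_real (?g \<tau>)" for \<tau> by (rule lim[of j \<tau>])
    show "scaled_char K (Suc n) j 0 \<in> borel_measurable lborel" for n by measurable
  qed
  have bnd: "norm (scaled_char K (Suc n) j 0 \<tau>) \<le> ?w \<tau>" for n j \<tau>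
    by (rule scaled_char_bound[OF Cc]) simp
  have DC: "(\<lambda>n. integral\<^sup>L lborel (scaled_char K (Suc n) j 0)) \<longlonglongrightarrow> integral\<^sup>L lborel (\<lambda>\<tau>. complex_of_real (?g \<tau>))"
    and ig: "integrable lborel (\<lambda>\<tau>. complex_of_real (?g \<tau>))" for j
  proof -
    show "(\<lambda>n. integral\<^sup>L lborel (scaled_char K (Suc n) j 0)) \<longlonglongrightarrow> integral\<^sup>L lborel (\<lambda>\<tau>. complex_of_real (?g \<tau>))"
      by (rule integral_dominated_convergence[where w = ?w]) (use gm iw lim bnd in auto)
    show "integrable lborel (\<lambda>\<tau>. complex_of_real (?g \<tau>))"
      by (rule integrable_dominated_convergence[where w = ?w and s = "\<lambda>n. scaled_char K (Suc n) j 0"])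
         (use gm iw lim bnd in auto)
  qed
  define I where "I = integral\<^sup>L lborel ?g"
  have ig': "integrable lborel ?g" using integrable_Re[OF ig] by simp
  have I: "I > 0"
  proof -
    have "I \<noteq> 0"
    proof
      assume "I = 0"
      then have "AE \<tau> in lborel. ?g \<tau> = 0"
        unfolding I_def using integral_nonneg_eq_0_iff_AE[OF ig'] by simp
      then have "AE \<tau> :: real \<times> real in lborel. False" by simp
      then show False by (simp add: eventually_False ae_filter_eq_bot_iff)
    qed
    moreover have "I \<ge> 0" unfolding I_def by (intro Bochner_Integration.integral_nonneg) simp
    ultimately show ?thesis by simp
  qed
  have conv: "(\<lambda>n. 4 * pi\<^sup>2 * real (Suc n) * occ K (Suc n) j 0) \<longlonglongrightarrow> I" for j
  proof -
    have "(\<lambda>n. complex_of_real (4 * pi\<^sup>2 * real (Suc n) * occ K (Suc n) j 0)) \<longlonglongrightarrow> complex_of_real I"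
      using DC[of j] by (simp only: occ_eq_integral_scaled_char zero_less_Suc integral_complex_of_real I_def)
    then show ?thesis by (simp only: tendsto_of_real_iff)
  qed
  have "\<forall>\<^sub>F n in sequentially. I / 2 < 4 * pi\<^sup>2 * real (Suc n) * occ K (Suc n) j 0" for j
    by (rule order_tendstoD(1)[OF conv]) (use I in simp)
  then have "\<forall>\<^sub>F n in sequentially. \<forall>j. I / 2 < 4 * pi\<^sup>2 * real (Suc n) * occ K (Suc n) j 0"
    by (simp add: eventually_all_finite)
  then obtain N where N: "\<And>n j. n \<ge> N \<Longrightarrow> I / 2 < 4 * pi\<^sup>2 * real (Suc n) * occ K (Suc n) j 0"
    unfolding eventually_sequentially by blast
  have "I / (8 * pi\<^sup>2) / real (Suc n) \<le> occ K (Suc n) j 0" if "n \<ge> N" for n j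
    using N[OF that, of j] by (simp add: field_simps del: of_nat_Suc)
  then show ?thesis using I by (intro exI[of _ "I / (8 * pi\<^sup>2)"] conjI exI[of _ N]) auto
qed

end

section \<open>Green functions and squared hitting probabilities\<close>

lemma harmonic_dyadic: "(\<Sum>l\<le>2 ^ k. 1 / (real l + 1)) \<le> 2 * (real k + 1)"
proof -
  have "(\<Sum>l\<le>2 ^ k. 1 / (real l + 1)) \<le> real k + 3 / 2"
  proof (induction k)
    case (Suc k)
    have "{..(2 :: nat) ^ Suc k} = {..2 ^ k} \<union> {2 ^ k<..2 ^ Suc k}" by auto
    then have "(\<Sum>l\<le>2 ^ Suc k. 1 / (real l + 1)) = (\<Sum>l\<le>2 ^ k. 1 / (real l + 1)) + (\<Sum>l\<in>{2 ^ k<..2 ^ Suc k}. 1 / (real l + 1))"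
      by (simp only:, subst sum.union_disjoint) auto
    also have "(\<Sum>l\<in>{2 ^ k<..(2 :: nat) ^ Suc k}. 1 / (real l + 1)) \<le> real (card {2 ^ k<..(2 :: nat) ^ Suc k}) * (1 / 2 ^ k)"
    proof (rule sum_bounded_above)
      fix l :: nat assume "l \<in> {2 ^ k<..2 ^ Suc k}"
      then have "real (2 ^ k) \<le> real l + 1" by (simp only: greaterThanAtMost_iff) linarith
      then show "1 / (real l + 1) \<le> 1 / 2 ^ k" by (intro divide_left_mono) auto
    qed
    also have "\<dots> = 1" by simp
    finally show ?case using Suc by simp
  qed simp
  then show ?thesis by simp
qed

lemma square_sum_le:
  fixes a :: "nat \<Rightarrow> real"
  assumes "\<And>l. 0 \<le> a l"
  shows "(\<Sum>l\<le>n. a l)\<^sup>2 \<le> 2 * (\<Sum>l\<le>n. \<Sum>m\<le>l. a l * a m)"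
proof (induction n)
  case 0
  then show ?case by (simp add: power2_eq_square assms)
next
  case (Suc n)
  have "(\<Sum>l\<le>Suc n. a l)\<^sup>2 = (\<Sum>l\<le>n. a l)\<^sup>2 + 2 * (a (Suc n) * (\<Sum>l\<le>n. a l)) + a (Suc n) * a (Suc n)"
    by (simp add: power2_eq_square algebra_simps)
  also have "\<dots> \<le> 2 * (\<Sum>l\<le>n. \<Sum>m\<le>l. a l * a m) + 2 * (a (Suc n) * (\<Sum>m\<le>Suc n. a m))"
  proof -
    have "0 \<le> a (Suc n) * a (Suc n)" by (intro mult_nonneg_nonneg assms)
    then show ?thesis using Suc by (simp only: sum.atMost_Suc distrib_left)
  qed
  also have "\<dots> = 2 * (\<Sum>l\<le>Suc n. \<Sum>m\<le>l. a l * a m)"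
    by (simp add: sum_distrib_left distrib_left)
  finally show ?case .
qed

lemma occ_sum_space: "(\<integral>\<^sup>+ x. ennreal (occ K n j x) \<partial>count_space UNIV) = 1"
proof -
  have "occ K n j x = pmf (map_pmf fst (walk_pmf K n j)) x" for x
    by (simp add: occ_def pmf_map vimage_def)
  then show ?thesis by (simp add: nn_integral_pmf measure_pmf.emeasure_space_1[simplified])
qed

text \<open>
  At two times \<open>m \<le> l\<close>, the sum over all sites of the product of the two
  occupation probabilities is at most \<open>A / (l + 1)\<close>, and there are \<open>l +
  1\<close> choices of \<open>m\<close>.
\<close>

lemma green_square_sum:
  assumes A: "\<And>n x. occ K n j x \<le> A / (real n + 1)" and "0 < A"
  shows "(\<integral>\<^sup>+ x. ennreal ((green K n j x)\<^sup>2) \<partial>count_space UNIV) \<le> ennreal (2 * A * (real n + 1))"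
proof -
  have "(green K n j x)\<^sup>2 \<le> (\<Sum>l\<le>n. \<Sum>m\<le>l. 2 * A / (real l + 1) * occ K m j x)" for x
  proof -
    have "(green K n j x)\<^sup>2 \<le> 2 * (\<Sum>l\<le>n. \<Sum>m\<le>l. occ K l j x * occ K m j x)"
      unfolding green_def by (rule square_sum_le) (rule occ_nonneg)
    also have "\<dots> \<le> 2 * (\<Sum>l\<le>n. \<Sum>m\<le>l. A / (real l + 1) * occ K m j x)"
      by (intro mult_left_mono sum_mono mult_right_mono A occ_nonneg) simp
    finally show ?thesis by (simp add: sum_distrib_left mult_ac)
  qed
  then have "(\<integral>\<^sup>+ x. ennreal ((green K n j x)\<^sup>2) \<partial>count_space UNIV) \<le>
      (\<integral>\<^sup>+ x. ennreal (\<Sum>l\<le>n. \<Sum>m\<le>l. 2 * A / (real l + 1) * occ K m j x) \<partial>count_space UNIV)"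
    by (intro nn_integral_mono ennreal_leI)
  also have "\<dots> = (\<integral>\<^sup>+ x. (\<Sum>l\<le>n. \<Sum>m\<le>l. ennreal (2 * A / (real l + 1)) * ennreal (occ K m j x)) \<partial>count_space UNIV)"
  proof (intro nn_integral_cong)
    fix x
    have 0: "0 \<le> 2 * A / (real l + 1)" for l using \<open>0 < A\<close> by simp
    have "ennreal (\<Sum>l\<le>n. \<Sum>m\<le>l. 2 * A / (real l + 1) * occ K m j x)
        = (\<Sum>l\<le>n. \<Sum>m\<le>l. ennreal (2 * A / (real l + 1) * occ K m j x))"
      using 0 by (simp only: sum_ennreal sum_nonneg mult_nonneg_nonneg occ_nonneg)
    also have "\<dots> = (\<Sum>l\<le>n. \<Sum>m\<le>l. ennreal (2 * A / (real l + 1)) * ennreal (occ K m j x))"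
      by (simp only: ennreal_mult[OF 0 occ_nonneg])
    finally show "ennreal (\<Sum>l\<le>n. \<Sum>m\<le>l. 2 * A / (real l + 1) * occ K m j x)
        = (\<Sum>l\<le>n. \<Sum>m\<le>l. ennreal (2 * A / (real l + 1)) * ennreal (occ K m j x))" .
  qed
  also have "\<dots> = (\<Sum>l\<le>n. \<Sum>m\<le>l. ennreal (2 * A / (real l + 1)))"
    by (simp add: nn_integral_sum nn_integral_cmult occ_sum_space)
  also have "\<dots> = ennreal (\<Sum>l\<le>n. \<Sum>m\<le>l. 2 * A / (real l + 1))"
  proof -
    have "0 \<le> 2 * A / (real l + 1)" for l using \<open>0 < A\<close> by simp
    then show ?thesis by (simp only: sum_ennreal sum_nonneg)
  qed
  also have "(\<Sum>l\<le>n. \<Sum>m\<le>l. 2 * A / (real l + 1)) = (\<Sum>l\<le>n. 2 * A)"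
    by (intro sum.cong refl) (simp add: field_simps)
  also have "\<dots> = 2 * A * (real n + 1)" by simp
  finally show ?thesis .
qed

text \<open>
  A bound for the hitting probability that does not depend on the state from which the walk starts.
\<close>

definition hit_sum :: "('e::finite \<Rightarrow> ('v::ab_group_add \<times> 'e) pmf) \<Rightarrow> nat \<Rightarrow> 'v \<Rightarrow> real" where
  "hit_sum K n x = (\<Sum>j\<in>UNIV. hit K n j x)"

lemma hit_le_hit_sum:
  assumes "n \<le> N" shows "hit K n j x \<le> hit_sum K N x"
proof -
  have "hit K n j x \<le> hit K N j x" by (rule hit_mono[OF assms])
  also have "\<dots> \<le> hit_sum K N x"
    unfolding hit_sum_def by (rule member_le_sum) (auto simp: hit_nonneg)
  finally show ?thesis .
qed

context dual_walks
begin

lemma green_upper: "\<exists>A>0. \<forall>k j. green K (2 ^ k) j 0 \<le> A * (real k + 1)"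
proof -
  obtain C c where "fourier_decay K C c" using decay by blast
  then obtain A where A: "A > 0" "\<And>n j x. occ K n j x \<le> A / (real n + 1)"
    using occ_upper by metis
  have "green K (2 ^ k) j 0 \<le> 2 * A * (real k + 1)" for k j
  proof -
    have "green K (2 ^ k) j 0 \<le> (\<Sum>l\<le>2 ^ k. A * (1 / (real l + 1)))"
      unfolding green_def using A(2) by (intro sum_mono) simp
    also have "\<dots> \<le> A * (2 * (real k + 1))"
      unfolding sum_distrib_left[symmetric] using A(1) harmonic_dyadic by (intro mult_left_mono) auto
    finally show ?thesis by (simp add: algebra_simps)
  qed
  then show ?thesis using A(1) by (intro exI[of _ "2 * A"]) auto
qed

text \<open>
  Every dyadic block of times beyond \<open>N\<close> contributes at least \<open>c / 2\<close>.
\<close>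

lemma green_lower: "\<exists>b>0. \<forall>k j. b * (real k + 1) \<le> green K (2 ^ k) j 0"
proof -
  obtain c N where c: "c > 0" and N: "\<And>n j. n \<ge> N \<Longrightarrow> c / real (Suc n) \<le> occ K (Suc n) j 0"
    using occ_lower by blast
  \<comment> \<open>the second term covers the times before \<open>N\<close>, where only the visit at
    time 0 is counted\<close>
  define b where "b = min (c / 2) (1 / (real N + 1))"
  have b: "0 < b" "b \<le> c / 2" "b * (real N + 1) \<le> 1"
    using c by (auto simp: b_def min_def field_simps)
  have one: "1 \<le> green K n j 0" for n j
    using green_mono[of 0 n K j 0] by (simp add: green_0)
  have "b * (real k + 1) \<le> green K (2 ^ k) j 0" for k j
  proof (induction k)
    case 0
    have "b * (real 0 + 1) \<le> b * (real N + 1)" using b by (intro mult_left_mono) auto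
    then show ?case using b(3) one[of "2 ^ 0" j] by linarith
  next
    case (Suc k)
    show ?case
    proof (cases "Suc k \<le> N")
      case True
      have "b * (real (Suc k) + 1) \<le> b * (real N + 1)" using b True by (intro mult_left_mono) auto
      then show ?thesis using b(3) one[of "2 ^ Suc k" j] by linarith
    next
      case False
      then have Nk: "N \<le> k" by simp
      have "{..(2 :: nat) ^ Suc k} = {..2 ^ k} \<union> {2 ^ k<..2 ^ Suc k}" by auto
      then have "green K (2 ^ Suc k) j 0 = green K (2 ^ k) j 0 + (\<Sum>l\<in>{2 ^ k<..2 ^ Suc k}. occ K l j 0)"
        unfolding green_def by (simp only:, subst sum.union_disjoint) auto
      moreover have "real (card {2 ^ k<..(2 :: nat) ^ Suc k}) * (c / 2 ^ Suc k) \<le> (\<Sum>l\<in>{2 ^ k<..2 ^ Suc k}. occ K l j 0)"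
      proof (rule sum_bounded_below)
        fix l :: nat assume l: "l \<in> {2 ^ k<..2 ^ Suc k}"
        then obtain m where m: "l = Suc m" by (cases l) auto
        have "k < 2 ^ k" by simp
        then have "N \<le> m" using l m Nk by (simp only: greaterThanAtMost_iff) linarith
        then have "c / real l \<le> occ K l j 0" using N[of m j] m by simp
        moreover have "c / 2 ^ Suc k \<le> c / real l"
        proof (rule divide_left_mono)
          have "real l \<le> real (2 ^ Suc k)" using l by (simp only: greaterThanAtMost_iff of_nat_le_iff)
          then show "real l \<le> 2 ^ Suc k" by simp
        qed (use c m in auto)
        ultimately show "c / 2 ^ Suc k \<le> occ K l j 0" by linarith
      qed
      moreover have "real (card {2 ^ k<..(2 :: nat) ^ Suc k}) * (c / 2 ^ Suc k) = c / 2" by simp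
      ultimately show ?thesis using Suc b(2) by (simp add: distrib_left)
    qed
  qed
  then show ?thesis using b by blast
qed

text \<open>
  Hitting probabilities are at most the Green function divided by a multiple of \<open>k +
  1\<close>, and the squares of the Green function sum to \<open>O(2 ^ k)\<close>.
\<close>

lemma hit_sum_square_sum:
  "\<exists>C>0. \<forall>k. (\<integral>\<^sup>+ x. ennreal ((hit_sum K (2 ^ k) x)\<^sup>2) \<partial>count_space UNIV) \<le> ennreal (C * 2 ^ k / (real k + 1)\<^sup>2)"
proof -
  obtain C c where "fourier_decay K C c" using decay by blast
  then obtain A where A: "A > 0" "\<And>n j x. occ K n j x \<le> A / (real n + 1)"
    using occ_upper by metis
  obtain b where b: "b > 0" "\<And>k j. b * (real k + 1) \<le> green K (2 ^ k) j 0"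
    using green_lower by blast
  define s where "s = real CARD('e)"
  have s: "s > 0" by (simp add: s_def)
  have pt: "(hit_sum K (2 ^ k) x)\<^sup>2 \<le> (\<Sum>j\<in>UNIV. s / (b * (real k + 1))\<^sup>2 * (green K (2 ^ k + 2 ^ k) j x)\<^sup>2)" for k x
  proof -
    have "(hit_sum K (2 ^ k) x)\<^sup>2 \<le> s * (\<Sum>j\<in>UNIV. (hit K (2 ^ k) j x)\<^sup>2)"
      unfolding hit_sum_def s_def using sum_squared_le_sum_of_squares[of "\<lambda>j. hit K (2 ^ k) j x" UNIV]
      by (simp add: mult.commute)
    also have "\<dots> \<le> s * (\<Sum>j\<in>UNIV. (green K (2 ^ k + 2 ^ k) j x / (b * (real k + 1)))\<^sup>2)"
    proof (intro mult_left_mono sum_mono power_mono hit_nonneg)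
      fix j
      have "b * (real k + 1) * hit K (2 ^ k) j x \<le> green K (2 ^ k + 2 ^ k) j x"
        by (rule hit_le_green) (use b in auto)
      then show "hit K (2 ^ k) j x \<le> green K (2 ^ k + 2 ^ k) j x / (b * (real k + 1))"
        using b(1) by (simp add: pos_le_divide_eq mult.commute)
    qed (use s in simp)
    finally show ?thesis by (simp add: power_divide sum_distrib_left)
  qed
  define D where "D = s * (s / b\<^sup>2 * (6 * A))"
  have "(\<integral>\<^sup>+ x. ennreal ((hit_sum K (2 ^ k) x)\<^sup>2) \<partial>count_space UNIV) \<le> ennreal (D * 2 ^ k / (real k + 1)\<^sup>2)" for k
  proof -
    let ?q = "s / (b * (real k + 1))\<^sup>2"
    have q: "?q \<ge> 0" using s by simp
    have "(\<integral>\<^sup>+ x. ennreal ((hit_sum K (2 ^ k) x)\<^sup>2) \<partial>count_space UNIV) \<le>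
       (\<integral>\<^sup>+ x. (\<Sum>j\<in>UNIV. ennreal ?q * ennreal ((green K (2 ^ k + 2 ^ k) j x)\<^sup>2)) \<partial>count_space UNIV)"
    proof (rule nn_integral_mono)
      fix x
      have "ennreal ((hit_sum K (2 ^ k) x)\<^sup>2) \<le> ennreal (\<Sum>j\<in>UNIV. ?q * (green K (2 ^ k + 2 ^ k) j x)\<^sup>2)"
        by (rule ennreal_leI) (rule pt)
      also have "\<dots> = (\<Sum>j\<in>UNIV. ennreal ?q * ennreal ((green K (2 ^ k + 2 ^ k) j x)\<^sup>2))"
        by (subst sum_ennreal[symmetric], rule mult_nonneg_nonneg[OF q zero_le_power2])
           (simp only: ennreal_mult[OF q zero_le_power2])
      finally show "ennreal ((hit_sum K (2 ^ k) x)\<^sup>2) \<le> (\<Sum>j\<in>UNIV. ennreal ?q * ennreal ((green K (2 ^ k + 2 ^ k) j x)\<^sup>2))" .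
    qed
    also have "\<dots> = (\<Sum>j\<in>UNIV. ennreal ?q * (\<integral>\<^sup>+ x. ennreal ((green K (2 ^ k + 2 ^ k) j x)\<^sup>2) \<partial>count_space UNIV))"
      by (simp add: nn_integral_sum nn_integral_cmult)
    also have "\<dots> \<le> (\<Sum>j\<in>(UNIV :: 'e set). ennreal ?q * ennreal (6 * A * 2 ^ k))"
    proof (intro sum_mono mult_left_mono order_trans[OF green_square_sum[OF A(2) A(1)]] ennreal_leI)
      have "real (2 ^ k + 2 ^ k) + 1 \<le> 3 * 2 ^ k" using one_le_power[of "2 :: real" k] by simp
      then have "2 * A * (real (2 ^ k + 2 ^ k) + 1) \<le> 2 * A * (3 * 2 ^ k)"
        using A(1) by (intro mult_left_mono) auto
      then show "2 * A * (real (2 ^ k + 2 ^ k) + 1) \<le> 6 * A * 2 ^ k" by simp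
    qed simp
    also have "\<dots> = ennreal s * (ennreal ?q * ennreal (6 * A * 2 ^ k))"
      by (simp add: s_def ennreal_of_nat_eq_real_of_nat)
    also have "\<dots> = ennreal (s * (?q * (6 * A * 2 ^ k)))"
    proof -
      have "0 \<le> 6 * A * 2 ^ k" using A(1) by simp
      then show ?thesis using q s by (simp only: ennreal_mult mult_nonneg_nonneg less_imp_le)
    qed
    also have "s * (?q * (6 * A * 2 ^ k)) = D * 2 ^ k / (real k + 1)\<^sup>2"
      by (simp add: D_def power_mult_distrib)
    finally show ?thesis .
  qed
  moreover have "D > 0" using A b s by (simp add: D_def)
  ultimately show ?thesis by blast
qed

end

section \<open>The mean number of visited sites\<close>

lemma range_pmf_support:
  assumes "A \<in> set_pmf (range_pmf K n j)"
  shows "finite A" "0 \<in> A" "card A \<le> n + 1"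
proof -
  have "finite A \<and> 0 \<in> A \<and> card A \<le> n + 1"
    using assms
  proof (induction n arbitrary: j A)
    case (Suc n)
    from Suc.prems obtain y k B where B: "B \<in> set_pmf (range_pmf K n k)" and A: "A = insert 0 ((+) y ` B)"
      by auto
    have "finite B" "card B \<le> n + 1" using Suc.IH[OF B] by auto
    moreover have "card A \<le> Suc (card ((+) y ` B))" unfolding A by (rule card_insert_le_m1[THEN order_trans]) (use \<open>finite B\<close> in \<open>auto simp: card_insert_if\<close>)
    moreover have "card ((+) y ` B) = card B" by (simp add: card_image)
    ultimately show ?case by (simp add: A)
  qed simp
  then show "finite A" "0 \<in> A" "card A \<le> n + 1" by auto
qed

definition mean_range :: "('e \<Rightarrow> ('v::ab_group_add \<times> 'e) pmf) \<Rightarrow> nat \<Rightarrow> 'e \<Rightarrow> real" where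
  "mean_range K n j = \<E> (range_pmf K n j) (\<lambda>A. real (card A))"

lemma mean_range_nonneg: "0 \<le> mean_range K n j"
  unfolding mean_range_def by (rule Bochner_Integration.integral_nonneg) simp

lemma mean_range_le: "mean_range K n j \<le> real n + 1"
proof -
  have "norm (mean_range K n j) \<le> real n + 1"
    unfolding mean_range_def
    by (rule norm_expectation_le) (use range_pmf_support(3) in \<open>fastforce simp: add.commute\<close>)
  then show ?thesis by simp
qed

lemma card_translate_insert:
  fixes A :: "'v::ab_group_add set"
  assumes "finite A"
  shows "real (card (insert 0 ((+) y ` A))) = real (card A) + (1 - indicator {B. - y \<in> B} A)"
proof -
  have "0 \<in> (+) y ` A \<longleftrightarrow> - y \<in> A"
    by (auto simp: image_iff eq_commute[of 0] add_eq_0_iff)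
  then show ?thesis using assms by (simp add: card_insert_if card_image indicator_def)
qed

lemma abs_not_hit_le: "\<bar>1 - hit K n j x\<bar> \<le> 1"
  using hit_nonneg[of K n j x] hit_le_1[of K n j x] by linarith

text \<open>
  Adding a step at the front adds the starting site, unless the rest of the walk returns to it.
\<close>

lemma mean_range_Suc:
  "mean_range K (Suc n) j = \<E> (K j) (\<lambda>u. mean_range K n (snd u) + (1 - hit K n (snd u) (- fst u)))"
proof -
  have main: "mean_range K (Suc n) j = \<E> (K j)
      (\<lambda>u. \<E> (range_pmf K n (snd u)) (\<lambda>A. real (card (insert 0 ((+) (fst u) ` A)))))"
    unfolding mean_range_def range_pmf.simps case_prod_unfold
    by (subst expectation_bind_support[where B = "real (Suc n + 1)"])
       (use range_pmf_support(3)[of _ K "Suc n" j] in \<open>auto simp: case_prod_unfold simp del: of_nat_Suc of_nat_add\<close>)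
  have inner: "\<E> (range_pmf K n k) (\<lambda>A. real (card (insert 0 ((+) y ` A))))
     = mean_range K n k + (1 - hit K n k (- y))" for y k
  proof -
    have i1: "integrable (range_pmf K n k) (\<lambda>A. real (card A))"
      by (rule integrable_pmf_support[where B = "real (n + 1)"])
         (use range_pmf_support(3) in \<open>fastforce simp del: of_nat_add\<close>)
    have i2: "integrable (range_pmf K n k) (\<lambda>A. indicator {B. - y \<in> B} A :: real)"
      by (rule integrable_pmf_bounded[where B = 1]) (auto simp: indicator_def)
    have "\<E> (range_pmf K n k) (\<lambda>A. real (card (insert 0 ((+) y ` A))))
       = \<E> (range_pmf K n k) (\<lambda>A. real (card A) + (1 - indicator {B. - y \<in> B} A))"
      by (intro integral_cong_AE) (auto simp: AE_measure_pmf_iff card_translate_insert range_pmf_support(1))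
    also have "\<dots> = mean_range K n k + (1 - hit K n k (- y))"
      using i1 i2 by (simp add: mean_range_def hit_def)
    finally show ?thesis .
  qed
  show ?thesis unfolding main inner ..
qed

lemma nn_integral_indicator_card:
  assumes "finite A"
  shows "(\<integral>\<^sup>+ x. indicator A x \<partial>count_space UNIV) = ennreal (real (card A))"
  using assms by (simp add: ennreal_of_nat_eq_real_of_nat)

lemma nn_integral_pmf_swap:
  fixes F :: "'v::countable \<Rightarrow> 'b \<Rightarrow> ennreal"
  shows "(\<integral>\<^sup>+ A. \<integral>\<^sup>+ x. F x A \<partial>count_space UNIV \<partial>measure_pmf R) = (\<integral>\<^sup>+ x. \<integral>\<^sup>+ A. F x A \<partial>measure_pmf R \<partial>count_space UNIV)"
  by (rule nn_integral_count_space_nn_integral) auto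

lemma mean_range_eq_sum_hit:
  fixes K :: "'e \<Rightarrow> ('v::{ab_group_add, countable} \<times> 'e) pmf"
  shows "ennreal (mean_range K n j) = (\<integral>\<^sup>+ x. ennreal (hit K n j x) \<partial>count_space UNIV)"
proof -
  have i: "integrable (range_pmf K n j) (\<lambda>A. real (card A))"
    by (rule integrable_pmf_support[where B = "real (n + 1)"])
       (use range_pmf_support(3) in \<open>fastforce simp del: of_nat_add\<close>)
  have "ennreal (mean_range K n j) = (\<integral>\<^sup>+ A. ennreal (real (card A)) \<partial>range_pmf K n j)"
    unfolding mean_range_def by (rule nn_integral_eq_integral[OF i, symmetric]) simp
  also have "\<dots> = (\<integral>\<^sup>+ A. \<integral>\<^sup>+ x. indicator {A. x \<in> A} A \<partial>count_space UNIV \<partial>range_pmf K n j)"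
  proof (rule nn_integral_cong_AE, unfold AE_measure_pmf_iff, rule ballI)
    fix A assume "A \<in> set_pmf (range_pmf K n j)"
    from nn_integral_indicator_card[OF range_pmf_support(1)[OF this]]
    show "ennreal (real (card A)) = (\<integral>\<^sup>+ x. indicator {A. x \<in> A} A \<partial>count_space UNIV)"
      by (simp add: indicator_def)
  qed
  also have "\<dots> = (\<integral>\<^sup>+ x. \<integral>\<^sup>+ A. indicator {A. x \<in> A} A \<partial>range_pmf K n j \<partial>count_space UNIV)"
    by (rule nn_integral_pmf_swap)
  also have "\<dots> = (\<integral>\<^sup>+ x. ennreal (hit K n j x) \<partial>count_space UNIV)"
    by (simp add: hit_def measure_pmf.emeasure_eq_measure)
  finally show ?thesis .
qed

lemma mean_range_mono:
  fixes K :: "'e \<Rightarrow> ('v::{ab_group_add, countable} \<times> 'e) pmf"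
  assumes "m \<le> n"
  shows "mean_range K m j \<le> mean_range K n j"
proof -
  have "ennreal (mean_range K m j) \<le> ennreal (mean_range K n j)"
    unfolding mean_range_eq_sum_hit by (intro nn_integral_mono ennreal_leI hit_mono assms)
  then show ?thesis by (simp add: mean_range_nonneg)
qed

lemma mean_range_almost_subharmonic:
  fixes K :: "'e::finite \<Rightarrow> ('v::{ab_group_add, countable} \<times> 'e) pmf"
  shows "almost_subharmonic K (mean_range K n)"
  unfolding almost_subharmonic_def
proof
  fix j
  have "mean_range K n j \<le> mean_range K (Suc n) j" by (rule mean_range_mono) simp
  also have "\<dots> \<le> \<E> (K j) (\<lambda>u. mean_range K n (snd u) + 1)"
    unfolding mean_range_Suc
  proof (rule expectation_mono_support[where B = "real n + 2" and C = "real n + 2"])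
    fix u
    show "\<bar>mean_range K n (snd u) + (1 - hit K n (snd u) (- fst u))\<bar> \<le> real n + 2"
      "\<bar>mean_range K n (snd u) + 1\<bar> \<le> real n + 2"
      "mean_range K n (snd u) + (1 - hit K n (snd u) (- fst u)) \<le> mean_range K n (snd u) + 1"
      using mean_range_nonneg[of K n "snd u"] mean_range_le[of K n "snd u"]
        hit_nonneg[of K n "snd u" "- fst u"] hit_le_1[of K n "snd u" "- fst u"] by linarith+
  qed
  also have "\<dots> = 1 + \<E> (K j) (\<lambda>u. mean_range K n (snd u))"
    using integrable_state_fun[of "K j" "mean_range K n"] by (simp add: measure_pmf.prob_space)
  finally show "mean_range K n j \<le> 1 + \<E> (K j) (\<lambda>u. mean_range K n (snd u))" .
qed

lemma green_sum_space: "(\<integral>\<^sup>+ x. ennreal (green K n j x) \<partial>count_space UNIV) = ennreal (real n + 1)"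
proof -
  have "(\<integral>\<^sup>+ x. ennreal (green K n j x) \<partial>count_space UNIV) = (\<integral>\<^sup>+ x. (\<Sum>l\<le>n. ennreal (occ K l j x)) \<partial>count_space UNIV)"
    by (simp add: green_def sum_ennreal occ_nonneg)
  also have "\<dots> = (\<Sum>l\<le>n. 1)" by (simp only: nn_integral_sum occ_sum_space borel_measurable_count_space)
  also have "\<dots> = ennreal (real n + 1)" by (simp add: ennreal_of_nat_eq_real_of_nat ennreal_plus)
  finally show ?thesis .
qed

section \<open>Cutting the stationary walk in two\<close>

text \<open>
  Past and future of a stationary walk, both seen from the present site, as independent ranges
  given the present state.
\<close>

definition two_sided ::
  "('e \<Rightarrow> ('v::ab_group_add \<times> 'e) pmf) \<Rightarrow> ('e \<Rightarrow> ('v \<times> 'e) pmf) \<Rightarrow> 'e pmf \<Rightarrow> nat \<Rightarrow> nat \<Rightarrow> ('v set \<times> 'v set) pmf" where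
  "two_sided K' K \<mu> n m = bind_pmf \<mu> (\<lambda>k. pair_pmf (range_pmf K' n k) (range_pmf K m k))"

lemma card_union_translate:
  fixes A B :: "'v::ab_group_add set"
  assumes "0 \<in> A" "0 \<in> B"
  shows "card (insert 0 ((+) (- z) ` A) \<union> B) = card (A \<union> insert 0 ((+) z ` B))"
proof -
  have "(+) z ` (insert 0 ((+) (- z) ` A) \<union> B) = A \<union> insert 0 ((+) z ` B)"
  proof -
    have "(+) z ` (+) (- z) ` A = A" by (simp add: image_image)
    moreover have "z \<in> (+) z ` B" using assms(2) by (auto simp: image_iff)
    ultimately show ?thesis using assms(1) by (auto simp: image_Un)
  qed
  then show ?thesis by (metis card_image inj_on_add)
qed

context dual_walks
begin

text \<open>
  Moving the present by one step: the last step of the past becomes the first step of the future,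
  by duality, and the union of both ranges is only translated.
\<close>

lemma two_sided_shift:
  "map_pmf (\<lambda>(A, B). card (A \<union> B)) (two_sided K' K \<mu> (Suc n) m) =
   map_pmf (\<lambda>(A, B). card (A \<union> B)) (two_sided K' K \<mu> n (Suc m))"
proof -
  let ?R' = "range_pmf K' n" and ?R = "range_pmf K m"
  have "map_pmf (\<lambda>(A, B). card (A \<union> B)) (two_sided K' K \<mu> (Suc n) m) =
     bind_pmf (joint K' \<mu>) (\<lambda>(k, y, j). bind_pmf (?R' j) (\<lambda>A. bind_pmf (?R k) (\<lambda>B.
        return_pmf (card (insert 0 ((+) y ` A) \<union> B)))))"
    by (simp add: two_sided_def joint_def pair_pmf_def map_pmf_def bind_assoc_pmf bind_return_pmf case_prod_unfold)
  also have "\<dots> = bind_pmf (joint K \<mu>) (\<lambda>(j, z, k). bind_pmf (?R' j) (\<lambda>A. bind_pmf (?R k) (\<lambda>B.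
        return_pmf (card (insert 0 ((+) (- z) ` A) \<union> B)))))"
    unfolding dual by (simp add: bind_map_pmf case_prod_unfold)
  also have "\<dots> = bind_pmf (joint K \<mu>) (\<lambda>(j, z, k). bind_pmf (?R' j) (\<lambda>A. bind_pmf (?R k) (\<lambda>B.
        return_pmf (card (A \<union> insert 0 ((+) z ` B))))))"
    unfolding case_prod_unfold
    by (intro bind_pmf_cong_support arg_cong[where f = return_pmf] card_union_translate)
       (erule range_pmf_support(2))+
  also have "\<dots> = bind_pmf \<mu> (\<lambda>j. bind_pmf (K j) (\<lambda>(z, k). bind_pmf (?R' j) (\<lambda>A. bind_pmf (?R k) (\<lambda>B.
        return_pmf (card (A \<union> insert 0 ((+) z ` B)))))))"
    by (simp add: joint_def bind_assoc_pmf bind_map_pmf case_prod_unfold)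
  also have "\<dots> = bind_pmf \<mu> (\<lambda>j. bind_pmf (?R' j) (\<lambda>A. bind_pmf (K j) (\<lambda>(z, k). bind_pmf (?R k) (\<lambda>B.
        return_pmf (card (A \<union> insert 0 ((+) z ` B)))))))"
    unfolding case_prod_unfold by (subst bind_commute_pmf) simp
  also have "\<dots> = map_pmf (\<lambda>(A, B). card (A \<union> B)) (two_sided K' K \<mu> n (Suc m))"
    by (simp add: two_sided_def pair_pmf_def map_pmf_def bind_assoc_pmf bind_return_pmf case_prod_unfold)
  finally show ?thesis .
qed

lemma two_sided_law:
  "map_pmf (\<lambda>(A, B). card (A \<union> B)) (two_sided K' K \<mu> n m) = map_pmf card (bind_pmf \<mu> (range_pmf K (n + m)))"
proof (induction n arbitrary: m)
  case 0
  show ?case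
    unfolding two_sided_def map_bind_pmf
    by (intro bind_pmf_cong_support)
       (simp add: pair_pmf_def map_pmf_def bind_assoc_pmf bind_return_pmf,
        intro bind_pmf_cong_support, simp add: range_pmf_support(2) insert_absorb)
next
  case (Suc n)
  show ?case using Suc[of "Suc m"] by (simp add: two_sided_shift)
qed

lemma range_law_dual:
  "map_pmf card (bind_pmf \<mu> (range_pmf K' n)) = map_pmf card (bind_pmf \<mu> (range_pmf K n))"
proof -
  have "map_pmf (\<lambda>(A, B). card (A \<union> B)) (two_sided K' K \<mu> n 0) = map_pmf card (bind_pmf \<mu> (range_pmf K' n))"
    unfolding two_sided_def map_bind_pmf
    by (intro bind_pmf_cong_support)
       (simp add: pair_pmf_def map_pmf_def bind_assoc_pmf bind_return_pmf,
        intro bind_pmf_cong_support, simp add: range_pmf_support(2) insert_absorb)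
  then show ?thesis using two_sided_law[of n 0] by simp
qed

definition stat_mean :: "nat \<Rightarrow> real" where
  "stat_mean n = (\<Sum>j\<in>UNIV. pmf \<mu> j * mean_range K n j)"

definition stat_var :: "nat \<Rightarrow> real" where
  "stat_var n = \<E> (bind_pmf \<mu> (range_pmf K n)) (\<lambda>A. (real (card A) - stat_mean n)\<^sup>2)"

lemma expectation_stat_range:
  fixes f :: "nat \<Rightarrow> real"
  assumes "\<And>A j. A \<in> set_pmf (range_pmf K n j) \<Longrightarrow> \<bar>f (card A)\<bar> \<le> B"
  shows "\<E> (bind_pmf \<mu> (range_pmf K n)) (\<lambda>A. f (card A)) =
    (\<Sum>j\<in>UNIV. pmf \<mu> j * \<E> (range_pmf K n j) (\<lambda>A. f (card A)))"
  by (subst expectation_bind_support[where B = B], use assms in force, subst integral_measure_pmf[of UNIV]) auto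

lemma stat_mean_eq: "stat_mean n = \<E> (bind_pmf \<mu> (range_pmf K n)) (\<lambda>A. real (card A))"
  unfolding stat_mean_def mean_range_def
  by (rule expectation_stat_range[symmetric, where B = "real (n + 1)"])
     (use range_pmf_support(3) in \<open>fastforce simp del: of_nat_add\<close>)

lemma pmf_sum_1: "(\<Sum>j\<in>UNIV. pmf \<mu> j) = 1"
  by (simp add: sum_pmf_eq_1)

text \<open>
  The stationary mean is an average of the values at the single states, which differ by a bounded
  amount.
\<close>

lemma mean_range_near_stat_mean: "\<exists>D\<ge>0. \<forall>n j. \<bar>mean_range K n j - stat_mean n\<bar> \<le> D"
proof -
  obtain D where D: "D \<ge> 0" "\<And>g j k. almost_subharmonic K g \<Longrightarrow> \<bar>g j - g k\<bar> \<le> D"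
    using oscillation_bound[OF irreducible] by blast
  have "\<bar>mean_range K n j - stat_mean n\<bar> \<le> D" for n j
  proof -
    have "mean_range K n j - stat_mean n = (\<Sum>k\<in>UNIV. pmf \<mu> k * (mean_range K n j - mean_range K n k))"
      by (simp add: stat_mean_def right_diff_distrib sum_subtractf pmf_sum_1 flip: sum_distrib_right)
    also have "\<bar>\<dots>\<bar> \<le> (\<Sum>k\<in>UNIV. pmf \<mu> k * D)"
    proof (rule order_trans[OF sum_abs sum_mono])
      fix k
      show "\<bar>pmf \<mu> k * (mean_range K n j - mean_range K n k)\<bar> \<le> pmf \<mu> k * D"
        unfolding abs_mult using D(2)[OF mean_range_almost_subharmonic, of n j k]
        by (simp add: mult_left_mono)
    qed
    also have "\<dots> = D" by (simp add: pmf_sum_1 flip: sum_distrib_right)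
    finally show ?thesis .
  qed
  then show ?thesis using D(1) by blast
qed

text \<open>
  The stationary probability that the starting site of \<open>n + 1\<close> steps is not visited
  again: the increment of the mean range.
\<close>

definition new_site :: "nat \<Rightarrow> real" where
  "new_site n = (\<Sum>j\<in>UNIV. pmf \<mu> j * \<E> (K j) (\<lambda>u. 1 - hit K n (snd u) (- fst u)))"

lemma stat_mean_Suc: "stat_mean (Suc n) = stat_mean n + new_site n"
proof -
  have i: "integrable (K j) (\<lambda>u. 1 - hit K n (snd u) (- fst u))" for j
    by (rule integrable_pmf_bounded[where B = 1]) (simp add: abs_not_hit_le)
  have "mean_range K (Suc n) j = \<E> (K j) (\<lambda>u. mean_range K n (snd u))
     + \<E> (K j) (\<lambda>u. 1 - hit K n (snd u) (- fst u))" for j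
    unfolding mean_range_Suc by (rule Bochner_Integration.integral_add[OF integrable_state_fun i])
  then have "stat_mean (Suc n) = (\<Sum>j\<in>UNIV. pmf \<mu> j * \<E> (K j) (\<lambda>u. mean_range K n (snd u))) + new_site n"
    by (simp add: stat_mean_def new_site_def distrib_left sum.distrib)
  then show ?thesis by (simp add: stationary stat_mean_def)
qed

lemma new_site_antimono: "m \<le> n \<Longrightarrow> new_site n \<le> new_site m"
  unfolding new_site_def
  by (intro sum_mono mult_left_mono expectation_mono_support[where B = 1 and C = 1])
     (auto simp: abs_not_hit_le hit_mono)

lemma new_site_nonneg: "0 \<le> new_site n"
  unfolding new_site_def
  by (intro sum_nonneg mult_nonneg_nonneg Bochner_Integration.integral_nonneg) (use hit_le_1 in auto)

lemma stat_mean_0: "stat_mean 0 = 1"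
  by (simp add: stat_mean_def mean_range_def pmf_sum_1)

lemma stat_mean_mono: "m \<le> n \<Longrightarrow> stat_mean m \<le> stat_mean n"
  by (rule lift_Suc_mono_le[of stat_mean]) (use new_site_nonneg in \<open>auto simp: stat_mean_Suc\<close>)

lemma new_site_le_average: "real n * new_site n \<le> stat_mean n"
proof -
  have "real n * new_site m + 1 \<le> stat_mean n" if "n \<le> m" for m
    using that
  proof (induction n)
    case (Suc n)
    then show ?case using new_site_antimono[of n m] by (simp add: stat_mean_Suc algebra_simps)
  qed (simp add: stat_mean_0)
  from this[of n] show ?thesis by simp
qed

text \<open>
  The increments decrease and the value at 0 is positive, so \<open>stat_mean n / n\<close>
  decreases as well.
\<close>

lemma stat_mean_concave: "n \<le> N \<Longrightarrow> real n * stat_mean N \<le> real N * stat_mean n"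
proof (induction N)
  case (Suc N)
  show ?case
  proof (cases "n \<le> N")
    case True
    have "real n * new_site N \<le> real n * new_site n"
      using new_site_antimono[OF True] by (intro mult_left_mono) auto
    then have "real n * new_site N \<le> stat_mean n" using new_site_le_average[of n] by linarith
    then show ?thesis using Suc.IH[OF True] by (simp add: stat_mean_Suc algebra_simps)
  next
    case False
    then have "n = Suc N" using Suc.prems by simp
    then show ?thesis by simp
  qed
qed simp

text \<open>
  The Green functions of all sites sum to \<open>n + 1\<close>, and each is at most the hitting
  probability times \<open>A (k + 1)\<close>.
\<close>

lemma stat_mean_lower: "\<exists>c>0. \<forall>k. c * 2 ^ k / (real k + 1) \<le> stat_mean (2 ^ k)"
proof -
  obtain A where A: "A > 0" "\<And>k j. green K (2 ^ k) j 0 \<le> A * (real k + 1)"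
    using green_upper by blast
  have "2 ^ k / (A * (real k + 1)) \<le> mean_range K (2 ^ k) j" for k j
  proof -
    have "green K (2 ^ k) j x \<le> A * (real k + 1) * hit K (2 ^ k) j x" for x
      by (rule green_le_hit[where N = "2 ^ k"]) (use A in auto)
    then have "ennreal (real (2 ^ k) + 1) \<le> (\<integral>\<^sup>+ x. ennreal (A * (real k + 1) * hit K (2 ^ k) j x) \<partial>count_space UNIV)"
      unfolding green_sum_space[of K "2 ^ k" j, symmetric] by (intro nn_integral_mono ennreal_leI)
    also have "\<dots> = ennreal (A * (real k + 1)) * ennreal (mean_range K (2 ^ k) j)"
      unfolding mean_range_eq_sum_hit using A(1)
      by (simp add: ennreal_mult'' hit_nonneg nn_integral_cmult)
    also have "\<dots> = ennreal (A * (real k + 1) * mean_range K (2 ^ k) j)"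
      using A(1) mean_range_nonneg by (intro ennreal_mult[symmetric]) auto
    finally have "real (2 ^ k) + 1 \<le> A * (real k + 1) * mean_range K (2 ^ k) j"
      using A(1) mean_range_nonneg[of K "2 ^ k" j] by (subst (asm) ennreal_le_iff) auto
    then show ?thesis using A(1) by (simp add: pos_divide_le_eq mult.commute)
  qed
  then have "2 ^ k / (A * (real k + 1)) \<le> stat_mean (2 ^ k)" for k
  proof -
    assume "\<And>k j. 2 ^ k / (A * (real k + 1)) \<le> mean_range K (2 ^ k) j"
    then have "(\<Sum>j\<in>UNIV. pmf \<mu> j * (2 ^ k / (A * (real k + 1)))) \<le> stat_mean (2 ^ k)"
      unfolding stat_mean_def by (intro sum_mono mult_left_mono) auto
    then show ?thesis by (simp only: sum_distrib_right[symmetric] pmf_sum_1 mult_1)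
  qed
  then show ?thesis using A(1) by (intro exI[of _ "1 / A"]) auto
qed

end

section \<open>The variance of the number of visited sites\<close>

text \<open>
  Doubling the time multiplies the bound \<open>4 ^ k / (k + 1) ^ 4\<close> nearly by 4, but the
  main term of the recursion only by 3; the gap absorbs the error terms once \<open>k\<close> is
  large.
\<close>

lemma dyadic_recursion:
  fixes v :: "nat \<Rightarrow> real"
  assumes triv: "\<And>N. v N \<le> (real N + 1)\<^sup>2"
    and rec: "\<And>k n m. n \<le> 2 ^ k \<Longrightarrow> m \<le> 2 ^ k \<Longrightarrow>
        v (n + m) \<le> 3 / 2 * (v n + v m) + F + G * 4 ^ k / (real k + 1) ^ 4"
    and FG: "0 \<le> F" "0 \<le> G"
  shows "\<exists>B>0. \<forall>k N. N \<le> 2 ^ k \<longrightarrow> v N \<le> B * 4 ^ k / (real k + 1) ^ 4"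
proof -
  \<comment> \<open>the first term settles \<open>k \<le> 25\<close> by the trivial bound; from 25 on,
    \<open>((k + 2) / (k + 1)) ^ 4\<close> is at most \<open>7 / 6\<close>, and \<open>7 / 6 * (3 * B +
    F + G) \<le> 4 * B\<close>\<close>
  define B where "B = 4 * 26 ^ 4 + 3 * (F + G)"
  have B: "B > 0" using FG by (simp add: B_def)
  have ratio: "(real k + 2) ^ 4 \<le> 7 / 6 * (real k + 1) ^ 4" if "25 \<le> k" for k
  proof -
    have "real k + 2 \<le> 27 / 26 * (real k + 1)" using that by simp
    then have "(real k + 2) ^ 4 \<le> (27 / 26 * (real k + 1)) ^ 4" by (intro power_mono) auto
    also have "\<dots> = (27 / 26) ^ 4 * (real k + 1) ^ 4" by (rule power_mult_distrib)
    also have "\<dots> \<le> 7 / 6 * (real k + 1) ^ 4" by (intro mult_right_mono) (auto simp: power_divide)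
    finally show ?thesis .
  qed
  have exp: "(real k + 1) ^ 4 \<le> 4 ^ k" if "25 \<le> k" for k
    using that
  proof (induction k rule: dec_induct)
    case base
    show ?case by simp
  next
    case (step k)
    have "(real (Suc k) + 1) ^ 4 = (real k + 2) ^ 4" by (simp add: add.commute)
    also have "\<dots> \<le> 7 / 6 * (real k + 1) ^ 4" by (rule ratio[OF step(1)])
    also have "\<dots> \<le> 4 * 4 ^ k" using step(3) by (intro mult_mono) auto
    finally show ?case by simp
  qed
  have "v N \<le> B * 4 ^ k / (real k + 1) ^ 4" if "N \<le> 2 ^ k" for k N
    using that
  proof (induction k arbitrary: N)
    case 0
    have "v N \<le> (real N + 1)\<^sup>2" by (rule triv)
    also have "\<dots> \<le> (1 + 1)\<^sup>2" using 0 by (intro power_mono) auto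
    also have "\<dots> \<le> B" using FG by (simp add: B_def)
    finally show ?case by simp
  next
    case (Suc k)
    show ?case
    proof (cases "Suc k \<le> 25")
      case True
      have "real N \<le> 2 ^ Suc k" using of_nat_mono[OF Suc.prems, where ?'a = real] by simp
      moreover have "(1 :: real) \<le> 2 ^ Suc k" by (rule one_le_power) simp
      ultimately have "real N + 1 \<le> 2 * 2 ^ Suc k" by linarith
      then have "(real N + 1)\<^sup>2 \<le> (2 * 2 ^ Suc k)\<^sup>2" by (intro power_mono) auto
      also have "\<dots> = 4 * 4 ^ Suc k"
      proof -
        have "(2 ^ Suc k)\<^sup>2 = (4 :: real) ^ Suc k"
          using power_mult[of "2 :: real" 2 "Suc k"] power_mult[of "2 :: real" "Suc k" 2] by (simp add: mult.commute)
        then show ?thesis by (simp only: power_mult_distrib) simp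
      qed
      also have "\<dots> = 4 * 26 ^ 4 * 4 ^ Suc k / 26 ^ 4" by simp
      also have "\<dots> \<le> B * 4 ^ Suc k / (real (Suc k) + 1) ^ 4"
      proof (rule frac_le)
        show "4 * 26 ^ 4 * 4 ^ Suc k \<le> B * 4 ^ Suc k"
          using FG by (intro mult_right_mono) (auto simp: B_def)
        have "real (Suc k) + 1 \<le> 26" using of_nat_mono[OF True, where ?'a = real] by simp
        then show "(real (Suc k) + 1) ^ 4 \<le> 26 ^ 4" by (intro power_mono) auto
      qed (use B in auto)
      finally show ?thesis using triv[of N] by linarith
    next
      case False
      then have k: "25 \<le> k" by simp
      define n where "n = N div 2"
      have n: "n \<le> 2 ^ k" "N - n \<le> 2 ^ k" "n + (N - n) = N" using Suc.prems by (auto simp: n_def)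
      let ?q = "4 ^ k / (real k + 1) ^ 4"
      have q1: "1 \<le> ?q" using exp[OF k] by (simp add: pos_le_divide_eq)
      have collect: "3 / 2 * (B * q + B * q) + F * q + G * q = (3 * B + F + G) * q" for q
        by (simp add: algebra_simps)
      have "v N \<le> 3 / 2 * (v n + v (N - n)) + F + G * ?q"
        using rec[OF n(1,2)] n(3) by simp
      also have "\<dots> \<le> 3 / 2 * (B * ?q + B * ?q) + F * ?q + G * ?q"
        using Suc.IH[OF n(1)] Suc.IH[OF n(2)] mult_left_mono[OF q1 FG(1)]
        by (intro add_mono mult_left_mono) (use FG in auto)
      also have "\<dots> = (3 * B + F + G) * ?q" by (rule collect)
      also have "\<dots> \<le> (3 * B + F + G) * (7 / 6 * (4 ^ k / (real k + 2) ^ 4))"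
      proof (rule mult_left_mono)
        have "4 ^ k * (real k + 2) ^ 4 \<le> 4 ^ k * (7 / 6 * (real k + 1) ^ 4)"
          by (intro mult_left_mono ratio[OF k]) simp
        then show "?q \<le> 7 / 6 * (4 ^ k / (real k + 2) ^ 4)"
          by (simp add: field_simps)
      qed (use B FG in simp)
      also have "\<dots> \<le> (4 * B) * (4 ^ k / (real k + 2) ^ 4)"
      proof -
        have "(3 * B + F + G) * (7 / 6) \<le> 4 * B" using FG by (simp add: B_def)
        moreover have "0 \<le> 4 ^ k / (real k + 2) ^ 4" by simp
        ultimately have "(3 * B + F + G) * (7 / 6) * (4 ^ k / (real k + 2) ^ 4) \<le> 4 * B * (4 ^ k / (real k + 2) ^ 4)"
          by (rule mult_right_mono)
        then show ?thesis by (simp only: mult.assoc)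
      qed
      also have "\<dots> = B * 4 ^ Suc k / (real (Suc k) + 1) ^ 4" by (simp add: add.commute)
      finally show ?thesis .
    qed
  qed
  then show ?thesis using B by blast
qed

lemma card_square_sum:
  assumes "finite S"
  shows "ennreal ((real (card S))\<^sup>2) = (\<integral>\<^sup>+ x. \<integral>\<^sup>+ y. indicator {T. x \<in> T \<and> y \<in> T} S \<partial>count_space UNIV \<partial>count_space UNIV)"
proof -
  have "(\<integral>\<^sup>+ x. \<integral>\<^sup>+ y. indicator {T. x \<in> T \<and> y \<in> T} S \<partial>count_space UNIV \<partial>count_space UNIV)
      = (\<integral>\<^sup>+ x. \<integral>\<^sup>+ y. indicator S x * indicator S y \<partial>count_space UNIV \<partial>count_space UNIV)"
    by (intro nn_integral_cong) (simp add: indicator_def)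
  also have "\<dots> = (\<integral>\<^sup>+ x. indicator S x * ennreal (real (card S)) \<partial>count_space UNIV)"
    by (simp add: nn_integral_cmult nn_integral_indicator_card[OF assms] del: nn_integral_indicator)
  also have "\<dots> = ennreal (real (card S)) * ennreal (real (card S))"
    by (simp add: nn_integral_multc nn_integral_indicator_card[OF assms] del: nn_integral_indicator)
  also have "\<dots> = ennreal ((real (card S))\<^sup>2)"
    by (simp add: power2_eq_square flip: ennreal_mult)
  finally show ?thesis by simp
qed

lemma convolution_square_sum:
  fixes H :: "'v::{ab_group_add, countable} \<Rightarrow> real"
  defines "U \<equiv> (\<integral>\<^sup>+ x. ennreal ((H x)\<^sup>2) \<partial>count_space UNIV)"
  shows "(\<integral>\<^sup>+ x. \<integral>\<^sup>+ y. ennreal ((H x * H (y - x))\<^sup>2) \<partial>count_space UNIV \<partial>count_space UNIV) = U * U"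
    and "(\<integral>\<^sup>+ x. \<integral>\<^sup>+ y. ennreal ((H y * H (x - y))\<^sup>2) \<partial>count_space UNIV \<partial>count_space UNIV) = U * U"
proof -
  have shift: "(\<integral>\<^sup>+ y. ennreal ((H (y - x))\<^sup>2) \<partial>count_space UNIV) = U" for x
    unfolding U_def
    by (rule nn_integral_bij_count_space[where g = "\<lambda>y. y - x" and f = "\<lambda>y. ennreal ((H y)\<^sup>2)"])
       (rule bij_betwI[where g = "\<lambda>y. y + x"], auto)
  have split: "ennreal ((H a * H b)\<^sup>2) = ennreal ((H a)\<^sup>2) * ennreal ((H b)\<^sup>2)" for a b
    by (simp add: power_mult_distrib ennreal_mult)
  show one: "(\<integral>\<^sup>+ x. \<integral>\<^sup>+ y. ennreal ((H x * H (y - x))\<^sup>2) \<partial>count_space UNIV \<partial>count_space UNIV) = U * U"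
    unfolding split by (simp add: nn_integral_cmult shift nn_integral_multc flip: U_def)
  have "(\<integral>\<^sup>+ x. \<integral>\<^sup>+ y. ennreal ((H y * H (x - y))\<^sup>2) \<partial>count_space UNIV \<partial>count_space UNIV)
     = (\<integral>\<^sup>+ y. \<integral>\<^sup>+ x. ennreal ((H y * H (x - y))\<^sup>2) \<partial>count_space UNIV \<partial>count_space UNIV)"
    by (rule nn_integral_count_space_nn_integral) auto
  then show "(\<integral>\<^sup>+ x. \<integral>\<^sup>+ y. ennreal ((H y * H (x - y))\<^sup>2) \<partial>count_space UNIV \<partial>count_space UNIV) = U * U"
    using one by simp
qed

lemma product_le_convolution_squares:
  fixes a b c d a' b' c' d' p p' :: real
  assumes "p \<le> a * b + c * d" "p' \<le> a' * b' + c' * d'" "0 \<le> p" "0 \<le> p'"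
  shows "p * p' \<le> ((a * b)\<^sup>2 + (c * d)\<^sup>2) + ((a' * b')\<^sup>2 + (c' * d')\<^sup>2)"
proof -
  have sq: "(x + y)\<^sup>2 \<le> 2 * (x\<^sup>2 + y\<^sup>2)" for x y :: real
    using sum_squares_bound[of x y] by (simp add: power2_sum)
  have "2 * (p * p') \<le> p\<^sup>2 + p'\<^sup>2" using sum_squares_bound[of p p'] by simp
  also have "\<dots> \<le> (a * b + c * d)\<^sup>2 + (a' * b' + c' * d')\<^sup>2"
    by (intro add_mono power_mono assms)
  also have "\<dots> \<le> 2 * ((a * b)\<^sup>2 + (c * d)\<^sup>2) + 2 * ((a' * b')\<^sup>2 + (c' * d')\<^sup>2)"
    by (intro add_mono sq)
  finally show ?thesis by simp
qed

text \<open>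
  The square of the number of common sites counts pairs of sites that are hit by both walks. Given
  the present state these are independent events, and each has probability at most a sum of two
  products of hitting probabilities, whose squares sum up like a convolution.
\<close>

lemma intersection_second_moment:
  fixes K K' :: "'e::finite \<Rightarrow> ('v::{ab_group_add, countable} \<times> 'e) pmf"
  assumes n: "n \<le> N" "m \<le> N"
  defines "U \<equiv> (\<integral>\<^sup>+ x. ennreal ((hit_sum K N x)\<^sup>2) \<partial>count_space UNIV)"
    and "U' \<equiv> (\<integral>\<^sup>+ x. ennreal ((hit_sum K' N x)\<^sup>2) \<partial>count_space UNIV)"
  shows "(\<integral>\<^sup>+ u. ennreal ((real (card (fst u \<inter> snd u)))\<^sup>2) \<partial>two_sided K' K \<mu> n m) \<le> (U' * U' + U' * U') + (U * U + U * U)"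
proof -
  let ?W = "(U' * U' + U' * U') + (U * U + U * U)"
  let ?H = "hit_sum K N" and ?H' = "hit_sum K' N"
  have per_state: "(\<integral>\<^sup>+ u. ennreal ((real (card (fst u \<inter> snd u)))\<^sup>2) \<partial>pair_pmf (range_pmf K' n k) (range_pmf K m k)) \<le> ?W" for k
  proof -
    let ?R' = "range_pmf K' n k" and ?R = "range_pmf K m k"
    let ?i = "\<lambda>x y S. indicator {T. x \<in> T \<and> y \<in> T} S :: ennreal"
    have "(\<integral>\<^sup>+ u. ennreal ((real (card (fst u \<inter> snd u)))\<^sup>2) \<partial>pair_pmf ?R' ?R) =
        (\<integral>\<^sup>+ A. \<integral>\<^sup>+ B. ennreal ((real (card (A \<inter> B)))\<^sup>2) \<partial>?R \<partial>?R')"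
      by (subst nn_integral_pair_pmf') simp
    also have "\<dots> = (\<integral>\<^sup>+ A. \<integral>\<^sup>+ B. \<integral>\<^sup>+ x. \<integral>\<^sup>+ y. ?i x y A * ?i x y B \<partial>count_space UNIV \<partial>count_space UNIV \<partial>?R \<partial>?R')"
    proof (intro nn_integral_cong_AE, unfold AE_measure_pmf_iff, intro ballI nn_integral_cong_AE, unfold AE_measure_pmf_iff, intro ballI)
      fix A B assume "A \<in> set_pmf ?R'"
      then have "finite (A \<inter> B)" by (simp add: range_pmf_support(1))
      from card_square_sum[OF this]
      show "ennreal ((real (card (A \<inter> B)))\<^sup>2) = (\<integral>\<^sup>+ x. \<integral>\<^sup>+ y. ?i x y A * ?i x y B \<partial>count_space UNIV \<partial>count_space UNIV)"
        by (simp add: indicator_def) (intro nn_integral_cong, auto)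
    qed
    also have "\<dots> = (\<integral>\<^sup>+ A. \<integral>\<^sup>+ x. \<integral>\<^sup>+ y. \<integral>\<^sup>+ B. ?i x y A * ?i x y B \<partial>?R \<partial>count_space UNIV \<partial>count_space UNIV \<partial>?R')"
      by (simp only: nn_integral_pmf_swap)
    also have "\<dots> = (\<integral>\<^sup>+ x. \<integral>\<^sup>+ y. \<integral>\<^sup>+ A. \<integral>\<^sup>+ B. ?i x y A * ?i x y B \<partial>?R \<partial>?R' \<partial>count_space UNIV \<partial>count_space UNIV)"
      by (simp only: nn_integral_pmf_swap[where R = ?R'])
    also have "\<dots> = (\<integral>\<^sup>+ x. \<integral>\<^sup>+ y. ennreal (hit_both K' n k x y * hit_both K m k x y) \<partial>count_space UNIV \<partial>count_space UNIV)"
      by (simp add: nn_integral_cmult nn_integral_multc measure_pmf.emeasure_eq_measure hit_both_def ennreal_mult)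
    also have "\<dots> \<le> (\<integral>\<^sup>+ x. \<integral>\<^sup>+ y. (ennreal ((?H' x * ?H' (y - x))\<^sup>2) + ennreal ((?H' y * ?H' (x - y))\<^sup>2))
         + (ennreal ((?H x * ?H (y - x))\<^sup>2) + ennreal ((?H y * ?H (x - y))\<^sup>2)) \<partial>count_space UNIV \<partial>count_space UNIV)"
    proof (intro nn_integral_mono)
      fix x y
      have le: "hit_both L l k x y \<le> hit_sum L N x * hit_sum L N (y - x) + hit_sum L N y * hit_sum L N (x - y)"
        if "l \<le> N" for l and L :: "'e \<Rightarrow> ('v \<times> 'e) pmf"
      proof -
        have h: "0 \<le> hit_sum L N z" for z unfolding hit_sum_def by (intro sum_nonneg hit_nonneg)
        have "hit_both L l k x y \<le> hit L l k x * hit_sum L N (y - x) + hit L l k y * hit_sum L N (x - y)"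
          by (rule hit_both_le_product[OF hit_le_hit_sum that])
        also have "\<dots> \<le> hit_sum L N x * hit_sum L N (y - x) + hit_sum L N y * hit_sum L N (x - y)"
          by (intro add_mono mult_right_mono hit_le_hit_sum that h)
        finally show ?thesis .
      qed
      have "hit_both K' n k x y * hit_both K m k x y \<le>
          ((?H' x * ?H' (y - x))\<^sup>2 + (?H' y * ?H' (x - y))\<^sup>2) + ((?H x * ?H (y - x))\<^sup>2 + (?H y * ?H (x - y))\<^sup>2)"
        by (rule product_le_convolution_squares[OF le[OF n(1)] le[OF n(2)]]) (rule hit_both_nonneg)+
      then show "ennreal (hit_both K' n k x y * hit_both K m k x y) \<le>
         (ennreal ((?H' x * ?H' (y - x))\<^sup>2) + ennreal ((?H' y * ?H' (x - y))\<^sup>2))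
         + (ennreal ((?H x * ?H (y - x))\<^sup>2) + ennreal ((?H y * ?H (x - y))\<^sup>2))"
        by (simp add: ennreal_leI flip: ennreal_plus)
    qed
    also have "\<dots> = ?W"
      by (simp add: nn_integral_add convolution_square_sum U_def U'_def)
    finally show ?thesis .
  qed
  have "(\<integral>\<^sup>+ u. ennreal ((real (card (fst u \<inter> snd u)))\<^sup>2) \<partial>two_sided K' K \<mu> n m) \<le> (\<integral>\<^sup>+ k. ?W \<partial>\<mu>)"
    unfolding two_sided_def nn_integral_bind_pmf by (rule nn_integral_mono) (rule per_state)
  then show ?thesis by (simp add: measure_pmf.emeasure_space_1[simplified])
qed

lemma variance_minimal:
  fixes f :: "'b \<Rightarrow> real"
  assumes f: "\<And>x. x \<in> set_pmf M \<Longrightarrow> \<bar>f x\<bar> \<le> B"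
  shows "\<E> M (\<lambda>x. (f x - \<E> M f)\<^sup>2) \<le> \<E> M (\<lambda>x. (f x - c)\<^sup>2)"
proof -
  let ?e = "\<E> M f"
  have i1: "integrable M f" by (rule integrable_pmf_support[where B = B]) (use f in auto)
  have i2: "integrable M (\<lambda>x. (f x - ?e)\<^sup>2)"
  proof (rule integrable_pmf_support[where B = "(B + \<bar>?e\<bar>)\<^sup>2"])
    fix x assume "x \<in> set_pmf M"
    from f[OF this] have "\<bar>f x - ?e\<bar> \<le> B + \<bar>?e\<bar>" by linarith
    then have "\<bar>f x - ?e\<bar>\<^sup>2 \<le> (B + \<bar>?e\<bar>)\<^sup>2" by (intro power_mono) auto
    then show "norm ((f x - ?e)\<^sup>2) \<le> (B + \<bar>?e\<bar>)\<^sup>2" by simp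
  qed
  have "(f x - c)\<^sup>2 = (f x - ?e)\<^sup>2 + (2 * (?e - c) * (f x - ?e) + (?e - c)\<^sup>2)" for x
    by (simp add: power2_eq_square algebra_simps)
  then have "\<E> M (\<lambda>x. (f x - c)\<^sup>2) =
      \<E> M (\<lambda>x. (f x - ?e)\<^sup>2 + (2 * (?e - c) * (f x - ?e) + (?e - c)\<^sup>2))"
    by simp
  also have "\<dots> = \<E> M (\<lambda>x. (f x - ?e)\<^sup>2) + (?e - c)\<^sup>2"
    using i1 i2 by simp
  finally show ?thesis by simp
qed

context dual_walks
begin

lemma stat_range_support:
  assumes "A \<in> set_pmf (bind_pmf \<mu> (range_pmf K n))"
  shows "finite A" "card A \<le> n + 1"
  using assms range_pmf_support by (auto dest: range_pmf_support)

lemma rev_stat_mean: "rev.stat_mean n = stat_mean n"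
proof -
  have "rev.stat_mean n = \<E> (map_pmf card (bind_pmf \<mu> (range_pmf K' n))) real"
    by (simp add: rev.stat_mean_eq)
  also have "\<dots> = stat_mean n"
    by (simp only: range_law_dual) (simp add: stat_mean_eq)
  finally show ?thesis .
qed

lemma stat_var_eq_law:
  "stat_var n = \<E> (map_pmf card (bind_pmf \<mu> (range_pmf K n))) (\<lambda>c. (real c - stat_mean n)\<^sup>2)"
  by (simp add: stat_var_def)

lemma stat_var_le:
  "stat_var n \<le> \<E> (map_pmf card (bind_pmf \<mu> (range_pmf K n))) (\<lambda>a. (real a - c)\<^sup>2)"
proof -
  have "stat_var n \<le> \<E> (bind_pmf \<mu> (range_pmf K n)) (\<lambda>A. (real (card A) - c)\<^sup>2)"
    unfolding stat_var_def stat_mean_eq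
  proof (rule variance_minimal[where B = "real (n + 1)"])
    fix A assume "A \<in> set_pmf (bind_pmf \<mu> (range_pmf K n))"
    from stat_range_support(2)[OF this] show "\<bar>real (card A)\<bar> \<le> real (n + 1)"
      by (simp only: abs_of_nat of_nat_le_iff)
  qed
  then show ?thesis by simp
qed

lemma stat_var_trivial: "stat_var n \<le> (real n + 1)\<^sup>2"
proof -
  have "stat_var n \<le> \<E> (bind_pmf \<mu> (range_pmf K n)) (\<lambda>A. (real (card A))\<^sup>2)"
    using stat_var_le[of n 0] by simp
  also have "\<dots> \<le> norm \<dots>" by simp
  also have "\<dots> \<le> (real n + 1)\<^sup>2"
  proof (rule norm_expectation_le)
    fix A assume "A \<in> set_pmf (bind_pmf \<mu> (range_pmf K n))"
    from stat_range_support(2)[OF this] have "real (card A) \<le> real n + 1" by linarith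
    then show "norm ((real (card A))\<^sup>2) \<le> (real n + 1)\<^sup>2" by (simp add: power_mono)
  qed
  finally show ?thesis .
qed

lemma two_sided_support:
  assumes "u \<in> set_pmf (two_sided K' K \<mu> n m)"
  shows "finite (fst u)" "finite (snd u)" "card (fst u) \<le> n + 1" "card (snd u) \<le> m + 1"
  using assms by (auto simp: two_sided_def dest: range_pmf_support)

lemma two_sided_fst: "map_pmf fst (two_sided K' K \<mu> n m) = bind_pmf \<mu> (range_pmf K' n)"
  and two_sided_snd: "map_pmf snd (two_sided K' K \<mu> n m) = bind_pmf \<mu> (range_pmf K m)"
  by (simp_all add: two_sided_def map_bind_pmf map_fst_pair_pmf map_snd_pair_pmf)

text \<open>
  Given the present state, past and future are independent, so only the deviations of the two
  conditional means contribute.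
\<close>

lemma two_sided_covariance:
  assumes D: "\<And>n j. \<bar>mean_range K n j - stat_mean n\<bar> \<le> D"
    and D': "\<And>n j. \<bar>mean_range K' n j - stat_mean n\<bar> \<le> D'"
  shows "\<E> (two_sided K' K \<mu> n m)
     (\<lambda>u. (real (card (fst u)) - stat_mean n) * (real (card (snd u)) - stat_mean m)) \<le> D' * D"
proof -
  let ?a = "\<lambda>A. real (card A) - stat_mean n" and ?b = "\<lambda>B. real (card B) - stat_mean m"
  let ?B = "(real n + 1 + \<bar>stat_mean n\<bar>) * (real m + 1 + \<bar>stat_mean m\<bar>)"
  have bound: "\<bar>?a A * ?b B\<bar> \<le> ?B" if "card A \<le> n + 1" "card B \<le> m + 1" for A B :: "(int ^ 2) set"
    unfolding abs_mult using that by (intro mult_mono) linarith+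
  have mean: "\<E> (range_pmf L l k) (\<lambda>A. real (card A) - c) = mean_range L l k - c"
    for L :: "'e \<Rightarrow> ((int ^ 2) \<times> 'e) pmf" and l k c
  proof -
    have "integrable (range_pmf L l k) (\<lambda>A. real (card A))"
      by (rule integrable_pmf_support[where B = "real (l + 1)"])
         (use range_pmf_support(3) in \<open>fastforce simp del: of_nat_add\<close>)
    then show ?thesis by (simp add: mean_range_def measure_pmf.prob_space)
  qed
  have "\<E> (two_sided K' K \<mu> n m) (\<lambda>u. ?a (fst u) * ?b (snd u))
      = \<E> \<mu> (\<lambda>k. \<E> (pair_pmf (range_pmf K' n k) (range_pmf K m k)) (\<lambda>u. ?a (fst u) * ?b (snd u)))"
    unfolding two_sided_def
  proof (rule expectation_bind_support)
    fix u assume "u \<in> set_pmf (bind_pmf \<mu> (\<lambda>k. pair_pmf (range_pmf K' n k) (range_pmf K m k)))"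
    then show "\<bar>?a (fst u) * ?b (snd u)\<bar> \<le> ?B"
      by (intro bound) (auto dest: range_pmf_support(3))
  qed
  also have "\<dots> = \<E> \<mu> (\<lambda>k. (mean_range K' n k - stat_mean n) * (mean_range K m k - stat_mean m))"
  proof (intro Bochner_Integration.integral_cong refl)
    fix k
    have "\<E> (pair_pmf (range_pmf K' n k) (range_pmf K m k)) (\<lambda>u. ?a (fst u) * ?b (snd u))
      = \<E> (range_pmf K' n k) (\<lambda>A. \<E> (bind_pmf (range_pmf K m k) (\<lambda>B. return_pmf (A, B))) (\<lambda>u. ?a (fst u) * ?b (snd u)))"
      unfolding pair_pmf_def
    proof (rule expectation_bind_support)
      fix u assume "u \<in> set_pmf (bind_pmf (range_pmf K' n k) (\<lambda>A. bind_pmf (range_pmf K m k) (\<lambda>B. return_pmf (A, B))))"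
      then show "\<bar>?a (fst u) * ?b (snd u)\<bar> \<le> ?B"
        by (intro bound) (auto dest: range_pmf_support(3))
    qed
    also have "\<dots> = (mean_range K' n k - stat_mean n) * (mean_range K m k - stat_mean m)"
      by (simp add: mean flip: map_pmf_def)
    finally show "\<E> (pair_pmf (range_pmf K' n k) (range_pmf K m k)) (\<lambda>u. ?a (fst u) * ?b (snd u))
      = (mean_range K' n k - stat_mean n) * (mean_range K m k - stat_mean m)" .
  qed
  also have "\<dots> \<le> norm \<dots>" by simp
  also have "\<dots> \<le> D' * D"
  proof (rule norm_expectation_le)
    fix k
    show "norm ((mean_range K' n k - stat_mean n) * (mean_range K m k - stat_mean m)) \<le> D' * D"
      unfolding real_norm_def abs_mult using D[of m k] D'[of n k] by (intro mult_mono) auto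
  qed
  finally show ?thesis .
qed

text \<open>
  The deviation is \<open>a + b - I\<close>, where \<open>a\<close> and \<open>b\<close> are the
  deviations of past and future and \<open>I\<close> is the number of common sites. Young's
  inequality separates \<open>I\<close> at the price of the factor \<open>3 / 2\<close>, which is
  small enough for \<open>dyadic_recursion\<close>.
\<close>

lemma stat_var_split:
  assumes D: "\<And>n j. \<bar>mean_range K n j - stat_mean n\<bar> \<le> D"
    and D': "\<And>n j. \<bar>mean_range K' n j - stat_mean n\<bar> \<le> D'"
    and W: "(\<integral>\<^sup>+ u. ennreal ((real (card (fst u \<inter> snd u)))\<^sup>2) \<partial>two_sided K' K \<mu> n m) \<le> ennreal W" "0 \<le> W"
  shows "stat_var (n + m) \<le> 3 / 2 * (stat_var n + stat_var m) + 3 * (D' * D) + 3 * W"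
proof -
  let ?P = "two_sided K' K \<mu> n m"
  let ?a = "\<lambda>u :: (int ^ 2) set \<times> (int ^ 2) set. real (card (fst u)) - stat_mean n"
  let ?b = "\<lambda>u :: (int ^ 2) set \<times> (int ^ 2) set. real (card (snd u)) - stat_mean m"
  let ?I = "\<lambda>u :: (int ^ 2) set \<times> (int ^ 2) set. real (card (fst u \<inter> snd u))"
  have sup: "\<bar>?a u\<bar> \<le> real n + 1 + \<bar>stat_mean n\<bar>" "\<bar>?b u\<bar> \<le> real m + 1 + \<bar>stat_mean m\<bar>" "\<bar>?I u\<bar> \<le> real n + 1"
    "real (card (fst u \<union> snd u)) = real (card (fst u)) + real (card (snd u)) - ?I u"
    if u: "u \<in> set_pmf ?P" for u
  proof -
    note s = two_sided_support[OF u]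
    show "\<bar>?a u\<bar> \<le> real n + 1 + \<bar>stat_mean n\<bar>" "\<bar>?b u\<bar> \<le> real m + 1 + \<bar>stat_mean m\<bar>"
      using s(3,4) by linarith+
    have "card (fst u \<inter> snd u) \<le> card (fst u)" using s(1) by (intro card_mono) auto
    then show "\<bar>?I u\<bar> \<le> real n + 1" using s(3) by linarith
    show "real (card (fst u \<union> snd u)) = real (card (fst u)) + real (card (snd u)) - ?I u"
      using card_Un_Int[OF s(1,2)] by linarith
  qed
  have sq: "\<bar>x * y\<bar> \<le> A * B" if "\<bar>x\<bar> \<le> A" "\<bar>y\<bar> \<le> B" for x y A B :: real
    unfolding abs_mult using that by (intro mult_mono) auto
  have ia: "integrable ?P (\<lambda>u. ?a u * ?a u)"
    by (rule integrable_pmf_support) (unfold real_norm_def, rule sq, (erule sup)+)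
  have ib: "integrable ?P (\<lambda>u. ?b u * ?b u)"
    by (rule integrable_pmf_support) (unfold real_norm_def, rule sq, (erule sup)+)
  have iab: "integrable ?P (\<lambda>u. ?a u * ?b u)"
    by (rule integrable_pmf_support) (unfold real_norm_def, rule sq, (erule sup)+)
  have iI: "integrable ?P (\<lambda>u. ?I u * ?I u)"
    by (rule integrable_pmf_support) (unfold real_norm_def, rule sq, (erule sup)+)
  let ?G = "\<lambda>u. 3 / 2 * (?a u * ?a u) + 3 / 2 * (?b u * ?b u) + 3 * (?a u * ?b u) + 3 * (?I u * ?I u)"
  have iG: "integrable ?P ?G"
    by (intro Bochner_Integration.integrable_add integrable_mult_right ia ib iab iI)
  \<comment> \<open>the difference of the two sides is \<open>(x + 2 * z)\<^sup>2 / 2\<close>\<close>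
  have young: "(x - z)\<^sup>2 \<le> 3 / 2 * x\<^sup>2 + 3 * z\<^sup>2" for x z :: real
    using zero_le_power2[of "x + 2 * z"] by (simp add: power2_eq_square algebra_simps)
  have "stat_var (n + m) \<le> \<E> ?P (\<lambda>u. (real (card (fst u \<union> snd u)) - (stat_mean n + stat_mean m))\<^sup>2)"
    using stat_var_le[of "n + m" "stat_mean n + stat_mean m"]
    unfolding two_sided_law[symmetric] by (simp add: case_prod_unfold)
  also have "\<dots> \<le> \<E> ?P ?G"
  proof (rule integral_mono_AE)
    have pt: "(real (card (fst u \<union> snd u)) - (stat_mean n + stat_mean m))\<^sup>2 \<le> ?G u" if "u \<in> set_pmf ?P" for u
    proof -
      have "(real (card (fst u \<union> snd u)) - (stat_mean n + stat_mean m))\<^sup>2 = ((?a u + ?b u) - ?I u)\<^sup>2"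
        unfolding sup(4)[OF that] by (simp add: algebra_simps)
      also have "\<dots> \<le> 3 / 2 * (?a u + ?b u)\<^sup>2 + 3 * (?I u)\<^sup>2" by (rule young)
      also have "\<dots> = ?G u" by (simp add: power2_eq_square algebra_simps)
      finally show ?thesis .
    qed
    then show "AE u in ?P. (real (card (fst u \<union> snd u)) - (stat_mean n + stat_mean m))\<^sup>2 \<le> ?G u"
      unfolding AE_measure_pmf_iff by (intro ballI pt)
    show "integrable ?P (\<lambda>u. (real (card (fst u \<union> snd u)) - (stat_mean n + stat_mean m))\<^sup>2)"
    proof (rule Bochner_Integration.integrable_bound[OF iG])
      show "AE u in ?P. norm ((real (card (fst u \<union> snd u)) - (stat_mean n + stat_mean m))\<^sup>2) \<le> norm (?G u)"
        unfolding AE_measure_pmf_iff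
      proof
        fix u assume "u \<in> set_pmf ?P"
        from order_trans[OF pt[OF this] abs_ge_self]
        show "norm ((real (card (fst u \<union> snd u)) - (stat_mean n + stat_mean m))\<^sup>2) \<le> norm (?G u)"
          unfolding real_norm_def abs_power2 .
      qed
    qed simp
  qed (rule iG)
  also have "\<dots> = 3 / 2 * \<E> ?P (\<lambda>u. ?a u * ?a u) + 3 / 2 * \<E> ?P (\<lambda>u. ?b u * ?b u)
      + 3 * \<E> ?P (\<lambda>u. ?a u * ?b u) + 3 * \<E> ?P (\<lambda>u. ?I u * ?I u)"
    by (simp only: Bochner_Integration.integral_add[OF Bochner_Integration.integrable_add[OF Bochner_Integration.integrable_add[OF integrable_mult_right[OF ia] integrable_mult_right[OF ib]] integrable_mult_right[OF iab]] integrable_mult_right[OF iI]]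
        Bochner_Integration.integral_add[OF Bochner_Integration.integrable_add[OF integrable_mult_right[OF ia] integrable_mult_right[OF ib]] integrable_mult_right[OF iab]]
        Bochner_Integration.integral_add[OF integrable_mult_right[OF ia] integrable_mult_right[OF ib]] integral_mult_right_zero)
  also have "\<E> ?P (\<lambda>u. ?a u * ?a u) = stat_var n"
  proof -
    have "\<E> ?P (\<lambda>u. ?a u * ?a u) = \<E> (map_pmf fst ?P) (\<lambda>A. (real (card A) - stat_mean n)\<^sup>2)"
      by (simp add: power2_eq_square)
    also have "\<dots> = \<E> (map_pmf card (bind_pmf \<mu> (range_pmf K' n))) (\<lambda>c. (real c - stat_mean n)\<^sup>2)"
      unfolding two_sided_fst by simp
    finally show ?thesis by (simp only: range_law_dual stat_var_eq_law)
  qed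
  also have "\<E> ?P (\<lambda>u. ?b u * ?b u) = stat_var m"
  proof -
    have "\<E> ?P (\<lambda>u. ?b u * ?b u) = \<E> (map_pmf snd ?P) (\<lambda>A. (real (card A) - stat_mean m)\<^sup>2)"
      by (simp add: power2_eq_square)
    then show ?thesis by (simp only: two_sided_snd stat_var_def)
  qed
  finally have "stat_var (n + m) \<le> 3 / 2 * stat_var n + 3 / 2 * stat_var m
      + 3 * \<E> ?P (\<lambda>u. ?a u * ?b u) + 3 * \<E> ?P (\<lambda>u. ?I u * ?I u)" .
  moreover have "\<E> ?P (\<lambda>u. ?a u * ?b u) \<le> D' * D"
    by (rule two_sided_covariance[OF D D'])
  moreover have "\<E> ?P (\<lambda>u. ?I u * ?I u) \<le> W"
  proof -
    have "ennreal (\<E> ?P (\<lambda>u. ?I u * ?I u)) = (\<integral>\<^sup>+ u. ennreal (?I u * ?I u) \<partial>?P)"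
      by (rule nn_integral_eq_integral[OF iI, symmetric]) simp
    also have "\<dots> \<le> ennreal W" using W(1) by (simp only: power2_eq_square)
    finally show ?thesis using W(2) by (simp add: ennreal_le_iff)
  qed
  ultimately show ?thesis unfolding distrib_left[of "3 / 2"] by linarith
qed

lemma stat_var_upper: "\<exists>B>0. \<forall>k N. N \<le> 2 ^ k \<longrightarrow> stat_var N \<le> B * 4 ^ k / (real k + 1) ^ 4"
proof -
  obtain D where D: "D \<ge> 0" "\<And>n j. \<bar>mean_range K n j - stat_mean n\<bar> \<le> D"
    using mean_range_near_stat_mean by blast
  obtain D' where D': "D' \<ge> 0" "\<And>n j. \<bar>mean_range K' n j - stat_mean n\<bar> \<le> D'"
    using rev.mean_range_near_stat_mean unfolding rev_stat_mean by blast
  obtain C where C: "C > 0" "\<And>k. (\<integral>\<^sup>+ x. ennreal ((hit_sum K (2 ^ k) x)\<^sup>2) \<partial>count_space UNIV) \<le> ennreal (C * 2 ^ k / (real k + 1)\<^sup>2)"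
    using hit_sum_square_sum by blast
  obtain C' where C': "C' > 0" "\<And>k. (\<integral>\<^sup>+ x. ennreal ((hit_sum K' (2 ^ k) x)\<^sup>2) \<partial>count_space UNIV) \<le> ennreal (C' * 2 ^ k / (real k + 1)\<^sup>2)"
    using rev.hit_sum_square_sum by blast
  let ?G = "6 * (C'\<^sup>2 + C\<^sup>2)"
  show ?thesis
  proof (rule dyadic_recursion[where F = "3 * (D' * D)" and G = ?G])
    fix k n m :: nat assume n: "n \<le> 2 ^ k" "m \<le> 2 ^ k"
    let ?c = "C * 2 ^ k / (real k + 1)\<^sup>2" and ?c' = "C' * 2 ^ k / (real k + 1)\<^sup>2"
    have pos: "0 \<le> ?c" "0 \<le> ?c'" using C(1) C'(1) by auto
    have "(\<integral>\<^sup>+ u. ennreal ((real (card (fst u \<inter> snd u)))\<^sup>2) \<partial>two_sided K' K \<mu> n m)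
        \<le> (ennreal ?c' * ennreal ?c' + ennreal ?c' * ennreal ?c') + (ennreal ?c * ennreal ?c + ennreal ?c * ennreal ?c)"
      by (rule order_trans[OF intersection_second_moment[OF n]]) (intro add_mono mult_mono C(2) C'(2) zero_le)
    also have "\<dots> = ennreal ((?c' * ?c' + ?c' * ?c') + (?c * ?c + ?c * ?c))"
      using pos by (simp only: ennreal_mult ennreal_plus mult_nonneg_nonneg add_nonneg_nonneg)
    also have "(?c' * ?c' + ?c' * ?c') + (?c * ?c + ?c * ?c) = 2 * (C'\<^sup>2 + C\<^sup>2) * 4 ^ k / (real k + 1) ^ 4"
    proof -
      have "(2 :: real) ^ k * 2 ^ k = 4 ^ k" by (simp flip: power_mult_distrib)
      then have "x * 2 ^ k / (real k + 1)\<^sup>2 * (x * 2 ^ k / (real k + 1)\<^sup>2) = x\<^sup>2 * 4 ^ k / (real k + 1) ^ 4" for x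
        by (simp add: power2_eq_square power4_eq_xxxx mult_ac)
      then show ?thesis by (simp add: add_divide_distrib distrib_left distrib_right)
    qed
    finally have W: "(\<integral>\<^sup>+ u. ennreal ((real (card (fst u \<inter> snd u)))\<^sup>2) \<partial>two_sided K' K \<mu> n m)
       \<le> ennreal (2 * (C'\<^sup>2 + C\<^sup>2) * 4 ^ k / (real k + 1) ^ 4)" .
    have "stat_var (n + m) \<le> 3 / 2 * (stat_var n + stat_var m) + 3 * (D' * D) + 3 * (2 * (C'\<^sup>2 + C\<^sup>2) * 4 ^ k / (real k + 1) ^ 4)"
      by (rule stat_var_split[OF D(2) D'(2) W]) simp
    moreover have "3 * (2 * x * y / z) = 6 * x * y / z" for x y z :: real by simp
    ultimately show "stat_var (n + m) \<le> 3 / 2 * (stat_var n + stat_var m) + 3 * (D' * D) + ?G * 4 ^ k / (real k + 1) ^ 4"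
      by (simp only:)
  qed (use D D' stat_var_trivial in auto)
qed

end

section \<open>Sums and expectations over countable types\<close>

lemma nn_integral_count_space_has_sum:
  fixes f :: "'b \<Rightarrow> real"
  assumes f: "(f has_sum s) UNIV" "\<And>x. 0 \<le> f x"
  shows "(\<integral>\<^sup>+ x. ennreal (f x) \<partial>count_space UNIV) = ennreal s"
proof -
  have "f summable_on UNIV" using f(1) by (rule has_sum_imp_summable)
  then have "(\<lambda>x. norm (f x)) summable_on UNIV" using f(2) by simp
  then have abs: "Infinite_Set_Sum.abs_summable_on f UNIV" by (simp only: abs_summable_equivalent)
  then have int: "integrable (count_space UNIV) f" by (simp only: Infinite_Set_Sum.abs_summable_on_def)
  have "(\<integral>\<^sup>+ x. ennreal (f x) \<partial>count_space UNIV) = ennreal (integral\<^sup>L (count_space UNIV) f)"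
    by (rule nn_integral_eq_integral[OF int]) (use f(2) in auto)
  also have "integral\<^sup>L (count_space UNIV) f = infsum f UNIV"
    using infsetsum_infsum[OF abs] by (simp only: infsetsum_def)
  also have "\<dots> = s" using f(1) by (rule infsumI)
  finally show ?thesis .
qed

lemma has_sum_pmf:
  fixes f :: "'b \<Rightarrow> real"
  assumes "integrable (measure_pmf q) f"
  shows "((\<lambda>u. pmf q u * f u) has_sum \<E> q f) UNIV"
proof -
  have int: "integrable (count_space UNIV) (\<lambda>u. pmf q u * f u)"
    using assms unfolding measure_pmf_eq_density by (subst (asm) integrable_density) auto
  then have abs: "Infinite_Set_Sum.abs_summable_on (\<lambda>u. pmf q u * f u) UNIV"
    by (simp only: Infinite_Set_Sum.abs_summable_on_def)
  then have "(\<lambda>u. norm (pmf q u * f u)) summable_on UNIV"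
    by (simp only: abs_summable_equivalent)
  then have "(\<lambda>u. pmf q u * f u) summable_on UNIV" by (rule abs_summable_summable)
  then have "((\<lambda>u. pmf q u * f u) has_sum (infsum (\<lambda>u. pmf q u * f u) UNIV)) UNIV" by (rule has_sum_infsum)
  also have "infsum (\<lambda>u. pmf q u * f u) UNIV = integral\<^sup>L (count_space UNIV) (\<lambda>u. pmf q u * f u)"
    using infsetsum_infsum[OF abs] by (simp only: infsetsum_def)
  also have "\<dots> = \<E> q f"
    unfolding measure_pmf_eq_density by (subst integral_density) auto
  finally show ?thesis .
qed

lemma has_sum_pmf_slice:
  fixes g :: "'v \<Rightarrow> real"
  assumes "integrable (measure_pmf q) (\<lambda>u. g (fst u))"
  shows "((\<lambda>y. g y * pmf q (y, k)) has_sum \<E> q (\<lambda>u. g (fst u) * indicator {u. snd u = k} u)) UNIV"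
proof -
  let ?f = "\<lambda>u. g (fst u) * indicator {u. snd u = k} u"
  have "integrable (measure_pmf q) ?f"
    by (rule Bochner_Integration.integrable_bound[OF assms]) (auto simp: indicator_def)
  from has_sum_pmf[OF this]
  have "((\<lambda>u. pmf q u * ?f u) has_sum \<E> q ?f) UNIV" .
  also have "?this \<longleftrightarrow> ((\<lambda>u. pmf q u * ?f u) has_sum \<E> q ?f) ((\<lambda>y. (y, k)) ` UNIV)"
    by (rule has_sum_cong_neutral) (auto simp: indicator_def)
  also have "\<dots> \<longleftrightarrow> ((\<lambda>y. g y * pmf q (y, k)) has_sum \<E> q ?f) UNIV"
    by (subst has_sum_reindex) (auto simp: inj_on_def o_def mult.commute)
  finally show ?thesis .
qed

lemma has_sum_matrix:
  fixes f :: "'b \<Rightarrow> real ^ 'm ^ 'n"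
  assumes "\<And>j k. ((\<lambda>y. f y $ j $ k) has_sum S j k) A"
  shows "(f has_sum (\<chi> j k. S j k)) A"
  unfolding has_sum_def
proof (intro vec_tendstoI)
  fix j k
  show "((\<lambda>F. sum f F $ j $ k) \<longlongrightarrow> (\<chi> j k. S j k) $ j $ k) (finite_subsets_at_top A)"
    using assms[of j k] by (simp add: has_sum_def)
qed

section \<open>The kernel given by the transition weights\<close>

text \<open>
  The reversed kernel is given by Bayes' formula.
\<close>

lemma dual_kernel_exists:
  fixes K :: "'e::finite \<Rightarrow> ('v::ab_group_add \<times> 'e) pmf"
  assumes pos: "\<And>j. 0 < pmf \<mu> j" and stat: "map_pmf (\<lambda>v. snd (snd v)) (joint K \<mu>) = \<mu>"
  shows "\<exists>K'. joint K' \<mu> = map_pmf (\<lambda>(j, y, k). (k, - y, j)) (joint K \<mu>)"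
proof -
  \<comment> \<open>the conditional law of the preceding state and the reversed step, given the state
    \<open>k\<close> afterwards\<close>
  define w where "w k u = pmf (joint K \<mu>) (snd u, - fst u, k) / pmf \<mu> k" for k and u :: "'v \<times> 'e"
  have w: "\<And>u. 0 \<le> w k u" "(\<integral>\<^sup>+ u. ennreal (w k u) \<partial>count_space UNIV) = 1" for k
  proof -
    show "0 \<le> w k u" for u by (simp add: w_def)
    let ?h = "\<lambda>u :: 'v \<times> 'e. (snd u, - fst u, k)"
    have inj: "inj ?h" by (auto simp: inj_on_def prod_eq_iff)
    have range: "range ?h = {v. snd (snd v) = k}"
      by (force simp: image_iff prod_eq_iff intro: exI[of _ "- y" for y])
    have "(\<integral>\<^sup>+ u. ennreal (w k u) \<partial>count_space UNIV)
        = (\<integral>\<^sup>+ u. ennreal (pmf (joint K \<mu>) (?h u)) * ennreal (1 / pmf \<mu> k) \<partial>count_space UNIV)"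
      by (intro nn_integral_cong) (simp add: w_def divide_inverse ennreal_mult)
    also have "\<dots> = emeasure (joint K \<mu>) (range ?h) * ennreal (1 / pmf \<mu> k)"
      by (simp only: nn_integral_multc borel_measurable_count_space nn_integral_pmf'[OF inj])
    also have "emeasure (joint K \<mu>) (range ?h) = ennreal (pmf (map_pmf (\<lambda>v. snd (snd v)) (joint K \<mu>)) k)"
      unfolding range by (simp add: pmf_map vimage_def measure_pmf.emeasure_eq_measure)
    also have "\<dots> * ennreal (1 / pmf \<mu> k) = 1"
      unfolding stat using pos[of k] by (simp flip: ennreal_mult)
    finally show "(\<integral>\<^sup>+ u. ennreal (w k u) \<partial>count_space UNIV) = 1" .
  qed
  define K' where "K' k = embed_pmf (w k)" for k
  have K': "pmf (K' k) u = w k u" for k u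
    unfolding K'_def by (rule pmf_embed_pmf) (use w in auto)
  have pj: "pmf (joint L \<mu>) (j, u) = pmf \<mu> j * pmf (L j) u" for L :: "'e \<Rightarrow> ('v \<times> 'e) pmf" and j u
  proof -
    have "pmf (map_pmf (\<lambda>(y, k). (i, y, k)) (L i)) (j, u) = (if i = j then pmf (L i) u else 0)" for i
    proof -
      have "(\<lambda>(y, k). (i, y, k)) -` {(j, u)} = (if i = j then {u} else {})" by (auto split: if_splits)
      then show ?thesis by (simp add: pmf_map pmf.rep_eq)
    qed
    then have "pmf (joint L \<mu>) (j, u) = (\<Sum>i\<in>UNIV. pmf \<mu> i * (if i = j then pmf (L i) u else 0))"
      unfolding joint_def pmf_bind by (subst integral_measure_pmf[of UNIV]) auto
    also have "\<dots> = pmf \<mu> j * pmf (L j) u"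
      by (subst sum.remove[of _ j]) auto
    finally show ?thesis .
  qed
  have "joint K' \<mu> = map_pmf (\<lambda>(j, y, k). (k, - y, j)) (joint K \<mu>)"
  proof (rule pmf_eqI)
    fix v :: "'e \<times> 'v \<times> 'e"
    obtain k y j where v: "v = (k, y, j)" by (cases v)
    have "(\<lambda>(j, y, k). (k, - y, j)) -` {v} = {(j, - y, k)}" unfolding v by auto
    then have "pmf (map_pmf (\<lambda>(j, y, k). (k, - y, j)) (joint K \<mu>)) v = pmf (joint K \<mu>) (j, - y, k)"
      by (simp add: pmf_map pmf.rep_eq)
    then show "pmf (joint K' \<mu>) v = pmf (map_pmf (\<lambda>(j, y, k). (k, - y, j)) (joint K \<mu>)) v"
      using pos[of k] by (simp add: v pj[of K'] K' w_def)
  qed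
  then show ?thesis by blast
qed

lemma walk_pmf_snoc:
  assumes "(z, i) \<in> set_pmf (walk_pmf K n j)" "(y, k) \<in> set_pmf (K i)"
  shows "(z + y, k) \<in> set_pmf (walk_pmf K (Suc n) j)"
  using assms(1)
proof (induction n arbitrary: z j)
  case 0
  then show ?case using assms(2) by force
next
  case (Suc n)
  then obtain a l b where a: "(a, l) \<in> set_pmf (K j)" "(b, i) \<in> set_pmf (walk_pmf K n l)" "z = a + b"
    by auto
  from Suc.IH[OF a(2)] a(1) have "(a + (b + y), k) \<in> set_pmf (walk_pmf K (Suc (Suc n)) j)"
    by (subst walk_pmf.simps(2)) force
  then show ?case using a(3) by (simp add: add.assoc)
qed

definition kernel_of :: "(int ^ 'd \<Rightarrow> 'e::finite \<Rightarrow> 'e \<Rightarrow> real) \<Rightarrow> 'e \<Rightarrow> ((int ^ 'd) \<times> 'e) pmf" where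
  "kernel_of p j = embed_pmf (\<lambda>(y, k). p y j k)"

lemma pmf_kernel_of:
  assumes "transition_weights p"
  shows "pmf (kernel_of p j) (y, k) = p y j k"
proof -
  have nonneg: "0 \<le> p y j k" for y k using assms by (simp add: transition_weights_def)
  have "((\<lambda>(y, k). p y j k) has_sum 1) UNIV" using assms by (simp add: transition_weights_def)
  from nn_integral_count_space_has_sum[OF this]
  have "(\<integral>\<^sup>+ u. ennreal (case u of (y, k) \<Rightarrow> p y j k) \<partial>count_space UNIV) = 1"
    using nonneg by auto
  then show ?thesis
    unfolding kernel_of_def by (subst pmf_embed_pmf) (use nonneg in auto)
qed

text \<open>
  The steps of \<open>nstep\<close> are appended at the end, those of \<open>walk_pmf\<close> at
  the front; only the supports have to be compared.
\<close>

lemma nstep_support: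
  assumes p: "transition_weights p" and "nstep p n (x, j) (x + z, k) \<noteq> 0"
  shows "(z, k) \<in> set_pmf (walk_pmf (kernel_of p) n j)"
  using assms(2)
proof (induction n arbitrary: z k)
  case 0
  then show ?case by (simp split: if_splits)
next
  case (Suc n)
  have "\<exists>w. nstep p n (x, j) w * p (x + z - fst w) (snd w) k \<noteq> 0"
  proof (rule ccontr)
    assume "\<not> ?thesis"
    then have "(\<Sum>\<^sub>\<infinity>w\<in>UNIV. nstep p n (x, j) w * p (x + z - fst w) (snd w) k) = 0"
      by (intro infsum_0) blast
    then show False using Suc.prems by simp
  qed
  then obtain a i where a: "nstep p n (x, j) (a, i) \<noteq> 0" "p (x + z - a) i k \<noteq> 0" by auto
  have "(a - x, i) \<in> set_pmf (walk_pmf (kernel_of p) n j)"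
    by (rule Suc.IH) (use a in simp)
  moreover have "(x + z - a, k) \<in> set_pmf (kernel_of p i)"
    using a(2) by (simp add: set_pmf_iff pmf_kernel_of[OF p])
  ultimately have "(a - x + (x + z - a), k) \<in> set_pmf (walk_pmf (kernel_of p) (Suc n) j)"
    by (rule walk_pmf_snoc)
  then show ?case by simp
qed

lemma group_closure_mono:
  assumes "S \<subseteq> T" shows "group_closure S \<subseteq> group_closure T"
proof
  fix x assume "x \<in> group_closure S"
  then show "x \<in> group_closure T"
    by induction (use assms in \<open>auto intro: group_closure.intros\<close>)
qed

lemma trivial_arithmetic_decay:
  fixes p :: "int ^ 2 \<Rightarrow> 'e::finite \<Rightarrow> 'e \<Rightarrow> real"
  assumes p: "transition_weights p" and t: "trivial_arithmetic p"
  shows "\<exists>C c. fourier_decay (kernel_of p) C c"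
proof -
  have "group_closure {y - y' | y y'. \<exists>n k. (y, k) \<in> set_pmf (walk_pmf (kernel_of p) n j) \<and>
                 (y', k) \<in> set_pmf (walk_pmf (kernel_of p) n j)} = UNIV" (is "group_closure ?T = UNIV") for j
  proof -
    let ?S = "{y - y' | y y'. \<exists>n\<ge>1. nstep p n (0, j) (y, j) > 0 \<and> nstep p n (0, j) (y', j) > 0}"
    have "?S \<subseteq> ?T"
    proof
      fix d assume "d \<in> ?S"
      then obtain y y' n where d: "d = y - y'" "nstep p n (0, j) (y, j) > 0" "nstep p n (0, j) (y', j) > 0" by blast
      have "(y, j) \<in> set_pmf (walk_pmf (kernel_of p) n j)" "(y', j) \<in> set_pmf (walk_pmf (kernel_of p) n j)"
        using nstep_support[OF p, of n 0 j y j] nstep_support[OF p, of n 0 j y' j] d by simp_all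
      then show "d \<in> ?T" using d(1) by blast
    qed
    from group_closure_mono[OF this] show ?thesis using t by (auto simp: trivial_arithmetic_def)
  qed
  from fourier_decay_exists[OF this] show ?thesis by blast
qed

lemma Q_mat_entry:
  fixes p :: "int ^ 'd \<Rightarrow> 'e::finite \<Rightarrow> 'e \<Rightarrow> real"
  assumes p: "transition_weights p"
  shows "Q_mat p $ j $ k = measure_pmf.prob (kernel_of p j) {u. snd u = k}"
proof -
  have "((\<lambda>y. 1 * pmf (kernel_of p j) (y, k)) has_sum
      \<E> (kernel_of p j) (\<lambda>u. 1 * indicator {u. snd u = k} u)) UNIV" for j k
    by (rule has_sum_pmf_slice) simp
  then have "((\<lambda>y. A_mat p y $ j $ k) has_sum measure_pmf.prob (kernel_of p j) {u. snd u = k}) UNIV" for j k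
    by (simp add: A_mat_def pmf_kernel_of[OF p])
  from infsumI[OF has_sum_matrix[OF this]] show ?thesis by (simp add: Q_mat_def)
qed

lemma edges_kernel_of:
  assumes p: "transition_weights p" and "Q_mat p $ j $ k \<noteq> 0"
  shows "(j, k) \<in> edges (kernel_of p)"
proof -
  have "measure_pmf.prob (kernel_of p j) {u. snd u = k} \<noteq> 0" using assms Q_mat_entry by metis
  then have "set_pmf (kernel_of p j) \<inter> {u. snd u = k} \<noteq> {}"
    by (metis measure_Int_set_pmf measure_empty inf_commute)
  then show ?thesis by (auto simp: edges_def)
qed

lemma mat_power_edges:
  assumes p: "transition_weights p" and "mat_power (Q_mat p) n $ j $ k \<noteq> 0"
  shows "(j, k) \<in> (edges (kernel_of p))\<^sup>*"
  using assms(2)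
proof (induction n arbitrary: k)
  case 0
  then show ?case by (simp add: mat_def split: if_splits)
next
  case (Suc n)
  then have "(\<Sum>i\<in>UNIV. mat_power (Q_mat p) n $ j $ i * Q_mat p $ i $ k) \<noteq> 0"
    by (simp add: matrix_matrix_mult_def)
  then obtain i where "mat_power (Q_mat p) n $ j $ i * Q_mat p $ i $ k \<noteq> 0"
    by (meson sum.neutral)
  then have "mat_power (Q_mat p) n $ j $ i \<noteq> 0" "Q_mat p $ i $ k \<noteq> 0" by auto
  from Suc.IH[OF this(1)] edges_kernel_of[OF p this(2)] show ?case by (rule rtrancl_into_rtrancl)
qed

lemma component_le_norm_real_vec: "\<bar>real_of_int (y $ l)\<bar> \<le> norm (real_vec y)"
  using component_le_norm_cart[of "real_vec y" l] by (simp add: real_vec_def)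

lemma moment_integrable:
  fixes p :: "int ^ 'd::finite \<Rightarrow> 'e::finite \<Rightarrow> 'e \<Rightarrow> real"
  assumes p: "transition_weights p" and m: "moment_converges p r"
  shows "integrable (kernel_of p j) (\<lambda>u. real_of_int (fst u $ l) ^ r)"
proof (rule integrableI_bounded)
  let ?N = "\<lambda>y. norm (real_vec y) ^ r"
  have p0: "0 \<le> p y j k" for y k using p by (simp add: transition_weights_def)
  have fin: "(\<integral>\<^sup>+ y. ennreal (?N y * p y j k) \<partial>count_space UNIV) < \<top>" for k
  proof -
    obtain S where "((\<lambda>y. ?N y *\<^sub>R A_mat p y) has_sum S) UNIV"
      using m unfolding moment_converges_def summable_on_def by blast
    then have "((\<lambda>F. (\<Sum>y\<in>F. ?N y *\<^sub>R A_mat p y) $ j $ k) \<longlongrightarrow> S $ j $ k) (finite_subsets_at_top UNIV)"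
      unfolding has_sum_def by (intro tendsto_vec_nth)
    then have "((\<lambda>y. ?N y * p y j k) has_sum S $ j $ k) UNIV"
      by (simp add: has_sum_def A_mat_def)
    from nn_integral_count_space_has_sum[OF this] p0 show ?thesis by simp
  qed
  have "(\<integral>\<^sup>+ u. ennreal (norm (real_of_int (fst u $ l) ^ r)) \<partial>kernel_of p j)
      \<le> (\<integral>\<^sup>+ u. ennreal (?N (fst u) * p (fst u) j (snd u)) \<partial>count_space UNIV)"
    unfolding nn_integral_measure_pmf
  proof (rule nn_integral_mono)
    fix u :: "(int ^ 'd) \<times> 'e"
    have "norm (real_of_int (fst u $ l) ^ r) \<le> ?N (fst u)"
      unfolding real_norm_def power_abs by (intro power_mono component_le_norm_real_vec) simp
    then have "p (fst u) j (snd u) * norm (real_of_int (fst u $ l) ^ r) \<le> p (fst u) j (snd u) * ?N (fst u)"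
      by (rule mult_left_mono) (rule p0)
    moreover have "pmf (kernel_of p j) u = p (fst u) j (snd u)"
      using pmf_kernel_of[OF p, of j "fst u" "snd u"] by simp
    ultimately have "pmf (kernel_of p j) u * norm (real_of_int (fst u $ l) ^ r) \<le> ?N (fst u) * p (fst u) j (snd u)"
      by (simp only: mult.commute[of "?N (fst u)"])
    then show "ennreal (pmf (kernel_of p j) u) * ennreal (norm (real_of_int (fst u $ l) ^ r))
        \<le> ennreal (?N (fst u) * p (fst u) j (snd u))"
      by (simp add: ennreal_leI flip: ennreal_mult)
  qed
  also have "\<dots> = (\<integral>\<^sup>+ y. \<integral>\<^sup>+ k. ennreal (?N y * p y j k) \<partial>count_space UNIV \<partial>count_space UNIV)"
    by (subst nn_integral_fst_count_space[symmetric]) simp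
  also have "\<dots> = (\<integral>\<^sup>+ y. (\<Sum>k\<in>UNIV. ennreal (?N y * p y j k)) \<partial>count_space UNIV)"
    by (simp add: nn_integral_count_space_finite)
  also have "\<dots> = (\<Sum>k\<in>UNIV. \<integral>\<^sup>+ y. ennreal (?N y * p y j k) \<partial>count_space UNIV)"
    by (rule nn_integral_sum) simp
  also have "\<dots> < \<top>" using fin by (simp add: ennreal_sum_less_top)
  finally show "(\<integral>\<^sup>+ u. ennreal (norm (real_of_int (fst u $ l) ^ r)) \<partial>kernel_of p j) < \<infinity>" by simp
qed simp

text \<open>
  The entries of the matrix are lattice sums over the steps ending in a fixed state, that is,
  restricted expectations; summing over that state gives the mean displacement.
\<close>

lemma M_mat_mean:
  fixes p :: "int ^ 'd::finite \<Rightarrow> 'e::finite \<Rightarrow> 'e \<Rightarrow> real"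
  assumes p: "transition_weights p" and int: "\<And>j. integrable (kernel_of p j) (\<lambda>u. real_of_int (fst u $ l))"
  shows "(M_mat p l *v 1) $ j = \<E> (kernel_of p j) (\<lambda>u. real_of_int (fst u $ l))"
proof -
  let ?E = "\<lambda>j k. \<E> (kernel_of p j) (\<lambda>u. real_of_int (fst u $ l) * indicator {u. snd u = k} u)"
  have "((\<lambda>y. (real_of_int (y $ l) *\<^sub>R A_mat p y) $ j $ k) has_sum ?E j k) UNIV" for j k
    using has_sum_pmf_slice[OF int, of j k] by (simp add: A_mat_def pmf_kernel_of[OF p])
  from infsumI[OF has_sum_matrix[OF this]]
  have M: "M_mat p l $ j $ k = ?E j k" for k by (simp add: M_mat_def)
  have i: "integrable (kernel_of p j) (\<lambda>u. real_of_int (fst u $ l) * indicator {u. snd u = k} u)" for k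
    by (rule Bochner_Integration.integrable_bound[OF int[of j]]) (auto simp: indicator_def)
  have "(M_mat p l *v 1) $ j = (\<Sum>k\<in>UNIV. ?E j k)"
    by (simp add: matrix_vector_mult_def M)
  also have "\<dots> = \<E> (kernel_of p j) (\<lambda>u. \<Sum>k\<in>UNIV. real_of_int (fst u $ l) * indicator {u. snd u = k} u)"
    by (rule Bochner_Integration.integral_sum[symmetric]) (rule i)
  also have "\<dots> = \<E> (kernel_of p j) (\<lambda>u. real_of_int (fst u $ l))"
  proof (intro Bochner_Integration.integral_cong refl)
    fix u :: "(int ^ 'd) \<times> 'e"
    have "(\<Sum>k\<in>UNIV. real_of_int (fst u $ l) * indicator {u. snd u = k} u) = (\<Sum>k\<in>UNIV. if k = snd u then real_of_int (fst u $ l) else 0)"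
      by (intro sum.cong refl) (auto simp: indicator_def)
    then show "(\<Sum>k\<in>UNIV. real_of_int (fst u $ l) * indicator {u. snd u = k} u) = real_of_int (fst u $ l)"
      by simp
  qed
  finally show ?thesis .
qed

text \<open>
  A stationary law charges some state, hence every state reachable from it, so Bayes' formula
  applies.
\<close>

lemma dual_walks_exists:
  fixes p :: "int ^ 2 \<Rightarrow> 'e::finite \<Rightarrow> 'e \<Rightarrow> real" and m :: "real ^ 'e"
  assumes p: "transition_weights p" and b: "basic_assumptions p m" and m4: "moment_converges p 4"
  shows "\<exists>K' \<mu>. dual_walks (kernel_of p) K' \<mu>"
proof -
  let ?K = "kernel_of p"
  have irr: "(j, k) \<in> (edges ?K)\<^sup>*" for j k
    using b mat_power_edges[OF p] unfolding basic_assumptions_def irreducible_chain_def by (metis less_irrefl)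
  have m: "\<And>j. 0 \<le> m $ j" "(\<Sum>j\<in>UNIV. m $ j) = 1" "m v* Q_mat p = m"
    using b by (auto simp: basic_assumptions_def stationary_distribution_def)
  have mQ: "m $ k = (\<Sum>j\<in>UNIV. m $ j * Q_mat p $ j $ k)" for k
  proof -
    have "m $ k = (m v* Q_mat p) $ k" by (simp only: m(3))
    then show ?thesis by (simp add: vector_matrix_mult_def mult.commute)
  qed
  have mpos: "0 < m $ k" for k
  proof -
    have "\<exists>j. 0 < m $ j"
    proof (rule ccontr)
      assume "\<not> ?thesis"
      then have "m $ j = 0" for j using m(1)[of j] by (auto simp: not_less intro: antisym)
      then show False using m(2) by simp
    qed
    then obtain j where j: "0 < m $ j" by blast
    from irr[of j k] show ?thesis
    proof induction
      case (step i k)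
      have "0 < Q_mat p $ i $ k"
      proof -
        obtain y where "(y, k) \<in> set_pmf (?K i)" using step.hyps(2) by (auto simp: edges_def)
        then have "0 < pmf (?K i) (y, k)" by (simp add: pmf_positive_iff)
        also have "\<dots> \<le> measure_pmf.prob (?K i) {u. snd u = k}"
          unfolding pmf.rep_eq by (rule measure_pmf.finite_measure_mono) auto
        finally show ?thesis by (simp add: Q_mat_entry[OF p])
      qed
      then have "0 < m $ i * Q_mat p $ i $ k" using step.IH by simp
      also have "\<dots> \<le> (\<Sum>j\<in>UNIV. m $ j * Q_mat p $ j $ k)"
        by (rule member_le_sum) (use m(1) in \<open>auto simp: Q_mat_entry[OF p]\<close>)
      finally show ?case by (simp add: mQ[of k])
    qed (rule j)
  qed
  define \<mu> where "\<mu> = embed_pmf (\<lambda>j. m $ j)"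
  have \<mu>: "pmf \<mu> j = m $ j" for j
    unfolding \<mu>_def
    by (rule pmf_embed_pmf) (use m in \<open>auto simp: nn_integral_count_space_finite sum_ennreal\<close>)
  have pos: "0 < pmf \<mu> j" for j by (simp add: \<mu> mpos)
  have stat: "map_pmf (\<lambda>v. snd (snd v)) (joint ?K \<mu>) = \<mu>"
  proof (rule pmf_eqI)
    fix k
    have "pmf (map_pmf (\<lambda>v. snd (snd v)) (joint ?K \<mu>)) k = measure_pmf.prob (joint ?K \<mu>) {v. snd (snd v) = k}"
      by (simp add: pmf_map vimage_def)
    also have "\<dots> = (\<Sum>j\<in>UNIV. pmf \<mu> j * measure_pmf.prob (?K j) {u. snd u = k})"
      unfolding joint_def prob_bind_pmf
      by (subst integral_measure_pmf[of UNIV]) (auto simp: vimage_def case_prod_unfold)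
    also have "\<dots> = pmf \<mu> k" by (simp add: \<mu> Q_mat_entry[OF p, symmetric] mQ[of k, symmetric])
    finally show "pmf (map_pmf (\<lambda>v. snd (snd v)) (joint ?K \<mu>)) k = pmf \<mu> k" .
  qed
  obtain K' where K': "joint K' \<mu> = map_pmf (\<lambda>(j, y, k). (k, - y, j)) (joint ?K \<mu>)"
    using dual_kernel_exists[OF pos stat] by blast
  have i4: "integrable (?K j) (\<lambda>u. real_of_int (fst u $ l) ^ 4)" for j l
    by (rule moment_integrable[OF p m4])
  have i1: "integrable (?K j) (\<lambda>u. real_of_int (fst u $ l))" for j l
  proof (rule Bochner_Integration.integrable_bound)
    show "integrable (?K j) (\<lambda>u. 1 + real_of_int (fst u $ l) ^ 4)"
      by (intro Bochner_Integration.integrable_add i4) simp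
    have "\<bar>x\<bar> \<le> \<bar>1 + x ^ 4\<bar>" for x :: real
      using power_le_one_plus_power[of 1 4 x] by simp
    then show "AE u in ?K j. norm (real_of_int (fst u $ l)) \<le> norm (1 + real_of_int (fst u $ l) ^ 4)"
      unfolding real_norm_def by (intro AE_I2)
  qed simp
  have "dual_walks ?K K' \<mu>"
  proof
    show "0 < pmf \<mu> j" for j by (rule pos)
    show "joint K' \<mu> = map_pmf (\<lambda>(j, y, k). (k, - y, j)) (joint ?K \<mu>)" by (rule K')
    show "(j, k) \<in> (edges ?K)\<^sup>*" for j k by (rule irr)
    show "integrable (joint ?K \<mu>) (\<lambda>(j, y, k). real_of_int (y $ l) ^ 4)" for l
      unfolding integrable_joint_iff[OF pos] using i4 by (simp add: case_prod_unfold)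
    show "\<E> (joint ?K \<mu>) (\<lambda>(j, y, k). real_of_int (y $ l)) = 0" for l
    proof -
      have "integrable (joint ?K \<mu>) (\<lambda>(j, y, k). real_of_int (y $ l))"
        unfolding integrable_joint_iff[OF pos] using i1 by (simp add: case_prod_unfold)
      from expectation_joint[OF pos this]
      have "\<E> (joint ?K \<mu>) (\<lambda>(j, y, k). real_of_int (y $ l))
         = (\<Sum>j\<in>UNIV. m $ j * (M_mat p l *v 1) $ j)"
        by (simp add: case_prod_unfold \<mu> M_mat_mean[OF p i1])
      also have "\<dots> = m \<bullet> (M_mat p l *v 1)" by (simp add: inner_vec_def)
      also have "\<dots> = 0" using b by (simp add: basic_assumptions_def)
      finally show ?thesis .
    qed
    show "\<exists>C c. fourier_decay ?K C c"
      by (rule trivial_arithmetic_decay[OF p]) (use b in \<open>simp add: basic_assumptions_def\<close>)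
  qed
  then show ?thesis by blast
qed

section \<open>The law of the process\<close>

text \<open>
  Trajectories with the most recent state at the head, which is the order in which the Markov
  property extends them.
\<close>

primrec history_pmf :: "('e \<Rightarrow> ('v::ab_group_add \<times> 'e) pmf) \<Rightarrow> nat \<Rightarrow> 'v \<times> 'e \<Rightarrow> ('v \<times> 'e) list pmf" where
  "history_pmf K 0 u = return_pmf [u]"
| "history_pmf K (Suc n) u =
     bind_pmf (history_pmf K n u) (\<lambda>h. map_pmf (\<lambda>v. (fst (hd h) + fst v, snd v) # h) (K (snd (hd h))))"

lemma history_pmf_nonempty: "h \<in> set_pmf (history_pmf K n u) \<Longrightarrow> h \<noteq> []"
  by (cases n) auto

text \<open>
  The first step can be split off as well; this links trajectories, extended at the end, with
  \<open>range_pmf\<close>, extended at the front.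
\<close>

lemma history_pmf_front:
  "history_pmf K (Suc n) u =
     bind_pmf (K (snd u)) (\<lambda>v. map_pmf (\<lambda>h. h @ [u]) (history_pmf K n (fst u + fst v, snd v)))"
proof (induction n)
  case 0
  show ?case by (simp add: bind_return_pmf map_pmf_def)
next
  case (Suc n)
  let ?ext = "\<lambda>h. map_pmf (\<lambda>v. (fst (hd h) + fst v, snd v) # h) (K (snd (hd h)))"
  have "history_pmf K (Suc (Suc n)) u = bind_pmf (history_pmf K (Suc n) u) ?ext"
    by (rule history_pmf.simps(2))
  also have "\<dots> = bind_pmf (K (snd u)) (\<lambda>v. bind_pmf (history_pmf K n (fst u + fst v, snd v)) (\<lambda>h. ?ext (h @ [u])))"
    unfolding Suc.IH by (simp add: bind_assoc_pmf bind_map_pmf)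
  also have "\<dots> = bind_pmf (K (snd u)) (\<lambda>v. bind_pmf (history_pmf K n (fst u + fst v, snd v)) (\<lambda>h. map_pmf (\<lambda>h. h @ [u]) (?ext h)))"
    by (intro bind_pmf_cong_support) (simp add: history_pmf_nonempty map_pmf_comp)
  also have "\<dots> = bind_pmf (K (snd u)) (\<lambda>v. map_pmf (\<lambda>h. h @ [u]) (history_pmf K (Suc n) (fst u + fst v, snd v)))"
    by (simp add: map_bind_pmf)
  finally show ?case .
qed

lemma history_sites:
  "map_pmf (\<lambda>h. fst ` set h) (history_pmf K n (x, j)) = map_pmf (\<lambda>A. (+) x ` A) (range_pmf K n j)"
proof (induction n arbitrary: x j)
  case (Suc n)
  have "map_pmf (\<lambda>h. fst ` set h) (history_pmf K (Suc n) (x, j)) =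
     bind_pmf (K j) (\<lambda>v. map_pmf (insert x) (map_pmf (\<lambda>h. fst ` set h) (history_pmf K n (x + fst v, snd v))))"
    unfolding history_pmf_front by (simp add: map_bind_pmf map_pmf_comp)
  also have "\<dots> = bind_pmf (K j) (\<lambda>v. map_pmf (\<lambda>A. (+) x ` insert 0 ((+) (fst v) ` A)) (range_pmf K n (snd v)))"
    unfolding Suc.IH by (simp add: map_pmf_comp image_image add.assoc)
  also have "\<dots> = map_pmf (\<lambda>A. (+) x ` A) (range_pmf K (Suc n) j)"
    by (simp add: map_bind_pmf map_pmf_comp case_prod_unfold)
  finally show ?case .
qed simp

primrec history :: "(nat \<Rightarrow> 'a \<Rightarrow> 'b) \<Rightarrow> nat \<Rightarrow> 'a \<Rightarrow> 'b list" where
  "history \<xi> 0 \<omega> = [\<xi> 0 \<omega>]"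
| "history \<xi> (Suc n) \<omega> = \<xi> (Suc n) \<omega> # history \<xi> n \<omega>"

lemma set_history: "set (history \<xi> n \<omega>) = (\<lambda>i. \<xi> i \<omega>) ` {0..n}"
  by (induction n) (auto simp: atLeast0_atMost_Suc)

lemma visited_sites_history: "visited_sites \<xi> n \<omega> = card (fst ` set (history \<xi> n \<omega>))"
  by (simp add: visited_sites_def set_history image_image)

lemma length_history: "length (history \<xi> n \<omega>) = Suc n"
  by (induction n) auto

lemma history_eq_iff:
  assumes "length h = Suc n"
  shows "history \<xi> n \<omega> = h \<longleftrightarrow> (\<forall>i\<le>n. \<xi> i \<omega> = h ! (n - i))"
  using assms
proof (induction n arbitrary: h)
  case 0
  then show ?case by (cases h) auto
next
  case (Suc n)
  then obtain v g where h: "h = v # g" "length g = Suc n" by (cases h) auto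
  have "(\<forall>i\<le>Suc n. \<xi> i \<omega> = h ! (Suc n - i)) \<longleftrightarrow> \<xi> (Suc n) \<omega> = v \<and> (\<forall>i\<le>n. \<xi> i \<omega> = g ! (n - i))"
    unfolding h(1) by (auto simp: le_Suc_eq Suc_diff_le)
  with Suc.IH[OF h(2)] show ?case by (auto simp: h(1))
qed

lemma history_pmf_length: "h \<in> set_pmf (history_pmf K n u) \<Longrightarrow> length h = Suc n"
  by (induction n arbitrary: h) auto

lemma pmf_history_pmf_Suc:
  "pmf (bind_pmf T (\<lambda>h. map_pmf (\<lambda>v. (fst (hd h) + fst v, snd v) # h) (K (snd (hd h))))) (v # g)
    = pmf T g * pmf (K (snd (hd g))) (fst v - fst (hd g), snd v)"
  for K :: "'e \<Rightarrow> ('v::ab_group_add \<times> 'e) pmf"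
proof -
  have step: "pmf (map_pmf (\<lambda>v. (fst (hd h) + fst v, snd v) # h) (K (snd (hd h)))) (v # g)
     = pmf (K (snd (hd g))) (fst v - fst (hd g), snd v) * indicator {g} h" for h
  proof -
    have "(\<lambda>v. (fst (hd h) + fst v, snd v) # h) -` {v # g} = (if h = g then {(fst v - fst (hd g), snd v)} else {})"
      by (auto simp: prod_eq_iff)
    then show ?thesis by (simp add: pmf_map pmf.rep_eq)
  qed
  show ?thesis unfolding pmf_bind step by (simp add: pmf.rep_eq)
qed

locale walk_process =
  fixes p :: "int ^ 2 \<Rightarrow> 'e::finite \<Rightarrow> 'e \<Rightarrow> real" and M :: "'a measure" and \<xi> :: "nat \<Rightarrow> 'a \<Rightarrow> (int ^ 2) \<times> 'e"
  assumes weights: "transition_weights p" and process: "rw_with_internal_states p M \<xi>"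
begin

sublocale prob_space M
  using process by (simp add: rw_with_internal_states_def)

lemma xi_measurable: "\<xi> n \<in> measurable M (count_space UNIV)"
  using process by (simp add: rw_with_internal_states_def)

lemma history_event: "{\<omega> \<in> space M. history \<xi> n \<omega> = h} \<in> sets M"
proof (induction n arbitrary: h)
  case 0
  have "{\<omega> \<in> space M. history \<xi> 0 \<omega> = h} = (if length h = 1 then \<xi> 0 -` {hd h} \<inter> space M else {})"
    by (cases h) auto
  then show ?case using measurable_sets[OF xi_measurable, of "{hd h}" 0] by simp
next
  case (Suc n)
  show ?case
  proof (cases h)
    case (Cons v g)
    have "{\<omega> \<in> space M. history \<xi> (Suc n) \<omega> = h} = (\<xi> (Suc n) -` {v} \<inter> space M) \<inter> {\<omega> \<in> space M. history \<xi> n \<omega> = g}"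
      using Cons by auto
    then show ?thesis using Suc.IH[of g] measurable_sets[OF xi_measurable, of "{v}" "Suc n"] by simp
  qed simp
qed

lemma history_measurable: "history \<xi> n \<in> measurable M (count_space UNIV)"
  unfolding measurable_count_space_eq2_countable
  using history_event by (auto simp: vimage_def Int_def conj_commute)

definition initial :: "'e pmf" where
  "initial = embed_pmf (\<lambda>j. prob {\<omega> \<in> space M. snd (\<xi> 0 \<omega>) = j})"

lemma pmf_initial: "pmf initial j = prob {\<omega> \<in> space M. snd (\<xi> 0 \<omega>) = j}"
  unfolding initial_def
proof (rule pmf_embed_pmf)
  have ev: "{\<omega> \<in> space M. snd (\<xi> 0 \<omega>) = j} \<in> sets M" for j
    using measurable_sets[OF xi_measurable, of "{u. snd u = j}" 0] by (simp add: vimage_def Int_def conj_commute)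
  have "(\<Sum>j\<in>UNIV. prob {\<omega> \<in> space M. snd (\<xi> 0 \<omega>) = j}) = prob (\<Union>j. {\<omega> \<in> space M. snd (\<xi> 0 \<omega>) = j})"
    by (rule finite_measure_finite_Union[symmetric]) (use ev in \<open>auto simp: disjoint_family_on_def\<close>)
  also have "(\<Union>j. {\<omega> \<in> space M. snd (\<xi> 0 \<omega>) = j}) = space M" by auto
  finally have "(\<Sum>j\<in>UNIV. prob {\<omega> \<in> space M. snd (\<xi> 0 \<omega>) = j}) = 1" by (simp add: prob_space)
  then show "(\<integral>\<^sup>+ j. ennreal (prob {\<omega> \<in> space M. snd (\<xi> 0 \<omega>) = j}) \<partial>count_space UNIV) = 1"
    by (simp add: nn_integral_count_space_finite sum_ennreal)
qed simp

definition law :: "nat \<Rightarrow> ((int ^ 2) \<times> 'e) list pmf" where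
  "law n = bind_pmf initial (\<lambda>j. history_pmf (kernel_of p) n (0, j))"

lemma law_Suc:
  "law (Suc n) = bind_pmf (law n) (\<lambda>h. map_pmf (\<lambda>v. (fst (hd h) + fst v, snd v) # h) (kernel_of p (snd (hd h))))"
  by (simp add: law_def bind_assoc_pmf)

lemma law_length: "h \<in> set_pmf (law n) \<Longrightarrow> length h = Suc n"
  by (auto simp: law_def history_pmf_length)

text \<open>
  By induction on the length of the trajectory, using the Markov property in the form in which it
  is stated for the process; a past of probability zero has no continuation of positive
  probability.
\<close>

lemma prob_history: "prob {\<omega> \<in> space M. history \<xi> n \<omega> = h} = pmf (law n) h"
proof (induction n arbitrary: h)
  case 0
  show ?case
  proof (cases "\<exists>j. h = [(0, j)]")
    case True
    then obtain j where h: "h = [(0, j)]" by blast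
    have "prob {\<omega> \<in> space M. history \<xi> 0 \<omega> = h} = prob {\<omega> \<in> space M. snd (\<xi> 0 \<omega>) = j}"
    proof (rule finite_measure_eq_AE)
      show "AE \<omega> in M. \<omega> \<in> {\<omega> \<in> space M. history \<xi> 0 \<omega> = h} \<longleftrightarrow> \<omega> \<in> {\<omega> \<in> space M. snd (\<xi> 0 \<omega>) = j}"
      proof -
        have "AE \<omega> in M. fst (\<xi> 0 \<omega>) = 0" using process by (simp add: rw_with_internal_states_def)
        then show ?thesis by eventually_elim (auto simp: h prod_eq_iff)
      qed
      show "{\<omega> \<in> space M. snd (\<xi> 0 \<omega>) = j} \<in> sets M"
        using measurable_sets[OF xi_measurable, of "{u. snd u = j}" 0] by (simp add: vimage_def Int_def conj_commute)
    qed (rule history_event)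
    also have "\<dots> = pmf (law 0) h"
    proof -
      have "law 0 = map_pmf (\<lambda>j. [(0, j)]) initial" by (simp add: law_def map_pmf_def)
      then show ?thesis
        using pmf_map_inj'[of "\<lambda>j. [(0 :: int ^ 2, j)]" initial j] by (simp add: h pmf_initial[symmetric] inj_on_def)
    qed
    finally show ?thesis .
  next
    case False
    then have "h \<notin> set_pmf (law 0)" by (auto simp: law_def)
    then have "pmf (law 0) h = 0" by (simp add: set_pmf_iff)
    moreover have "prob {\<omega> \<in> space M. history \<xi> 0 \<omega> = h} = 0"
    proof -
      have "AE \<omega> in M. fst (\<xi> 0 \<omega>) = 0" using process by (simp add: rw_with_internal_states_def)
      then have "AE \<omega> in M. history \<xi> 0 \<omega> \<noteq> h" by eventually_elim (use False in \<open>auto simp: prod_eq_iff\<close>)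
      then show ?thesis unfolding prob_eq_0[OF history_event] by eventually_elim simp
    qed
    ultimately show ?thesis by simp
  qed
next
  case (Suc n)
  show ?case
  proof (cases "length h = Suc (Suc n)")
    case False
    then have "h \<notin> set_pmf (law (Suc n))" using law_length by blast
    then have "pmf (law (Suc n)) h = 0" by (simp add: set_pmf_iff)
    moreover have "{\<omega> \<in> space M. history \<xi> (Suc n) \<omega> = h} = {}"
      using False length_history[of \<xi> "Suc n"] by auto
    ultimately show ?thesis by (simp only: measure_empty)
  next
    case True
    then obtain v g where h: "h = v # g" and g: "length g = Suc n" by (cases h) auto
    define s where "s i = h ! (Suc n - i)" for i
    have s: "s (Suc n) = v" "s n = hd g"
      using g by (cases g; simp add: s_def h)+
    have past: "(\<forall>i\<le>n. \<xi> i \<omega> = s i) \<longleftrightarrow> history \<xi> n \<omega> = g" for \<omega>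
      unfolding history_eq_iff[OF g] by (auto simp: s_def h Suc_diff_le)
    have now: "history \<xi> (Suc n) \<omega> = h \<longleftrightarrow> \<xi> (Suc n) \<omega> = s (Suc n) \<and> history \<xi> n \<omega> = g" for \<omega>
      by (simp add: h s(1))
    have pm: "pmf (law (Suc n)) h = pmf (law n) g * p (fst v - fst (hd g)) (snd (hd g)) (snd v)"
      unfolding law_Suc h pmf_history_pmf_Suc pmf_kernel_of[OF weights] ..
    show ?thesis
    proof (cases "prob {\<omega> \<in> space M. history \<xi> n \<omega> = g} > 0")
      case True
      have "\<P>(\<omega> in M. \<xi> (Suc n) \<omega> = s (Suc n) \<bar> \<forall>i\<le>n. \<xi> i \<omega> = s i) =
          p (fst (s (Suc n)) - fst (s n)) (snd (s n)) (snd (s (Suc n)))"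
        using process True unfolding rw_with_internal_states_def past[symmetric] by blast
      then have "prob {\<omega> \<in> space M. history \<xi> (Suc n) \<omega> = h} / prob {\<omega> \<in> space M. history \<xi> n \<omega> = g}
          = p (fst v - fst (hd g)) (snd (hd g)) (snd v)"
        unfolding cond_prob_def past now s .
      then have "prob {\<omega> \<in> space M. history \<xi> (Suc n) \<omega> = h} =
          prob {\<omega> \<in> space M. history \<xi> n \<omega> = g} * p (fst v - fst (hd g)) (snd (hd g)) (snd v)"
        using True by (simp add: field_simps)
      then show ?thesis using Suc.IH[of g] pm by simp
    next
      case False
      then have "prob {\<omega> \<in> space M. history \<xi> n \<omega> = g} = 0" using measure_nonneg[of M] by (simp add: not_less antisym)
      moreover have "prob {\<omega> \<in> space M. history \<xi> (Suc n) \<omega> = h} \<le> prob {\<omega> \<in> space M. history \<xi> n \<omega> = g}"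
        by (rule finite_measure_mono) (use history_event now in auto)
      ultimately have "prob {\<omega> \<in> space M. history \<xi> (Suc n) \<omega> = h} = 0" "pmf (law n) g = 0"
        using measure_nonneg[of M] Suc.IH[of g] by (auto intro: antisym)
      then show ?thesis using pm by simp
    qed
  qed
qed

lemma distr_history: "distr M (count_space UNIV) (history \<xi> n) = measure_pmf (law n)"
proof (rule measure_eqI_countable[of _ UNIV])
  fix h :: "((int ^ 2) \<times> 'e) list"
  have "emeasure (distr M (count_space UNIV) (history \<xi> n)) {h} = emeasure M (history \<xi> n -` {h} \<inter> space M)"
    by (rule emeasure_distr[OF history_measurable]) simp
  also have "history \<xi> n -` {h} \<inter> space M = {\<omega> \<in> space M. history \<xi> n \<omega> = h}" by auto
  also have "emeasure M \<dots> = ennreal (pmf (law n) h)"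
    by (simp add: emeasure_eq_measure prob_history)
  finally show "emeasure (distr M (count_space UNIV) (history \<xi> n)) {h} = emeasure (measure_pmf (law n)) {h}"
    by (simp add: emeasure_pmf_single)
qed auto

lemma law_sites: "map_pmf (\<lambda>h. fst ` set h) (law n) = bind_pmf initial (range_pmf (kernel_of p) n)"
proof -
  have "(`) ((+) (0 :: int ^ 2)) = (\<lambda>A. A)" by (auto simp: fun_eq_iff)
  then show ?thesis unfolding law_def map_bind_pmf history_sites by simp
qed

lemma prob_visited:
  "prob {\<omega> \<in> space M. \<Phi> (visited_sites \<xi> n \<omega>)} =
     (\<Sum>j\<in>UNIV. pmf initial j * measure_pmf.prob (range_pmf (kernel_of p) n j) {A. \<Phi> (card A)})"
proof -
  have "prob {\<omega> \<in> space M. \<Phi> (visited_sites \<xi> n \<omega>)} = measure (distr M (count_space UNIV) (history \<xi> n)) {h. \<Phi> (card (fst ` set h))}"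
    by (subst measure_distr[OF history_measurable]) (auto simp: visited_sites_history intro!: arg_cong[where f = prob])
  also have "\<dots> = measure_pmf.prob (map_pmf (\<lambda>h. fst ` set h) (law n)) {A. \<Phi> (card A)}"
    unfolding distr_history by (simp add: vimage_def)
  also have "\<dots> = (\<Sum>j\<in>UNIV. pmf initial j * measure_pmf.prob (range_pmf (kernel_of p) n j) {A. \<Phi> (card A)})"
    unfolding law_sites prob_bind_pmf by (subst integral_measure_pmf[of UNIV]) auto
  finally show ?thesis .
qed

lemma visited_measurable: "(\<lambda>\<omega>. visited_sites \<xi> n \<omega>) \<in> measurable M (count_space UNIV)"
  unfolding visited_sites_history
  by (rule measurable_compose[OF history_measurable]) simp

lemma expected_visited:
  "expected_visited_sites M \<xi> n = (\<Sum>j\<in>UNIV. pmf initial j * mean_range (kernel_of p) n j)"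
proof -
  have "expected_visited_sites M \<xi> n = integral\<^sup>L (distr M (count_space UNIV) (history \<xi> n)) (\<lambda>h. real (card (fst ` set h)))"
    unfolding expected_visited_sites_def visited_sites_history by (rule integral_distr[OF history_measurable, symmetric]) simp
  also have "\<dots> = \<E> (map_pmf (\<lambda>h. fst ` set h) (law n)) (\<lambda>A. real (card A))"
    unfolding distr_history by simp
  also have "\<dots> = \<E> initial (mean_range (kernel_of p) n)"
    unfolding law_sites mean_range_def
    by (rule expectation_bind_support[where B = "real (n + 1)"]) (auto dest: range_pmf_support(3) simp del: of_nat_add)
  also have "\<dots> = (\<Sum>j\<in>UNIV. pmf initial j * mean_range (kernel_of p) n j)"
    by (subst integral_measure_pmf[of UNIV]) auto
  finally show ?thesis .
qed

end

section \<open>Almost sure convergence\<close>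

text \<open>
  The law started from \<open>j\<close> is dominated by the stationary law divided by \<open>pmf
  \<mu> j\<close>, so the stationary variance controls it as well.
\<close>

lemma (in dual_walks) stat_chebyshev:
  assumes a: "0 < a"
  shows "measure_pmf.prob (range_pmf K n j) {A. a \<le> \<bar>real (card A) - stat_mean n\<bar>} \<le> stat_var n / a\<^sup>2 / pmf \<mu> j"
proof -
  let ?S = "{A :: (int ^ 2) set. a \<le> \<bar>real (card A) - stat_mean n\<bar>}"
  let ?P = "bind_pmf \<mu> (range_pmf K n)"
  have i: "integrable ?P (\<lambda>A. (real (card A))\<^sup>2)"
  proof (rule integrable_pmf_support)
    fix A assume "A \<in> set_pmf ?P"
    from stat_range_support(2)[OF this] have "real (card A) \<le> real (n + 1)" by (simp only: of_nat_le_iff)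
    then show "norm ((real (card A))\<^sup>2) \<le> (real (n + 1))\<^sup>2" by (simp add: power_mono del: of_nat_add)
  qed
  have "measure_pmf.prob ?P ?S \<le> stat_var n / a\<^sup>2"
    using measure_pmf.Chebyshev_inequality[OF _ i a] by (simp add: stat_mean_eq[symmetric] stat_var_def)
  moreover have "pmf \<mu> j * measure_pmf.prob (range_pmf K n j) ?S \<le> measure_pmf.prob ?P ?S"
    unfolding prob_bind_pmf
    by (subst integral_measure_pmf[of UNIV]) (auto intro!: member_le_sum[where f = "\<lambda>j. pmf \<mu> j * measure_pmf.prob (range_pmf K n j) ?S"])
  ultimately have "pmf \<mu> j * measure_pmf.prob (range_pmf K n j) ?S \<le> stat_var n / a\<^sup>2" by linarith
  then show ?thesis by (subst pos_le_divide_eq[OF pos]) (simp only: mult.commute)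
qed

lemma (in dual_walks) stat_mean_pos: "0 < stat_mean n"
  using stat_mean_mono[of 0 n] by (simp add: stat_mean_0)

lemma (in dual_walks) relative_variance:
  "\<exists>C. \<forall>k n. 2 ^ k \<le> n \<and> n \<le> 2 ^ Suc k \<longrightarrow> stat_var n / (stat_mean n)\<^sup>2 \<le> C / (real k + 1)\<^sup>2"
proof -
  obtain B where B: "B > 0" "\<And>k N. N \<le> 2 ^ k \<Longrightarrow> stat_var N \<le> B * 4 ^ k / (real k + 1) ^ 4"
    using stat_var_upper by blast
  obtain c where c: "c > 0" "\<And>k. c * 2 ^ k / (real k + 1) \<le> stat_mean (2 ^ k)"
    using stat_mean_lower by blast
  have "stat_var n / (stat_mean n)\<^sup>2 \<le> 4 * B / c\<^sup>2 / (real k + 1)\<^sup>2" if "2 ^ k \<le> n" "n \<le> 2 ^ Suc k" for k n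
  proof -
    let ?m = "c * 2 ^ k / (real k + 1)"
    have "stat_var n \<le> B * 4 ^ Suc k / (real (Suc k) + 1) ^ 4" by (rule B(2)[OF that(2)])
    also have "\<dots> \<le> B * 4 ^ Suc k / (real k + 1) ^ 4"
      using B(1) by (intro divide_left_mono power_mono mult_pos_pos) auto
    finally have v: "stat_var n \<le> 4 * B * 4 ^ k / (real k + 1) ^ 4" by (simp add: mult_ac)
    have m: "0 < ?m" "?m \<le> stat_mean n"
      using c(1) order_trans[OF c(2) stat_mean_mono[OF that(1)]] by auto
    have "stat_var n / (stat_mean n)\<^sup>2 \<le> (4 * B * 4 ^ k / (real k + 1) ^ 4) / ?m\<^sup>2"
      using v m B(1) by (intro frac_le power_mono) auto
    also have "\<dots> = 4 * B / c\<^sup>2 / (real k + 1)\<^sup>2"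
    proof -
      have "(2 ^ k)\<^sup>2 = (4 :: real) ^ k"
        using power_mult[of "2 :: real" 2 k] power_mult[of "2 :: real" k 2] by (simp add: mult.commute)
      then have m2: "?m\<^sup>2 = c\<^sup>2 * 4 ^ k / (real k + 1)\<^sup>2" by (simp add: power_divide power_mult_distrib)
      have alg: "x * z / y ^ 4 / (w * z / y\<^sup>2) = x / w / y\<^sup>2" if "z \<noteq> 0" "y \<noteq> 0" for x y z w :: real
        using that by (cases "w = 0") (simp_all add: field_simps power2_eq_square power4_eq_xxxx)
      show ?thesis unfolding m2 by (rule alg) auto
    qed
    finally show ?thesis .
  qed
  then show ?thesis by blast
qed

text \<open>
  The relative variance at these times is of order \<open>i powr (- 3 / 2)\<close>. An exponent
  above \<open>1 / 2\<close> makes it summable, and an exponent below 1 makes the ratio of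
  consecutive times tend to 1.
\<close>

definition sparse_times :: "nat \<Rightarrow> nat" where
  "sparse_times i = nat \<lfloor>2 powr (real i powr (3 / 4))\<rfloor>"

lemma sparse_times_bounds:
  "real (sparse_times i) \<le> 2 powr (real i powr (3 / 4))" "2 powr (real i powr (3 / 4)) - 1 < real (sparse_times i)"
  unfolding sparse_times_def by (auto simp: of_nat_nat)

lemma sparse_times_pos: "0 < sparse_times i"
proof -
  have "1 \<le> 2 powr (real i powr (3 / 4))" by (rule ge_one_powr_ge_zero) auto
  then show ?thesis unfolding sparse_times_def by simp
qed

lemma sparse_times_mono: "mono sparse_times"
  unfolding sparse_times_def
  by (intro monoI nat_mono floor_mono powr_mono powr_mono2) auto

lemma sparse_times_at_top: "filterlim sparse_times at_top at_top"
proof -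
  have "filterlim (\<lambda>i. 2 powr (real i powr (3 / 4)) - 1) at_top sequentially" by real_asymp
  then have "filterlim (\<lambda>i. real (sparse_times i)) at_top sequentially"
    by (rule filterlim_at_top_mono) (use sparse_times_bounds(2) in \<open>auto intro!: always_eventually less_imp_le\<close>)
  then show ?thesis by (simp add: filterlim_sequentially_iff_filterlim_real)
qed

lemma sparse_times_ratio: "(\<lambda>i. real (sparse_times (Suc i)) / real (sparse_times i)) \<longlonglongrightarrow> 1"
proof (rule tendsto_sandwich[of "\<lambda>_. 1"])
  show "(\<lambda>i. 2 powr ((real i + 1) powr (3 / 4)) / (2 powr (real i powr (3 / 4)) - 1)) \<longlonglongrightarrow> 1"
    by real_asymp
  show "\<forall>\<^sub>F i in sequentially. 1 \<le> real (sparse_times (Suc i)) / real (sparse_times i)"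
  proof (rule always_eventually, rule allI)
    fix i
    have "sparse_times i \<le> sparse_times (Suc i)" by (rule monoD[OF sparse_times_mono]) simp
    then show "1 \<le> real (sparse_times (Suc i)) / real (sparse_times i)"
      using sparse_times_pos[of i] by (simp add: pos_le_divide_eq)
  qed
  show "\<forall>\<^sub>F i in sequentially. real (sparse_times (Suc i)) / real (sparse_times i)
      \<le> 2 powr ((real i + 1) powr (3 / 4)) / (2 powr (real i powr (3 / 4)) - 1)"
  proof (rule eventually_sequentiallyI[of 1])
    fix i :: nat assume i: "1 \<le> i"
    have "1 \<le> real i powr (3 / 4)" using i by (intro ge_one_powr_ge_zero) auto
    then have "2 powr 1 \<le> 2 powr (real i powr (3 / 4))" by (intro powr_mono) auto
    then show "real (sparse_times (Suc i)) / real (sparse_times i)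
      \<le> 2 powr ((real i + 1) powr (3 / 4)) / (2 powr (real i powr (3 / 4)) - 1)"
      using sparse_times_bounds(1)[of "Suc i"] sparse_times_bounds(2)[of i]
      by (intro frac_le) (auto simp: add.commute)
  qed
qed simp

lemma sparse_times_dyadic: "\<exists>k. 2 ^ k \<le> sparse_times i \<and> sparse_times i \<le> 2 ^ Suc k \<and> real i powr (3 / 4) \<le> real k + 1"
proof -
  let ?x = "real i powr (3 / 4)"
  define k where "k = nat \<lfloor>?x\<rfloor>"
  have k: "real k \<le> ?x" "?x \<le> real k + 1" by (auto simp: k_def of_nat_nat)
  have "2 ^ k \<le> sparse_times i"
  proof -
    have "2 powr real k \<le> 2 powr ?x" using k by (intro powr_mono) auto
    then have "real_of_int (2 ^ k) \<le> 2 powr ?x" by (simp add: powr_realpow)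
    then have "2 ^ k \<le> \<lfloor>2 powr ?x\<rfloor>" by (simp only: le_floor_iff)
    then show ?thesis unfolding sparse_times_def by (simp add: nat_le_iff le_nat_iff)
  qed
  moreover have "sparse_times i \<le> 2 ^ Suc k"
  proof -
    have "2 powr ?x \<le> 2 powr (real (Suc k))" using k by (intro powr_mono) auto
    also have "\<dots> = real (2 ^ Suc k)" by (subst powr_realpow) auto
    finally have "real (sparse_times i) \<le> real (2 ^ Suc k)"
      using sparse_times_bounds(1)[of i] by linarith
    then show ?thesis by (simp only: of_nat_le_iff)
  qed
  ultimately show ?thesis using k by blast
qed

text \<open>
  Between two consecutive times of the subsequence both sequences are monotone, and by concavity
  \<open>e\<close> grows at most by the ratio of the times.
\<close>

lemma ratio_limit_interpolation:
  fixes L e :: "nat \<Rightarrow> real" and N :: "nat \<Rightarrow> nat"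
  assumes L: "mono L" "\<And>n. 0 \<le> L n" and e: "\<And>n. 0 < e n" "mono e"
    and concave: "\<And>n m. n \<le> m \<Longrightarrow> real n * e m \<le> real m * e n"
    and N: "mono N" "\<And>i. 0 < N i" "filterlim N at_top at_top" "(\<lambda>i. real (N (Suc i)) / real (N i)) \<longlonglongrightarrow> 1"
    and lim: "(\<lambda>i. L (N i) / e (N i)) \<longlonglongrightarrow> 1"
  shows "(\<lambda>n. L n / e n) \<longlonglongrightarrow> 1"
proof (rule order_tendstoI)
  let ?r = "\<lambda>i. real (N (Suc i)) / real (N i)" and ?a = "\<lambda>i. L (N i) / e (N i)"
  \<comment> \<open>the least \<open>i\<close> with \<open>n < N (Suc i)\<close> locates
    \<open>n\<close> between two times of the subsequence\<close>
  have block: "\<exists>i\<ge>I. N i \<le> n \<and> n \<le> N (Suc i)" if n: "N I \<le> n" for I n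
  proof -
    have "\<exists>i. n < N (Suc i)"
    proof -
      have "\<forall>\<^sub>F i in sequentially. Suc n \<le> N i" using N(3) unfolding filterlim_at_top by blast
      then obtain i where "n < N i" by (auto simp: eventually_sequentially Suc_le_eq)
      also have "N i \<le> N (Suc i)" by (rule monoD[OF N(1)]) simp
      finally show ?thesis by blast
    qed
    define i where "i = (LEAST i. n < N (Suc i))"
    have i: "n < N (Suc i)" unfolding i_def by (rule LeastI_ex) fact
    have "I \<le> i"
    proof (rule ccontr)
      assume "\<not> I \<le> i"
      then have "N (Suc i) \<le> N I" by (intro monoD[OF N(1)]) simp
      with i n show False by simp
    qed
    moreover have "N i \<le> n"
    proof (cases i)
      case 0
      then show ?thesis using \<open>I \<le> i\<close> n by simp
    next
      case (Suc l)
      then have "\<not> n < N (Suc l)" unfolding i_def by (intro not_less_Least) simp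
      then show ?thesis using Suc by simp
    qed
    ultimately show ?thesis using i by (intro exI[of _ i]) auto
  qed
  have e_ratio: "e (N (Suc i)) \<le> ?r i * e (N i)" for i
    using concave[OF monoD[OF N(1)], of i "Suc i"] N(2)[of i] by (simp add: field_simps)
  have upper: "L n / e n \<le> ?a (Suc i) * ?r i" if "N i \<le> n" "n \<le> N (Suc i)" for i n
  proof -
    have "L n / e n \<le> L (N (Suc i)) / e (N i)"
      using that L e(1) monoD[OF L(1)] monoD[OF e(2)] by (intro frac_le) auto
    also have "\<dots> = ?a (Suc i) * (e (N (Suc i)) / e (N i))" using e(1)[of "N (Suc i)"] by simp
    also have "\<dots> \<le> ?a (Suc i) * ?r i"
      using e_ratio[of i] e(1) L(2) by (intro mult_left_mono) (auto simp: pos_divide_le_eq less_imp_le)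
    finally show ?thesis .
  qed
  have lower: "?a i / ?r i \<le> L n / e n" if "N i \<le> n" "n \<le> N (Suc i)" for i n
  proof -
    have "?a i / ?r i = L (N i) / (?r i * e (N i))" by simp
    also have "\<dots> \<le> L (N i) / e (N (Suc i))"
      using e_ratio[of i] e(1) L(2) N(2) by (intro divide_left_mono mult_pos_pos divide_pos_pos) auto
    also have "\<dots> \<le> L n / e n"
      using that L e(1) monoD[OF L(1)] monoD[OF e(2)] by (intro frac_le) auto
    finally show ?thesis .
  qed
  have eventually_blocks: "\<forall>\<^sub>F n in sequentially. P (L n / e n)"
    if "\<forall>\<^sub>F i in sequentially. \<forall>n. N i \<le> n \<longrightarrow> n \<le> N (Suc i) \<longrightarrow> P (L n / e n)" for P
  proof -
    from that obtain I where I: "\<And>i n. i \<ge> I \<Longrightarrow> N i \<le> n \<Longrightarrow> n \<le> N (Suc i) \<Longrightarrow> P (L n / e n)"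
      by (auto simp: eventually_sequentially)
    show ?thesis
      by (rule eventually_sequentiallyI[of "N I"]) (use block I in blast)
  qed
  have up: "(\<lambda>i. ?a (Suc i) * ?r i) \<longlonglongrightarrow> 1"
    using tendsto_mult[OF LIMSEQ_Suc[OF lim] N(4)] by simp
  have low: "(\<lambda>i. ?a i / ?r i) \<longlonglongrightarrow> 1"
    using tendsto_divide[OF lim N(4)] by simp
  show "\<forall>\<^sub>F n in sequentially. x < L n / e n" if "x < 1" for x
    by (rule eventually_blocks, rule eventually_mono[OF order_tendstoD(1)[OF low that]])
       (use lower less_le_trans in blast)
  show "\<forall>\<^sub>F n in sequentially. L n / e n < x" if "1 < x" for x
    by (rule eventually_blocks, rule eventually_mono[OF order_tendstoD(2)[OF up that]])
       (use upper le_less_trans in blast)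
qed

text \<open>
  Convergence is expressed by countable quantifiers, so that it is an event.
\<close>

lemma convergence_event:
  fixes X :: "nat \<Rightarrow> 'a \<Rightarrow> real"
  assumes [measurable]: "\<And>n. X n \<in> borel_measurable M"
  shows "{\<omega> \<in> space M. (\<lambda>n. X n \<omega>) \<longlonglongrightarrow> c} \<in> sets M"
proof -
  have "(\<lambda>n. X n \<omega>) \<longlonglongrightarrow> c \<longleftrightarrow> (\<forall>m. \<exists>N. \<forall>n\<ge>N. \<bar>X n \<omega> - c\<bar> < 1 / real (Suc m))" for \<omega>
  proof
    assume "(\<lambda>n. X n \<omega>) \<longlonglongrightarrow> c"
    then show "\<forall>m. \<exists>N. \<forall>n\<ge>N. \<bar>X n \<omega> - c\<bar> < 1 / real (Suc m)"
      unfolding LIMSEQ_iff real_norm_def by simp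
  next
    assume R: "\<forall>m. \<exists>N. \<forall>n\<ge>N. \<bar>X n \<omega> - c\<bar> < 1 / real (Suc m)"
    show "(\<lambda>n. X n \<omega>) \<longlonglongrightarrow> c"
      unfolding LIMSEQ_iff real_norm_def
    proof (intro allI impI)
      fix r :: real assume "0 < r"
      then obtain m where m: "1 / real (Suc m) < r" using nat_approx_posE by blast
      from R obtain N where N: "\<forall>n\<ge>N. \<bar>X n \<omega> - c\<bar> < 1 / real (Suc m)" by blast
      show "\<exists>N. \<forall>n\<ge>N. \<bar>X n \<omega> - c\<bar> < r"
        by (intro exI[of _ N] allI impI less_trans[OF N[rule_format] m])
    qed
  qed
  then show ?thesis by simp
qed

lemma (in dual_walks) stat_mean_at_top: "filterlim stat_mean at_top at_top"
  unfolding filterlim_at_top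
proof
  fix Z :: real
  obtain c where c: "c > 0" "\<And>k. c * 2 ^ k / (real k + 1) \<le> stat_mean (2 ^ k)"
    using stat_mean_lower by blast
  have "filterlim (\<lambda>k. 2 ^ k / (real k + 1)) at_top sequentially" by real_asymp
  then have "\<forall>\<^sub>F k in sequentially. Z / c \<le> 2 ^ k / (real k + 1)" unfolding filterlim_at_top by blast
  then obtain k where "Z / c \<le> 2 ^ k / (real k + 1)" by (auto simp: eventually_sequentially)
  then have "Z \<le> c * (2 ^ k / (real k + 1))" using c(1) by (simp only: pos_divide_le_eq mult.commute)
  then have k: "Z \<le> stat_mean (2 ^ k)" using c(2)[of k] by simp
  show "\<forall>\<^sub>F n in sequentially. Z \<le> stat_mean n"
    by (rule eventually_sequentiallyI[of "2 ^ k"]) (rule order_trans[OF k stat_mean_mono])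
qed

theorem theorem8:
  fixes p :: "int ^ 2 \<Rightarrow> 'e::finite \<Rightarrow> 'e \<Rightarrow> real"
    and \<mu> :: "real ^ 'e"
    and M :: "'a measure"
    and \<xi> :: "nat \<Rightarrow> 'a \<Rightarrow> (int ^ 2) \<times> 'e"
  assumes "transition_weights p"
    and "basic_assumptions p \<mu>"
    and "moment_converges p 4"
    and "rw_with_internal_states p M \<xi>"
  shows "\<P>(\<omega> in M. (\<lambda>n. real (visited_sites \<xi> n \<omega>) / expected_visited_sites M \<xi> n)
           \<longlonglongrightarrow> 1) = 1"
proof -
  obtain K' \<mu>' where dual: "dual_walks (kernel_of p) K' \<mu>'"
    using dual_walks_exists[OF assms(1-3)] by blast
  interpret D: dual_walks "kernel_of p" K' \<mu>' by (rule dual)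
  interpret W: walk_process p M \<xi> by unfold_locales (use assms in auto)
  let ?L = "\<lambda>n \<omega>. real (visited_sites \<xi> n \<omega>)" and ?e = D.stat_mean and ?E = "expected_visited_sites M \<xi>"
  have e: "0 < ?e n" for n by (rule D.stat_mean_pos)
  have Lm [measurable]: "?L n \<in> borel_measurable M" for n
    by (rule measurable_compose[OF W.visited_measurable]) simp
  have initial_sum: "(\<Sum>j\<in>UNIV. pmf W.initial j) = 1" by (simp add: sum_pmf_eq_1)
  define S where "S = (\<Sum>j\<in>UNIV. 1 / pmf \<mu>' j)"
  have S: "1 / pmf \<mu>' j \<le> S" for j
    unfolding S_def by (rule member_le_sum) (use D.pos in \<open>auto simp: less_imp_le\<close>)
  \<comment> \<open>the initial law is dominated by \<open>S\<close> times the stationary one\<close>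
  have deviation: "W.prob {\<omega> \<in> space M. r * ?e n \<le> \<bar>?L n \<omega> - ?e n\<bar>} \<le> S / r\<^sup>2 * (D.stat_var n / (?e n)\<^sup>2)"
    if r: "0 < r" for r n
  proof -
    have v: "0 \<le> D.stat_var n" unfolding D.stat_var_def by (rule Bochner_Integration.integral_nonneg) simp
    have "W.prob {\<omega> \<in> space M. r * ?e n \<le> \<bar>?L n \<omega> - ?e n\<bar>}
        = (\<Sum>j\<in>UNIV. pmf W.initial j * measure_pmf.prob (range_pmf (kernel_of p) n j) {A. r * ?e n \<le> \<bar>real (card A) - ?e n\<bar>})"
      by (rule W.prob_visited)
    also have "\<dots> \<le> (\<Sum>j\<in>UNIV. pmf W.initial j * (S / r\<^sup>2 * (D.stat_var n / (?e n)\<^sup>2)))"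
    proof (intro sum_mono mult_left_mono)
      fix j
      have "measure_pmf.prob (range_pmf (kernel_of p) n j) {A. r * ?e n \<le> \<bar>real (card A) - ?e n\<bar>}
          \<le> D.stat_var n / (r * ?e n)\<^sup>2 / pmf \<mu>' j"
        by (rule D.stat_chebyshev) (use r e in simp)
      also have "\<dots> = (D.stat_var n / (?e n)\<^sup>2 / r\<^sup>2) * (1 / pmf \<mu>' j)"
        by (simp add: power_mult_distrib mult.commute)
      also have "\<dots> \<le> (D.stat_var n / (?e n)\<^sup>2 / r\<^sup>2) * S"
        by (rule mult_left_mono[OF S]) (use v in simp)
      finally show "measure_pmf.prob (range_pmf (kernel_of p) n j) {A. r * ?e n \<le> \<bar>real (card A) - ?e n\<bar>}
          \<le> S / r\<^sup>2 * (D.stat_var n / (?e n)\<^sup>2)" by (simp add: mult_ac)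
    qed simp
    also have "\<dots> = S / r\<^sup>2 * (D.stat_var n / (?e n)\<^sup>2)"
      by (simp only: sum_distrib_right[symmetric] initial_sum mult_1)
    finally show ?thesis .
  qed
  obtain C where C: "\<And>k n. 2 ^ k \<le> n \<Longrightarrow> n \<le> 2 ^ Suc k \<Longrightarrow> D.stat_var n / (?e n)\<^sup>2 \<le> C / (real k + 1)\<^sup>2"
    using D.relative_variance by blast
  have sparse: "D.stat_var (sparse_times i) / (?e (sparse_times i))\<^sup>2 \<le> \<bar>C\<bar> * real i powr (- 3 / 2)" if "1 \<le> i" for i
  proof -
    obtain k where k: "2 ^ k \<le> sparse_times i" "sparse_times i \<le> 2 ^ Suc k" "real i powr (3 / 4) \<le> real k + 1"
      using sparse_times_dyadic by blast
    have pos: "0 < real i powr (3 / 4)" using that by simp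
    have "D.stat_var (sparse_times i) / (?e (sparse_times i))\<^sup>2 \<le> C / (real k + 1)\<^sup>2" by (rule C[OF k(1,2)])
    also have "\<dots> \<le> \<bar>C\<bar> / (real i powr (3 / 4))\<^sup>2"
      using pos k(3) by (intro frac_le power_mono) auto
    also have "(real i powr (3 / 4))\<^sup>2 = real i powr (3 / 2)"
      by (simp add: power2_eq_square flip: powr_add)
    also have "\<bar>C\<bar> / real i powr (3 / 2) = \<bar>C\<bar> * real i powr (- 3 / 2)"
    proof -
      have "- 3 / 2 = - (3 / 2 :: real)" by simp
      then show ?thesis by (simp only: powr_minus_divide times_divide_eq_right mult_1_right)
    qed
    finally show ?thesis .
  qed
  have close: "AE \<omega> in M. \<forall>\<^sub>F i in sequentially. \<bar>?L (sparse_times i) \<omega> - ?e (sparse_times i)\<bar> < r * ?e (sparse_times i)"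
    if r: "0 < r" for r
  proof -
    let ?A = "\<lambda>i. {\<omega> \<in> space M. r * ?e (sparse_times i) \<le> \<bar>?L (sparse_times i) \<omega> - ?e (sparse_times i)\<bar>}"
    have "summable (\<lambda>i. W.prob (?A i))"
    proof (rule summable_comparison_test'[where N = 1])
      show "summable (\<lambda>i. S / r\<^sup>2 * (\<bar>C\<bar> * real i powr (- 3 / 2)))"
        by (intro summable_mult) (simp add: summable_real_powr_iff)
      fix i :: nat assume i: "1 \<le> i"
      have "0 \<le> S" unfolding S_def by (intro sum_nonneg) (simp add: D.pos less_imp_le)
      then have "S / r\<^sup>2 * (D.stat_var (sparse_times i) / (?e (sparse_times i))\<^sup>2) \<le> S / r\<^sup>2 * (\<bar>C\<bar> * real i powr (- 3 / 2))"
        by (intro mult_left_mono sparse[OF i]) simp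
      with deviation[OF r, of "sparse_times i"]
      show "norm (W.prob (?A i)) \<le> S / r\<^sup>2 * (\<bar>C\<bar> * real i powr (- 3 / 2))" by simp
    qed
    then have "AE \<omega> in M. \<forall>\<^sub>F i in sequentially. \<omega> \<in> space M - ?A i"
      by (intro borel_cantelli_AE1) (auto simp: W.emeasure_eq_measure)
    then show ?thesis
      by eventually_elim (auto elim!: eventually_mono)
  qed
  have "AE \<omega> in M. \<forall>m. \<forall>\<^sub>F i in sequentially.
      \<bar>?L (sparse_times i) \<omega> - ?e (sparse_times i)\<bar> < 1 / real (Suc m) * ?e (sparse_times i)"
    unfolding AE_all_countable by (intro allI close) simp
  then have stat_limit: "AE \<omega> in M. (\<lambda>n. ?L n \<omega> / ?e n) \<longlonglongrightarrow> 1"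
  proof eventually_elim
    fix \<omega>
    assume R: "\<forall>m. \<forall>\<^sub>F i in sequentially.
      \<bar>?L (sparse_times i) \<omega> - ?e (sparse_times i)\<bar> < 1 / real (Suc m) * ?e (sparse_times i)"
    have "(\<lambda>i. ?L (sparse_times i) \<omega> / ?e (sparse_times i)) \<longlonglongrightarrow> 1"
    proof (rule tendstoI)
      fix r :: real assume "0 < r"
      then obtain m where m: "1 / real (Suc m) < r" using nat_approx_posE by blast
      from R have "\<forall>\<^sub>F i in sequentially.
        \<bar>?L (sparse_times i) \<omega> - ?e (sparse_times i)\<bar> < 1 / real (Suc m) * ?e (sparse_times i)" by blast
      then show "\<forall>\<^sub>F i in sequentially. dist (?L (sparse_times i) \<omega> / ?e (sparse_times i)) 1 < r"
      proof eventually_elim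
        case (elim i)
        have "dist (?L (sparse_times i) \<omega> / ?e (sparse_times i)) 1
            = \<bar>?L (sparse_times i) \<omega> - ?e (sparse_times i)\<bar> / ?e (sparse_times i)"
        proof -
          have "\<bar>x / y - 1\<bar> = \<bar>x - y\<bar> / y" if "0 < y" for x y :: real
          proof -
            have "x / y - 1 = (x - y) / y" using that by (simp add: diff_divide_distrib)
            then show ?thesis using that by (simp only: abs_divide abs_of_pos)
          qed
          from this[OF e] show ?thesis by (simp only: dist_real_def)
        qed
        also have "\<dots> < 1 / real (Suc m)"
          by (subst pos_divide_less_eq[OF e]) (rule elim)
        finally show ?case using m by linarith
      qed
    qed
    then show "(\<lambda>n. ?L n \<omega> / ?e n) \<longlonglongrightarrow> 1"
    proof (rule ratio_limit_interpolation[rotated -1])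
      show "mono (\<lambda>n. ?L n \<omega>)"
        unfolding visited_sites_def by (intro monoI of_nat_mono card_mono) auto
      show "mono ?e" by (intro monoI D.stat_mean_mono)
      show "real n * ?e m \<le> real m * ?e n" if "n \<le> m" for n m by (rule D.stat_mean_concave[OF that])
    qed (use e sparse_times_mono sparse_times_pos sparse_times_at_top sparse_times_ratio in auto)
  qed
  \<comment> \<open>the true mean differs from the stationary one by a bounded amount, and the latter
    tends to infinity\<close>
  have mean_limit: "(\<lambda>n. ?E n / ?e n) \<longlonglongrightarrow> 1"
  proof -
    obtain B where B: "B \<ge> 0" "\<And>n j. \<bar>mean_range (kernel_of p) n j - ?e n\<bar> \<le> B"
      using D.mean_range_near_stat_mean by blast
    have diff: "\<bar>?E n - ?e n\<bar> \<le> B" for n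
    proof -
      have "?E n - ?e n = (\<Sum>j\<in>UNIV. pmf W.initial j * (mean_range (kernel_of p) n j - ?e n))"
        by (simp add: W.expected_visited right_diff_distrib sum_subtractf initial_sum flip: sum_distrib_right)
      also have "\<bar>\<dots>\<bar> \<le> (\<Sum>j\<in>UNIV. pmf W.initial j * B)"
      proof (rule order_trans[OF sum_abs sum_mono])
        fix j
        show "\<bar>pmf W.initial j * (mean_range (kernel_of p) n j - ?e n)\<bar> \<le> pmf W.initial j * B"
          unfolding abs_mult using B(2)[of n j] by (simp add: mult_left_mono)
      qed
      also have "\<dots> = B" by (simp add: initial_sum flip: sum_distrib_right)
      finally show ?thesis .
    qed
    have "(\<lambda>n. B / ?e n) \<longlonglongrightarrow> 0"
      by (rule tendsto_divide_0[OF tendsto_const]) (rule filterlim_at_top_imp_at_infinity[OF D.stat_mean_at_top])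
    then have "(\<lambda>n. (?E n - ?e n) / ?e n) \<longlonglongrightarrow> 0"
    proof (rule Lim_null_comparison[rotated])
      show "\<forall>\<^sub>F n in sequentially. norm ((?E n - ?e n) / ?e n) \<le> B / ?e n"
      proof (rule always_eventually, rule allI)
        fix n
        show "norm ((?E n - ?e n) / ?e n) \<le> B / ?e n"
          unfolding real_norm_def abs_divide using diff[of n] e[of n] by (simp add: divide_right_mono)
      qed
    qed
    then have "(\<lambda>n. (?E n - ?e n) / ?e n + 1) \<longlonglongrightarrow> 0 + 1" by (intro tendsto_add tendsto_const)
    moreover have "(?E n - ?e n) / ?e n + 1 = ?E n / ?e n" for n using e[of n] by (simp add: field_simps)
    ultimately show ?thesis by (simp only: add_0)
  qed
  have "AE \<omega> in M. (\<lambda>n. ?L n \<omega> / ?E n) \<longlonglongrightarrow> 1"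
    using stat_limit
  proof eventually_elim
    fix \<omega> assume "(\<lambda>n. ?L n \<omega> / ?e n) \<longlonglongrightarrow> 1"
    from tendsto_divide[OF this mean_limit] have "(\<lambda>n. (?L n \<omega> / ?e n) / (?E n / ?e n)) \<longlonglongrightarrow> 1" by simp
    moreover have "(?L n \<omega> / ?e n) / (?E n / ?e n) = ?L n \<omega> / ?E n" for n using e[of n] by simp
    ultimately show "(\<lambda>n. ?L n \<omega> / ?E n) \<longlonglongrightarrow> 1" by (simp only:)
  qed
  moreover have "{\<omega> \<in> space M. (\<lambda>n. ?L n \<omega> / ?E n) \<longlonglongrightarrow> 1} \<in> sets M"
    by (rule convergence_event) measurable
  ultimately show ?thesis by (simp only: W.prob_Collect_eq_1)
qed

end
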